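(* Let $E$ be the Dirichlet energy on $\mathcal{P}_2(S^1)$, $E(\mu)=\frac12\int_{S^1}(\partial_xu)^2\,dx$ if $\mu=u\,dx$ with $u\in H^1(S^1)$, and $E(\mu)=+\infty$ otherwise. Let $\mu=u\,dx$ be a probability measure on $S^1$ with $E(\mu)<c<+\infty$ and $u>m>0$ on $S^1$, where $c$ and $m$ are constants. Then there exists $\lambda=\lambda_{c,m}\in\mathbb{R}$, depending only on $c$ and $m$, such that $E$ is restricted $\lambda$-convex at $\mu$ (with level $c$).
   Context: $S^1=\mathbb{R}/\mathbb{Z}$ with its geodesic distance; $\mathcal{P}_2(S^1)$ is the set of Borel probability measures on $S^1$ with the quadratic Wasserstein distance $W_2$. For absolutely continuous $\mu_0,\mu_1$ let $T$ be the optimal transport map from $\mu_0$ to $\mu_1$, represented so that $|T(x)-x|\le\frac12$ equals the geodesic distance between $x$ and its image; the geodesic from $\mu_0$ to $\mu_1$ is $\mu_s=((1-s)\mathrm{Id}+sT)_\#\mu_0$ (modulo $\mathbb{Z}$), $s\in[0,1]$. $E$ is $\lambda$-convex along a geodesic $\mu_s$ if $E(\mu_s)\le(1-s)E(\mu_0)+sE(\mu_1)-\frac{\lambda}{2}s(1-s)W_2^2(\mu_0,\mu_1)$ for all $s\in[0,1]$. Restricted $\lambda$-convexity: for $\mu$ with $E(\mu)<c<+\infty$, $E$ is restricted $\lambda$-convex at $\mu$ (with level $c$) if there exists $\delta>0$ such that $E$ is $\lambda$-convex along the geodesic connecting any pair $\nu_1,\nu_2\in B_\delta(\mu)\cap E_c$,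 where $B_\delta(\mu)=\{\nu:W_2(\mu,\nu)<\delta\}$ and $E_c=\{\nu:E(\nu)<c\}$. *)

theory Defs
  imports "HOL-Probability.Probability"
begin

section \<open>The circle\<close>

quotient_type circle = real / "\<lambda>x y :: real. x - y \<in> \<int>"
proof (rule equivpI)
  show "reflp (\<lambda>x y :: real. x - y \<in> \<int>)"
    by (simp add: reflp_def)
  show "symp (\<lambda>x y :: real. x - y \<in> \<int>)"
    by (metis (mono_tags, lifting) Ints_minus minus_diff_eq sympI)
  show "transp (\<lambda>x y :: real. x - y \<in> \<int>)"
    by (smt (verit, best) Ints_add transpI)
qed

lift_definition to_circle :: "real \<Rightarrow> circle" is "\<lambda>x. x" .

lemma infdist_Ints: "infdist x \<int> = \<bar>x - of_int (round x)\<bar>" for x :: real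
proof (rule antisym)
  show "infdist x \<int> \<le> \<bar>x - of_int (round x)\<bar>"
    using infdist_le[of "of_int (round x)" \<int> x] by (simp add: dist_real_def)
  have ne: "(\<int> :: real set) \<noteq> {}"
    using Ints_0 by blast
  have "\<bar>x - of_int (round x)\<bar> \<le> dist x a" if "a \<in> \<int>" for a :: real
    using that by (auto elim!: Ints_cases simp: dist_real_def round_diff_minimal)
  then show "\<bar>x - of_int (round x)\<bar> \<le> infdist x \<int>"
    unfolding infdist_notempty[OF ne] by (intro cINF_greatest ne)
qed

lemma infdist_Ints_le: "infdist x \<int> \<le> \<bar>x - of_int k\<bar>" for x :: real
  by (simp add: infdist_Ints round_diff_minimal)

lemma infdist_Ints_le_half: "infdist x \<int> \<le> 1 / 2" for x :: real
  by (metis infdist_Ints abs_minus_commute of_int_round_abs_le)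

lemma infdist_Ints_uminus: "infdist (- x) \<int> = infdist x \<int>" for x :: real
proof -
  have "infdist (- y) \<int> \<le> infdist y \<int>" for y :: real
    using infdist_Ints_le[of "- y" "- round y"] unfolding infdist_Ints[of y] by simp
  from this[of x] this[of "- x"] show ?thesis by simp
qed

lemma infdist_Ints_add: "infdist (x + y) \<int> \<le> infdist x \<int> + infdist y \<int>" for x y :: real
  using infdist_Ints_le[of "x + y" "round x + round y"]
  unfolding infdist_Ints[of x] infdist_Ints[of y] by simp

lemma infdist_Ints_eq_0_iff: "infdist x \<int> = 0 \<longleftrightarrow> x \<in> \<int>" for x :: real
proof
  assume "infdist x \<int> = 0"
  then have "x = of_int (round x)" by (simp add: infdist_Ints)
  then show "x \<in> \<int>" by (metis Ints_of_int)
next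
  assume "x \<in> \<int>"
  then show "infdist x \<int> = 0" by simp
qed

lemma infdist_Ints_cong:
  fixes x y :: real
  assumes "x - y \<in> \<int>"
  shows "infdist x \<int> = infdist y \<int>"
proof -
  have "infdist (x - y) \<int> = 0" "infdist (y - x) \<int> = 0"
    using assms infdist_Ints_uminus[of "x - y"] by simp_all
  then show ?thesis
    using infdist_Ints_add[of "x - y" y] infdist_Ints_add[of "y - x" x] by simp
qed

instantiation circle :: ab_group_add
begin

lift_definition zero_circle :: circle is 0 .

lift_definition plus_circle :: "circle \<Rightarrow> circle \<Rightarrow> circle" is "(+)"
  by (simp add: add_diff_add)

lift_definition uminus_circle :: "circle \<Rightarrow> circle" is uminus
  by (metis Ints_minus minus_diff_minus)

lift_definition minus_circle :: "circle \<Rightarrow> circle \<Rightarrow> circle" is "(-)"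
  by (metis (no_types, opaque_lifting) Ints_diff diff_diff_eq2 diff_add_eq diff_diff_eq add.commute)

instance
  by standard (transfer; simp add: algebra_simps)+

end

text \<open>The geodesic distance between \<open>x\<close> and \<open>y\<close> is the minimum over
  integers \<open>k\<close> of \<open>\<bar>x - y - k\<bar>\<close>.\<close>

instantiation circle :: metric_space
begin

lift_definition dist_circle :: "circle \<Rightarrow> circle \<Rightarrow> real" is "\<lambda>x y. infdist (x - y) \<int>"
proof -
  fix x x' y y' :: real
  assume "x - x' \<in> \<int>" "y - y' \<in> \<int>"
  then have "(x - x') - (y - y') \<in> \<int>" by (rule Ints_diff)
  then have "(x - y) - (x' - y') \<in> \<int>" by (simp add: algebra_simps)
  then show "infdist (x - y) \<int> = infdist (x' - y') \<int>" by (rule infdist_Ints_cong)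
qed

definition uniformity_circle :: "(circle \<times> circle) filter"
  where "uniformity_circle = (INF e\<in>{0<..}. principal {(x, y). dist x y < e})"

definition open_circle :: "circle set \<Rightarrow> bool"
  where "open_circle U \<longleftrightarrow> (\<forall>x\<in>U. \<forall>\<^sub>F (x', y) in uniformity. x' = x \<longrightarrow> y \<in> U)"

instance
proof
  show "uniformity = (INF e\<in>{0<..}. principal {(x :: circle, y). dist x y < e})"
    by (rule uniformity_circle_def)
  show "open U \<longleftrightarrow> (\<forall>x\<in>U. \<forall>\<^sub>F (x', y) in uniformity. x' = x \<longrightarrow> y \<in> U)" for U :: "circle set"
    by (rule open_circle_def)
  show "dist x y = 0 \<longleftrightarrow> x = y" for x y :: circle
    by transfer (rule infdist_Ints_eq_0_iff)
  show "dist x y \<le> dist x z + dist y z" for x y z :: circle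
  proof transfer
    fix x y z :: real
    show "infdist (x - y) \<int> \<le> infdist (x - z) \<int> + infdist (y - z) \<int>"
      using infdist_Ints_add[of "x - z" "z - y"] infdist_Ints_uminus[of "y - z"] by simp
  qed
qed

end

lemma dist_circle_le_half: "dist x y \<le> 1 / 2" for x y :: circle
  by transfer (rule infdist_Ints_le_half)

lemma continuous_to_circle: "continuous_on UNIV to_circle"
proof -
  have "dist (to_circle x) (to_circle y) \<le> dist x y" for x y
    by transfer (use infdist_Ints_le[where k = 0] in \<open>simp add: dist_real_def\<close>)
  then show ?thesis
    unfolding continuous_on_iff by (meson le_less_trans)
qed

lemma measurable_to_circle [measurable]: "to_circle \<in> borel_measurable borel"
  using continuous_to_circle by (rule borel_measurable_continuous_onI)

definition lebesgue_circle :: "circle measure"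
  where "lebesgue_circle = distr (restrict_space lborel {0..<1}) borel to_circle"

section \<open>The quadratic Wasserstein distance and geodesics\<close>

text \<open>The circle is bounded, so there is no second moment condition.\<close>

definition P2 :: "circle measure set"
  where "P2 = {\<mu>. sets \<mu> = sets borel \<and> prob_space \<mu>}"

definition couplings :: "circle measure \<Rightarrow> circle measure \<Rightarrow> (circle \<times> circle) measure set"
  where "couplings \<mu> \<nu> =
    {\<pi>. sets \<pi> = sets borel \<and> distr \<pi> borel fst = \<mu> \<and> distr \<pi> borel snd = \<nu>}"

definition W2 :: "circle measure \<Rightarrow> circle measure \<Rightarrow> real"
  where "W2 \<mu> \<nu> = sqrt (INF \<pi>\<in>couplings \<mu> \<nu>. \<integral>p. (dist (fst p) (snd p))\<^sup>2 \<partial>\<pi>)"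

definition optimal_map :: "circle measure \<Rightarrow> circle measure \<Rightarrow> (circle \<Rightarrow> circle) \<Rightarrow> bool"
  where "optimal_map \<mu> \<nu> T \<longleftrightarrow>
    T \<in> borel_measurable borel \<and> distr \<mu> borel T = \<nu> \<and>
    (\<integral>x. (dist x (T x))\<^sup>2 \<partial>\<mu>) = (W2 \<mu> \<nu>)\<^sup>2"

text \<open>\<open>v\<close> is the real-valued displacement \<open>T(x) - x\<close> for the representation of \<open>T\<close> in which
  \<open>\<bar>T(x) - x\<bar>\<close> is the geodesic distance from \<open>x\<close> to its image (hence at most \<open>1/2\<close>).\<close>

definition displacement :: "(circle \<Rightarrow> circle) \<Rightarrow> (circle \<Rightarrow> real) \<Rightarrow> bool"
  where "displacement T v \<longleftrightarrow>
    v \<in> borel_measurable borel \<and>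
    (\<forall>x. T x = x + to_circle (v x) \<and> \<bar>v x\<bar> = dist x (T x))"

text \<open>With \<open>T(x) = x + v(x)\<close> we have \<open>(1 - s) x + s T(x) = x + s v(x)\<close>.\<close>

definition wasserstein_geodesic ::
    "circle measure \<Rightarrow> circle measure \<Rightarrow> (real \<Rightarrow> circle measure) \<Rightarrow> bool"
  where "wasserstein_geodesic \<mu>\<^sub>0 \<mu>\<^sub>1 \<gamma> \<longleftrightarrow>
    absolutely_continuous lebesgue_circle \<mu>\<^sub>0 \<and> absolutely_continuous lebesgue_circle \<mu>\<^sub>1 \<and>
    (\<exists>T v. optimal_map \<mu>\<^sub>0 \<mu>\<^sub>1 T \<and> displacement T v \<and>
      (\<forall>s\<in>{0..1}. \<gamma> s = distr \<mu>\<^sub>0 borel (\<lambda>x. x + to_circle (s * v x))))"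

section \<open>Convexity along geodesics\<close>

definition convex_along :: "(circle measure \<Rightarrow> ereal) \<Rightarrow> real \<Rightarrow> (real \<Rightarrow> circle measure) \<Rightarrow> bool"
  where "convex_along E lam \<gamma> \<longleftrightarrow>
    (\<forall>s\<in>{0..1}. E (\<gamma> s) \<le> ereal (1 - s) * E (\<gamma> 0) + ereal s * E (\<gamma> 1)
       - ereal (lam / 2 * s * (1 - s) * (W2 (\<gamma> 0) (\<gamma> 1))\<^sup>2))"

definition restricted_convex ::
    "(circle measure \<Rightarrow> ereal) \<Rightarrow> real \<Rightarrow> real \<Rightarrow> circle measure \<Rightarrow> bool"
  where "restricted_convex E lam c \<mu> \<longleftrightarrow>
    (\<exists>\<delta>>0. \<forall>\<nu>\<^sub>1 \<in> P2. \<forall>\<nu>\<^sub>2 \<in> P2.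
      W2 \<mu> \<nu>\<^sub>1 < \<delta> \<longrightarrow> E \<nu>\<^sub>1 < ereal c \<longrightarrow> W2 \<mu> \<nu>\<^sub>2 < \<delta> \<longrightarrow> E \<nu>\<^sub>2 < ereal c \<longrightarrow>
      (\<forall>\<gamma>. wasserstein_geodesic \<nu>\<^sub>1 \<nu>\<^sub>2 \<gamma> \<longrightarrow> convex_along E lam \<gamma>))"

section \<open>The Dirichlet energy\<close>

definition L2_circle :: "(circle \<Rightarrow> real) set"
  where "L2_circle = {u \<in> borel_measurable borel. integrable lebesgue_circle (\<lambda>x. (u x)\<^sup>2)}"

text \<open>Test functions on the circle, as 1-periodic smooth functions on the line.\<close>

definition test_functions :: "(real \<Rightarrow> real) set"
  where "test_functions =
    {\<phi>. (\<forall>x. \<phi> (x + 1) = \<phi> x) \<and> (\<forall>n x. ((deriv ^^ n) \<phi>) differentiable (at x))}"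

definition is_weak_deriv :: "(circle \<Rightarrow> real) \<Rightarrow> (circle \<Rightarrow> real) \<Rightarrow> bool"
  where "is_weak_deriv u g \<longleftrightarrow>
    (\<forall>\<phi>\<in>test_functions.
      (LINT x:{0..<1}|lborel. u (to_circle x) * deriv \<phi> x) =
      - (LINT x:{0..<1}|lborel. g (to_circle x) * \<phi> x))"

definition H1_circle :: "(circle \<Rightarrow> real) set"
  where "H1_circle = {u \<in> L2_circle. \<exists>g\<in>L2_circle. is_weak_deriv u g}"

definition weak_deriv :: "(circle \<Rightarrow> real) \<Rightarrow> circle \<Rightarrow> real"
  where "weak_deriv u = (SOME g. g \<in> L2_circle \<and> is_weak_deriv u g)"

text \<open>\<open>\<mu> = u dx\<close>. The sign condition is needed because \<open>ennreal\<close> truncates negative values.\<close>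

definition has_density :: "circle measure \<Rightarrow> (circle \<Rightarrow> real) \<Rightarrow> bool"
  where "has_density \<mu> u \<longleftrightarrow>
    u \<in> borel_measurable borel \<and> (AE x in lebesgue_circle. 0 \<le> u x) \<and>
    \<mu> = density lebesgue_circle (\<lambda>x. ennreal (u x))"

text \<open>The choices of \<open>u\<close> and of its weak derivative are immaterial: both are unique up to null
  sets.\<close>

definition dirichlet_energy :: "circle measure \<Rightarrow> ereal"
  where "dirichlet_energy \<mu> =
    (if \<exists>u\<in>H1_circle. has_density \<mu> u
     then let u = (SOME u. u \<in> H1_circle \<and> has_density \<mu> u)
          in ereal (1 / 2 * (\<integral>x. (weak_deriv u x)\<^sup>2 \<partial>lebesgue_circle))
     else \<infinity>)"

end

theory Submission
  imports Defs
begin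

text \<open>
  In Lagrangian coordinates a measure \<open>\<nu>\<close> with a positive \<open>H\<^sup>1\<close> density is the law of a quantile
  map \<open>X\<close> on the unit interval, and its Dirichlet energy is \<open>1/2 \<integral> X''\<^sup>2 / X'\<^sup>5\<close>. The Wasserstein
  geodesic between two such measures is the affine interpolation of suitably shifted quantile maps
  \<open>X\<close>, \<open>Y\<close>, and the squared distance is \<open>\<integral> v\<^sup>2\<close> with \<open>v = Y - X\<close>. Pointwise, the second
  derivative in \<open>s\<close> of the energy density along the geodesic is at least
  \<open>v''\<^sup>2 / p\<^sup>5 - 70 a\<^sup>2 v'\<^sup>2 / p\<^sup>7\<close>, where \<open>p\<close> and \<open>a\<close> interpolate \<open>X'\<close>, \<open>Y'\<close> and \<open>X''\<close>, \<open>Y''\<close>.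
  The bounds on the densities and energies control the second term by \<open>sup v'\<^sup>2\<close>, which
  interpolation between \<open>\<integral> v''\<^sup>2\<close> and \<open>\<integral> v\<^sup>2\<close> absorbs at the cost of a multiple of the squared
  distance. The lower bound \<open>u > m\<close> passes to nearby measures because smallness of \<open>W2\<close> and bounded
  energy force the densities to be uniformly close.
\<close>

section \<open>The circle\<close>

text \<open>Two features of the circle shape the proof. A measure determines its quantile map only
  up to a shift of the parameter, and the shift decides whether pairing two such maps is optimal.
  The right one makes the integral of x - S x over a period vanish, S being the induced map of the
  line: only then does a Kantorovich potential with derivative 2 (x - S x) descend to the circle.
  Moreover \<open>wasserstein_geodesic\<close> admits any optimal map and any admissible
  displacement, so both must be identified: duality makes every optimal map agree with S almost
  everywhere, and a bound of 1/4 on the displacement excludes the antipodal ambiguity. Closeness of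
  the densities thus serves twice, for their lower bound and for this 1/4.

  The energy is defined through choice operators, whence the uniqueness theory for weak derivatives.
  In the final estimate the interpolation parameter t is tuned so that the bad multiple of the
  integral of v''^2 cancels the good one exactly; the remaining multiple of the squared distance, of
  order 1 / t^3, yields \<lambda>.\<close>

lemma to_circle_eq_iff: "to_circle x = to_circle y \<longleftrightarrow> x - y \<in> \<int>"
  by transfer (rule refl)

lemma to_circle_add: "to_circle (x + y) = to_circle x + to_circle y"
  by transfer simp

lemma to_circle_add_1 [simp]: "to_circle (x + 1) = to_circle x"
  by (simp add: to_circle_eq_iff)

lemma to_circle_add_int [simp]: "to_circle (x + of_int k) = to_circle x"
  by (simp add: to_circle_eq_iff)

lemma dist_to_circle: "dist (to_circle x) (to_circle y) = infdist (x - y) \<int>"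
  by transfer (rule refl)

lemma dist_to_circle_le: "dist (to_circle x) (to_circle y) \<le> \<bar>x - y\<bar>"
  using infdist_Ints_le[of "x - y" 0] by (simp add: dist_to_circle)

lemma dist_to_circle_eq: "\<bar>x - y\<bar> \<le> 1 / 2 \<Longrightarrow> dist (to_circle x) (to_circle y) = \<bar>x - y\<bar>"
proof -
  assume a: "\<bar>x - y\<bar> \<le> 1 / 2"
  have "\<bar>x - y\<bar> \<le> \<bar>x - y - of_int (round (x - y))\<bar>"
  proof (cases "round (x - y) = 0")
    case False
    then have "\<bar>of_int (round (x - y)) :: real\<bar> \<ge> 1"
      by linarith
    then show ?thesis using a by linarith
  qed simp
  then show ?thesis
    using dist_to_circle_le[of x y] unfolding dist_to_circle infdist_Ints by simp
qed

lemma to_circle_window: "\<exists>x. a \<le> x \<and> x < a + 1 \<and> to_circle x = p"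
proof -
  obtain y where y: "p = to_circle y"
    by (metis (no_types) Quotient_circle Quotient_def to_circle_def eq_id_iff id_apply o_apply map_fun_apply)
  define k where "k = \<lfloor>y - a\<rfloor>"
  have "to_circle (y - of_int k) = p"
    by (simp add: y to_circle_eq_iff)
  moreover have "a \<le> y - of_int k" "y - of_int k < a + 1"
    unfolding k_def by linarith+
  ultimately show ?thesis by blast
qed

text \<open>Rounding picks the lift of q nearest to x. This is how statements about the distance on
  the circle are pulled back to the line.\<close>

lemma to_circle_near: "\<exists>y. q = to_circle y \<and> \<bar>x - y\<bar> = dist (to_circle x) q"
proof -
  obtain y where y: "q = to_circle y"
    using to_circle_window by metis
  have "q = to_circle (y + of_int (round (x - y)))"
    by (simp add: y)
  moreover have "\<bar>x - (y + of_int (round (x - y)))\<bar> = dist (to_circle x) q"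
    unfolding y dist_to_circle infdist_Ints by (simp add: algebra_simps)
  ultimately show ?thesis by blast
qed

text \<open>Every point q at distance less than e from the image of x has a lift at the same
  distance from x, so the projection is an open map. Openness gives both a countable basis and the
  descent of continuity to the circle.\<close>

lemma open_to_circle_image: "open U \<Longrightarrow> open (to_circle ` U)"
  unfolding open_dist
proof safe
  fix x assume U: "\<forall>x\<in>U. \<exists>e>0. \<forall>y. dist y x < e \<longrightarrow> y \<in> U" and x: "x \<in> U"
  then obtain e where e: "e > 0" "\<And>y. dist y x < e \<Longrightarrow> y \<in> U" by blast
  show "\<exists>e>0. \<forall>y. dist y (to_circle x) < e \<longrightarrow> y \<in> to_circle ` U"
  proof (intro exI conjI allI impI)
    show "e > 0" by fact
    fix q assume "dist q (to_circle x) < e"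
    moreover obtain y where "q = to_circle y" "\<bar>x - y\<bar> = dist (to_circle x) q"
      using to_circle_near by blast
    ultimately show "q \<in> to_circle ` U"
      using e(2)[of y] by (auto simp: dist_real_def dist_commute abs_minus_commute)
  qed
qed

text \<open>Second countability identifies the Borel sets of the product of two circles with the
  product sigma-algebra, which is needed to handle couplings and pairs of measurable maps.\<close>

instance circle :: second_countable_topology
proof
  obtain B :: "real set set" where B: "countable B" "topological_basis B"
    using ex_countable_basis by blast
  have "topological_basis ((`) to_circle ` B)"
  proof (rule topological_basisI)
    show "open B'" if "B' \<in> (`) to_circle ` B" for B'
      using that B(2) open_to_circle_image topological_basis_open by auto
    fix O' and p :: circle assume O': "open O'" "p \<in> O'"
    obtain x where x: "p = to_circle x"
      using to_circle_window by metis
    have "open (to_circle -` O')"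
      using O'(1) continuous_to_circle by (simp add: open_vimage)
    moreover have "x \<in> to_circle -` O'" using O' x by simp
    ultimately obtain b where "b \<in> B" "x \<in> b" "b \<subseteq> to_circle -` O'"
      by (rule topological_basisE[OF B(2)])
    then show "\<exists>B'\<in>(`) to_circle ` B. p \<in> B' \<and> B' \<subseteq> O'"
      using x by (intro bexI[of _ "to_circle ` b"]) auto
  qed
  then show "\<exists>B::circle set set. countable B \<and> open = generate_topology B"
    using B(1) topological_basis_imp_subbasis by blast
qed

lemma compact_circle: "compact (UNIV :: circle set)"
proof -
  have "to_circle ` {0..1} = UNIV"
  proof (rule set_eqI, simp)
    fix p show "p \<in> to_circle ` {0..1}"
      using to_circle_window[of 0 p] by force
  qed
  then show ?thesis
    using compact_continuous_image[OF continuous_on_subset[OF continuous_to_circle subset_UNIV] compact_Icc[of 0 1]]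
    by simp
qed

lemma continuous_on_circle:
  fixes f :: "circle \<Rightarrow> 'a::topological_space"
  assumes "continuous_on UNIV (\<lambda>x. f (to_circle x))"
  shows "continuous_on UNIV f"
  unfolding continuous_on_open_vimage[OF open_UNIV]
proof safe
  fix B :: "'a set" assume "open B"
  then have "open ((\<lambda>x. f (to_circle x)) -` B)"
    using assms by (simp add: open_vimage)
  then have "open (to_circle ` ((\<lambda>x. f (to_circle x)) -` B))"
    by (rule open_to_circle_image)
  also have "to_circle ` ((\<lambda>x. f (to_circle x)) -` B) = f -` B"
  proof (rule set_eqI)
    fix p
    obtain x where "p = to_circle x" using to_circle_window by metis
    then show "p \<in> to_circle ` ((\<lambda>x. f (to_circle x)) -` B) \<longleftrightarrow> p \<in> f -` B" by auto
  qed
  finally show "open (f -` B \<inter> UNIV)" by simp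
qed

text \<open>The Borel section of the projection with values in [0, 1). Functions on the circle are
  written as periodic functions of this representative, and \<open>circle_rep_periodic\<close>
  removes it again.\<close>

lift_definition circle_rep :: "circle \<Rightarrow> real" is frac
proof -
  fix x y :: real assume "x - y \<in> \<int>"
  then obtain k where "x = y + of_int k" by (auto elim!: Ints_cases simp: algebra_simps)
  then show "frac x = frac y" by (simp add: frac_def)
qed

lemma to_circle_rep [simp]: "to_circle (circle_rep p) = p"
  by transfer (simp add: frac_def)

lemma circle_rep_eq: "0 \<le> x \<Longrightarrow> x < 1 \<Longrightarrow> circle_rep (to_circle x) = x"
  by transfer (simp add: frac_eq)

lemma circle_rep_shift: "\<exists>k. circle_rep (to_circle x) = x + of_int k"
  by transfer (simp add: frac_def, metis diff_conv_add_uminus of_int_minus)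

lemma periodic_add_int:
  fixes f :: "real \<Rightarrow> 'a"
  assumes "\<And>x. f (x + 1) = f x"
  shows "f (x + of_int k) = f x"
proof -
  have *: "f (x + of_nat n) = f x" for x n
    by (induction n) (simp_all, metis add.assoc add.commute assms)
  show ?thesis
  proof (cases "k \<ge> 0")
    case True then show ?thesis using *[of x "nat k"] by simp
  next
    case False then show ?thesis using *[of "x + of_int k" "nat (-k)"] by simp
  qed
qed

lemma circle_rep_periodic:
  fixes f :: "real \<Rightarrow> 'a"
  assumes "\<And>x. f (x + 1) = f x"
  shows "f (circle_rep (to_circle x)) = f x"
  using circle_rep_shift[of x] periodic_add_int[of f, OF assms] by metis

lemma circle_rep_measurable [measurable]: "circle_rep \<in> borel_measurable borel"
proof (rule borel_measurableI_less)
  fix a :: real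
  have "{p \<in> space borel. circle_rep p < a} =
     (if a \<le> 0 then {} else {to_circle 0} \<union> to_circle ` {0<..<min a 1})"
    (is "?L = ?R")
  proof (rule set_eqI)
    fix p
    obtain x where x: "0 \<le> x" "x < 1" "p = to_circle x"
      using to_circle_window[of 0 p] by auto
    have eq: "x = y" if "to_circle x = to_circle y" "0 \<le> y" "y < 1" for y
      using that x circle_rep_eq by metis
    show "p \<in> ?L \<longleftrightarrow> p \<in> ?R"
      using x eq by (cases "x = 0") (force simp: circle_rep_eq)+
  qed
  moreover have "?R \<in> sets borel"
    by (auto intro!: borel_open open_to_circle_image sets.insert_in_sets borel_singleton)
  ultimately show "{p \<in> space borel. circle_rep p < a} \<in> sets borel" by simp
qed

section \<open>Integration over the circle\<close>

lemma sets_lebesgue_circle [measurable_cong, simp]: "sets lebesgue_circle = sets borel"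
  and space_lebesgue_circle [simp]: "space lebesgue_circle = UNIV"
  by (simp_all add: lebesgue_circle_def)

lemma nn_integral_lebesgue_circle:
  assumes [measurable]: "f \<in> borel_measurable borel"
  shows "(\<integral>\<^sup>+x. f x \<partial>lebesgue_circle) = (\<integral>\<^sup>+x. f (to_circle x) * indicator {0..<1} x \<partial>lborel)"
  unfolding lebesgue_circle_def
  by (subst nn_integral_distr)
     (auto simp: nn_integral_restrict_space intro!: measurable_restrict_space1)

lemma nn_integral_lborel_translate:
  fixes f :: "real \<Rightarrow> ennreal"
  assumes [measurable]: "f \<in> borel_measurable borel"
  shows "(\<integral>\<^sup>+x. f (x + t) \<partial>lborel) = (\<integral>\<^sup>+x. f x \<partial>lborel)"
  using nn_integral_real_affine[of f 1 t] by (simp add: add.commute)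

text \<open>Cut [0, 1) at the fractional part of a, move the left piece by 1, then translate by an
  integer. Windows at arbitrary positions are needed because a lift X sends [0, 1] to a window
  starting at X 0, and because arguments local at a point want that point in the interior.\<close>

lemma nn_integral_lebesgue_circle_window:
  fixes a :: real
  assumes [measurable]: "f \<in> borel_measurable borel"
  shows "(\<integral>\<^sup>+x. f x \<partial>lebesgue_circle) = (\<integral>\<^sup>+x. f (to_circle x) * indicator {a..a+1} x \<partial>lborel)"
proof -
  define k where "k = \<lfloor>a\<rfloor>"
  define r where "r = a - of_int k"
  have r: "0 \<le> r" "r < 1" unfolding r_def k_def by linarith+
  have "(\<integral>\<^sup>+x. f (to_circle x) * indicator {0..<1} x \<partial>lborel) =
    (\<integral>\<^sup>+x. f (to_circle x) * indicator {r..<1} x + f (to_circle x) * indicator {0..<r} x \<partial>lborel)"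
    using r by (intro nn_integral_cong) (auto split: split_indicator)
  also have "\<dots> = (\<integral>\<^sup>+x. f (to_circle x) * indicator {r..<1} x \<partial>lborel)
     + (\<integral>\<^sup>+x. f (to_circle x) * indicator {0..<r} x \<partial>lborel)"
    by (intro nn_integral_add) auto
  also have "(\<integral>\<^sup>+x. f (to_circle x) * indicator {0..<r} x \<partial>lborel) =
    (\<integral>\<^sup>+x. f (to_circle (x + (-1))) * indicator {0..<r} (x + (-1)) \<partial>lborel)"
    by (rule nn_integral_lborel_translate[symmetric]) simp
  also have "\<dots> = (\<integral>\<^sup>+x. f (to_circle x) * indicator {1..<1+r} x \<partial>lborel)"
    using to_circle_add_int[of _ "-1"]
    by (intro nn_integral_cong) (auto split: split_indicator)
  also have "(\<integral>\<^sup>+x. f (to_circle x) * indicator {r..<1} x \<partial>lborel) + \<dots> =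
     (\<integral>\<^sup>+x. f (to_circle x) * indicator {r..<1} x + f (to_circle x) * indicator {1..<1+r} x \<partial>lborel)"
    by (intro nn_integral_add[symmetric]) auto
  also have "\<dots> = (\<integral>\<^sup>+x. f (to_circle x) * indicator {r..<r+1} x \<partial>lborel)"
    using r by (intro nn_integral_cong) (auto split: split_indicator)
  also have "\<dots> = (\<integral>\<^sup>+x. f (to_circle (x + of_int (-k))) * indicator {r..<r+1} (x + of_int (-k)) \<partial>lborel)"
    by (rule nn_integral_lborel_translate[symmetric]) simp
  also have "\<dots> = (\<integral>\<^sup>+x. f (to_circle x) * indicator {a..<a+1} x \<partial>lborel)"
    unfolding to_circle_add_int
    by (intro nn_integral_cong) (auto split: split_indicator simp: r_def)
  also have "\<dots> = (\<integral>\<^sup>+x. f (to_circle x) * indicator {a..a+1} x \<partial>lborel)"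
    by (intro nn_integral_cong_AE eventually_mono[OF AE_lborel_singleton[of "a + 1"]])
       (auto split: split_indicator)
  finally show ?thesis
    by (simp add: nn_integral_lebesgue_circle)
qed

lemma integrable_lebesgue_circle_window:
  fixes a :: real and f :: "circle \<Rightarrow> real"
  assumes [measurable]: "f \<in> borel_measurable borel"
  shows "integrable lebesgue_circle f \<longleftrightarrow> set_integrable lborel {a..a+1} (\<lambda>x. f (to_circle x))"
proof -
  have "(\<integral>\<^sup>+x. norm (f x) \<partial>lebesgue_circle) =
     (\<integral>\<^sup>+x. norm (indicator {a..a+1} x *\<^sub>R f (to_circle x)) \<partial>lborel)"
    by (subst nn_integral_lebesgue_circle_window[where a = a])
       (auto intro!: nn_integral_cong split: split_indicator)
  then show ?thesis
    unfolding set_integrable_def integrable_iff_bounded by simp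
qed

lemma integral_lebesgue_circle_window:
  fixes a :: real and f :: "circle \<Rightarrow> real"
  assumes [measurable]: "f \<in> borel_measurable borel"
  shows "(\<integral>x. f x \<partial>lebesgue_circle) = (LINT x:{a..a+1}|lborel. f (to_circle x))"
proof (cases "integrable lebesgue_circle f")
  case True
  then have i: "integrable lborel (\<lambda>x. indicator {a..a+1} x *\<^sub>R f (to_circle x))"
    by (simp add: integrable_lebesgue_circle_window[where a = a] set_integrable_def)
  have 1: "(\<integral>\<^sup>+x. ennreal (f x) \<partial>lebesgue_circle) =
     (\<integral>\<^sup>+x. ennreal (indicator {a..a+1} x *\<^sub>R f (to_circle x)) \<partial>lborel)"
    by (subst nn_integral_lebesgue_circle_window[where a = a])
       (auto intro!: nn_integral_cong split: split_indicator)
  have 2: "(\<integral>\<^sup>+x. ennreal (- f x) \<partial>lebesgue_circle) =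
     (\<integral>\<^sup>+x. ennreal (- (indicator {a..a+1} x *\<^sub>R f (to_circle x))) \<partial>lborel)"
    by (subst nn_integral_lebesgue_circle_window[where a = a])
       (auto intro!: nn_integral_cong split: split_indicator)
  show ?thesis
    unfolding set_lebesgue_integral_def real_lebesgue_integral_def[OF True] real_lebesgue_integral_def[OF i] 1 2 ..
next
  \<comment> \<open>Both integrals then take the default value 0.\<close>
  case False
  then have "\<not> integrable lborel (\<lambda>x. indicator {a..a+1} x *\<^sub>R f (to_circle x))"
    by (simp add: integrable_lebesgue_circle_window[where a = a] set_integrable_def)
  with False show ?thesis
    by (simp add: set_lebesgue_integral_def not_integrable_integral_eq)
qed

lemma prob_space_lebesgue_circle: "prob_space lebesgue_circle"
  by standard (simp add: lebesgue_circle_def emeasure_distr emeasure_restrict_space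
      measurable_restrict_space1 space_restrict_space)

section \<open>Absolutely continuous functions on the line\<close>

lemma set_integral_combine:
  fixes f :: "real \<Rightarrow> real"
  assumes "a \<le> b" "b \<le> c" and f: "set_integrable lborel {a..c} f"
  shows "(LINT x:{a..c}|lborel. f x) = (LINT x:{a..b}|lborel. f x) + (LINT x:{b..c}|lborel. f x)"
proof -
  have "set_integrable lborel {a..b} f" "set_integrable lborel {b..c} f"
    using assms by (auto intro: set_integrable_subset)
  then show ?thesis
    using Henstock_Kurzweil_Integration.integral_combine[OF assms(1,2), of f] f
    by (simp add: set_borel_integral_eq_integral)
qed

lemma set_integrable_continuous_mult:
  fixes f h :: "real \<Rightarrow> real"
  assumes f: "set_integrable lborel {a..b} f" and h: "continuous_on {a..b} h"
  shows "set_integrable lborel {a..b} (\<lambda>x. h x * f x)"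
proof -
  obtain B where B: "\<And>x. x \<in> {a..b} \<Longrightarrow> norm (h x) \<le> B"
    using compact_imp_bounded[OF compact_continuous_image[OF h compact_Icc]]
    unfolding bounded_iff by (metis imageI)
  have hm: "(\<lambda>x. indicator {a..b} x *\<^sub>R h x) \<in> borel_measurable borel"
    using h by (intro borel_measurable_continuous_on_indicator) auto
  have fm: "(\<lambda>x. indicator {a..b} x *\<^sub>R f x) \<in> borel_measurable lborel"
    using f unfolding set_integrable_def by auto
  have "integrable lborel (\<lambda>x. (indicator {a..b} x *\<^sub>R h x) * (indicator {a..b} x *\<^sub>R f x))"
  proof (rule Bochner_Integration.integrable_bound)
    show "integrable lborel (\<lambda>x. B * (indicator {a..b} x *\<^sub>R f x))"
      using f unfolding set_integrable_def by (intro integrable_mult_right) auto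
    show "(\<lambda>x. (indicator {a..b} x *\<^sub>R h x) * (indicator {a..b} x *\<^sub>R f x)) \<in> borel_measurable lborel"
      using hm fm by (intro borel_measurable_times) auto
    show "AE x in lborel. norm ((indicator {a..b} x *\<^sub>R h x) * (indicator {a..b} x *\<^sub>R f x))
        \<le> norm (B * (indicator {a..b} x *\<^sub>R f x))"
    proof (rule AE_I2)
      fix x
      show "norm ((indicator {a..b} x *\<^sub>R h x) * (indicator {a..b} x *\<^sub>R f x))
        \<le> norm (B * (indicator {a..b} x *\<^sub>R f x))"
      proof (cases "x \<in> {a..b}")
        case True
        then have "\<bar>h x\<bar> \<le> \<bar>B\<bar>" using B[of x] by simp
        then show ?thesis using True by (simp add: abs_mult mult_right_mono)
      qed simp
    qed
  qed
  then show ?thesis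
    unfolding set_integrable_def
    by (rule back_subst[of "integrable lborel"]) (auto split: split_indicator)
qed

lemma set_integrable_continuous:
  fixes f :: "real \<Rightarrow> real"
  shows "continuous_on {a..b} f \<Longrightarrow> set_integrable lborel {a..b} f"
  unfolding set_integrable_def by (rule borel_integrable_compact) auto

lemma set_integrable_bounded:
  fixes f :: "real \<Rightarrow> real"
  assumes "f \<in> borel_measurable borel" "set_integrable lborel {a..b} g"
    and "\<And>x. x \<in> {a..b} \<Longrightarrow> \<bar>f x\<bar> \<le> g x"
  shows "set_integrable lborel {a..b} f"
proof -
  have "integrable lborel (\<lambda>x. indicator {a..b} x *\<^sub>R g x)"
    using assms(2) by (simp add: set_integrable_def)
  then show ?thesis unfolding set_integrable_def
  proof (rule Bochner_Integration.integrable_bound)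
    show "(\<lambda>x. indicator {a..b} x *\<^sub>R f x) \<in> borel_measurable lborel" using assms(1) by simp
    show "AE x in lborel. norm (indicator {a..b} x *\<^sub>R f x) \<le> norm (indicator {a..b} x *\<^sub>R g x)"
      using assms(3) by (intro AE_I2) (force split: split_indicator)
  qed
qed

lemma set_integrable_if_square:
  fixes f :: "real \<Rightarrow> real"
  assumes "f \<in> borel_measurable borel" "set_integrable lborel {a..b} (\<lambda>x. (f x)\<^sup>2)"
  shows "set_integrable lborel {a..b} f"
proof (rule set_integrable_bounded[OF assms(1)])
  show "set_integrable lborel {a..b} (\<lambda>x. 1 + (f x)\<^sup>2)"
    by (rule set_integral_add(1)[OF set_integrable_continuous[OF continuous_on_const] assms(2)])
  fix x
  have "0 \<le> (\<bar>f x\<bar> - 1)\<^sup>2" by simp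
  then show "\<bar>f x\<bar> \<le> 1 + (f x)\<^sup>2" by (simp add: power2_diff)
qed

lemma set_integrable_mult_if_square:
  fixes f g :: "real \<Rightarrow> real"
  assumes "f \<in> borel_measurable borel" "set_integrable lborel {a..b} (\<lambda>x. (f x)\<^sup>2)"
    "g \<in> borel_measurable borel" "set_integrable lborel {a..b} (\<lambda>x. (g x)\<^sup>2)"
  shows "set_integrable lborel {a..b} (\<lambda>x. f x * g x)"
proof (rule set_integrable_bounded)
  show "set_integrable lborel {a..b} (\<lambda>x. (f x)\<^sup>2 + (g x)\<^sup>2)"
    by (rule set_integral_add(1)[OF assms(2,4)])
  show "(\<lambda>x. f x * g x) \<in> borel_measurable borel" using assms by simp
  fix x
  show "\<bar>f x * g x\<bar> \<le> (f x)\<^sup>2 + (g x)\<^sup>2"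
  proof -
    have "2 * (\<bar>f x\<bar> * \<bar>g x\<bar>) \<le> (f x)\<^sup>2 + (g x)\<^sup>2"
      using sum_squares_bound[of "\<bar>f x\<bar>" "\<bar>g x\<bar>"] by (simp add: mult.assoc)
    moreover have "0 \<le> \<bar>f x\<bar> * \<bar>g x\<bar>" by simp
    ultimately show ?thesis unfolding abs_mult by linarith
  qed
qed

lemma set_integral_abs_le:
  fixes f :: "real \<Rightarrow> real"
  assumes "set_integrable lborel {a..b} f"
  shows "\<bar>LINT x:{a..b}|lborel. f x\<bar> \<le> (LINT x:{a..b}|lborel. \<bar>f x\<bar>)"
  using set_integral_norm_bound[OF assms] by simp

text \<open>Local absolute continuity, encoded by the fundamental theorem of calculus rather than by
  epsilon-delta or differentiability almost everywhere. Here g is a fixed Borel representative of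
  the derivative, so two different g may belong to the same U.\<close>

definition ac_deriv :: "(real \<Rightarrow> real) \<Rightarrow> (real \<Rightarrow> real) \<Rightarrow> bool"
  where "ac_deriv U g \<longleftrightarrow> g \<in> borel_measurable borel \<and>
    (\<forall>a b. a \<le> b \<longrightarrow> set_integrable lborel {a..b} g \<and> (LINT x:{a..b}|lborel. g x) = U b - U a)"

lemma ac_derivD:
  assumes "ac_deriv U g"
  shows "g \<in> borel_measurable borel" "set_integrable lborel {a..b} g"
    "a \<le> b \<Longrightarrow> (LINT x:{a..b}|lborel. g x) = U b - U a"
proof -
  show "set_integrable lborel {a..b} g"
    using assms by (cases "a \<le> b") (auto simp: ac_deriv_def set_integrable_def)
qed (use assms in \<open>auto simp: ac_deriv_def\<close>)

lemma ac_deriv_continuous: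
  assumes "ac_deriv U g"
  shows "continuous_on S U"
proof -
  have "isCont U x" for x
  proof -
    have "continuous_on {x-1..x+1} (\<lambda>t. integral {x-1..t} g)"
      using set_borel_integral_eq_integral(1)[OF ac_derivD(2)[OF assms]]
      by (rule indefinite_integral_continuous_1)
    then have "continuous_on {x-1..x+1} (\<lambda>t. U (x-1) + integral {x-1..t} g)"
      by (intro continuous_intros)
    moreover have "U (x-1) + integral {x-1..t} g = U t" if "t \<in> {x-1..x+1}" for t
      using that ac_derivD(3)[OF assms, of "x-1" t]
        set_borel_integral_eq_integral(2)[OF ac_derivD(2)[OF assms, of "x-1" t]] by simp
    ultimately have "continuous_on {x-1..x+1} U"
      by (subst continuous_on_cong[OF refl]) (auto elim: continuous_on_eq)
    then show ?thesis
      by (rule continuous_on_interior) auto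
  qed
  then show ?thesis by (simp add: continuous_at_imp_continuous_on)
qed

lemma ac_deriv_C1:
  assumes "\<And>x. (U has_real_derivative g x) (at x)" "continuous_on UNIV g"
  shows "ac_deriv U g"
  unfolding ac_deriv_def
proof (intro conjI allI impI)
  show "g \<in> borel_measurable borel" using assms(2) by (rule borel_measurable_continuous_onI)
  fix a b :: real assume "a \<le> b"
  show i: "set_integrable lborel {a..b} g"
    using assms(2) by (intro set_integrable_continuous continuous_on_subset[OF assms(2)]) auto
  have "(g has_integral U b - U a) {a..b}"
    using \<open>a \<le> b\<close> assms(1)
    by (intro fundamental_theorem_of_calculus)
       (auto simp: has_real_derivative_iff_has_vector_derivative[symmetric] intro: has_field_derivative_at_within)
  then show "(LINT x:{a..b}|lborel. g x) = U b - U a"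
    using set_borel_integral_eq_integral(2)[OF i] by (simp add: integral_unique)
qed

lemma ac_deriv_add:
  assumes "ac_deriv U g" "ac_deriv V h"
  shows "ac_deriv (\<lambda>x. U x + V x) (\<lambda>x. g x + h x)"
proof -
  have "set_integrable lborel {a..b} (\<lambda>x. g x + h x) \<and>
      (LINT x:{a..b}|lborel. g x + h x) = (U b + V b) - (U a + V a)" if "a \<le> b" for a b
    using set_integral_add[OF ac_derivD(2)[OF assms(1)] ac_derivD(2)[OF assms(2)], of a b]
      ac_derivD(3)[OF assms(1) that] ac_derivD(3)[OF assms(2) that] by simp
  then show ?thesis
    using ac_derivD(1)[OF assms(1)] ac_derivD(1)[OF assms(2)] by (simp add: ac_deriv_def)
qed

lemma ac_deriv_cmult:
  assumes "ac_deriv U g"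
  shows "ac_deriv (\<lambda>x. c * U x) (\<lambda>x. c * g x)"
  using assms unfolding ac_deriv_def by (auto simp: right_diff_distrib)

text \<open>Segments rather than intervals, because the endpoints will be values U p and U q whose
  order is unknown.\<close>

lemma mvt_closed_segment:
  fixes f :: "real \<Rightarrow> real"
  assumes "\<And>y. y \<in> closed_segment a b \<Longrightarrow> (f has_real_derivative f' y) (at y)"
  shows "\<exists>y\<in>closed_segment a b. f b - f a = f' y * (b - a)"
proof (cases a b rule: linorder_cases)
  case less
  then obtain z where "a < z" "z < b" "f b - f a = (b - a) * f' z"
    using MVT2[of a b f f'] assms by (auto simp: closed_segment_eq_real_ivl)
  then show ?thesis using less by (auto simp: closed_segment_eq_real_ivl intro!: bexI[of _ z])
next
  case greater
  then obtain z where "b < z" "z < a" "f a - f b = (a - b) * f' z"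
    using MVT2[of b a f f'] assms by (auto simp: closed_segment_eq_real_ivl)
  then show ?thesis using greater by (auto simp: closed_segment_eq_real_ivl algebra_simps intro!: bexI[of _ z])
qed (use assms in auto)

text \<open>The two sides of the fundamental theorem for \<open>\<Phi> \<circ> U\<close> are additive over intervals, and on short
  intervals differ by at most \<open>e \<integral> \<bar>g\<bar>\<close>; bisection makes this global.\<close>

lemma ac_deriv_chain:
  fixes U g \<Phi> \<Phi>' :: "real \<Rightarrow> real"
  assumes U: "ac_deriv U g" and S: "convex S" "\<And>x. U x \<in> S"
    and \<Phi>: "\<And>y. y \<in> S \<Longrightarrow> (\<Phi> has_real_derivative \<Phi>' y) (at y)" "continuous_on S \<Phi>'"
  shows "ac_deriv (\<lambda>x. \<Phi> (U x)) (\<lambda>x. \<Phi>' (U x) * g x)"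
proof -
  have Uc: "continuous_on T U" for T by (rule ac_deriv_continuous[OF U])
  have H: "continuous_on T (\<lambda>x. \<Phi>' (U x))" for T
    by (rule continuous_on_compose2[OF \<Phi>(2) Uc]) (use S in auto)
  have gi: "set_integrable lborel {a..b} g" for a b using ac_derivD(2)[OF U] .
  have Hi: "set_integrable lborel {a..b} (\<lambda>x. \<Phi>' (U x) * g x)" for a b
    by (rule set_integrable_continuous_mult[OF gi H])
  have eq: "(LINT x:{a..b}|lborel. \<Phi>' (U x) * g x) = \<Phi> (U b) - \<Phi> (U a)" if "a \<le> b" for a b
  proof -
    define D where "D x y = \<Phi> (U y) - \<Phi> (U x) - (LINT t:{x..y}|lborel. \<Phi>' (U t) * g t)" for x y
    define N where "N x y = (LINT t:{x..y}|lborel. \<bar>g t\<bar>)" for x y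
    have N0: "0 \<le> N x y" for x y
      unfolding N_def set_lebesgue_integral_def by (intro integral_nonneg_AE) auto
    have *: "\<bar>D a b\<bar> \<le> e * N a b" if "e > 0" for e
      using \<open>a \<le> b\<close>
    proof (induction rule: Bolzano)
      case (trans x y z)
      have "D x z = D x y + D y z"
        unfolding D_def using set_integral_combine[OF trans(3,4) Hi] by simp
      moreover have "N x z = N x y + N y z"
        unfolding N_def by (rule set_integral_combine[OF trans(3,4)]) (use set_integrable_abs[OF gi] in simp)
      ultimately show ?case using trans by (simp add: distrib_left)
    next
      case (local x)
      have "isCont (\<lambda>x. \<Phi>' (U x)) x" using H[of UNIV] by (simp add: continuous_on_eq_continuous_at)
      then obtain d where d: "d > 0" "\<And>t. \<bar>t - x\<bar> < d \<Longrightarrow> \<bar>\<Phi>' (U t) - \<Phi>' (U x)\<bar> < e / 2"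
        using \<open>e > 0\<close> unfolding continuous_at_eps_delta dist_real_def
        by (elim allE[of _ "e / 2"]) auto
      show ?case
      proof (intro exI[of _ d] conjI allI impI)
        fix p q assume pq: "p \<le> x \<and> x \<le> q \<and> q - p < d"
        \<comment> \<open>U takes on [p, q] every value between U p and U q, so the mean value point
          of \<Phi> is U z for some z in this short interval, where \<Phi>' (U z) is close to
          \<Phi>' (U x).\<close>
        have conn: "connected (U ` {p..q})" by (intro connected_continuous_image Uc) simp
        have seg: "closed_segment (U p) (U q) \<subseteq> U ` {p..q}"
          using pq conn by (intro closed_segment_subset) (auto simp: connected_convex_1)
        have "closed_segment (U p) (U q) \<subseteq> S"
          by (intro closed_segment_subset S)
        then obtain y where y: "y \<in> closed_segment (U p) (U q)" "\<Phi> (U q) - \<Phi> (U p) = \<Phi>' y * (U q - U p)"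
          using mvt_closed_segment[of "U p" "U q" \<Phi> \<Phi>'] \<Phi>(1) by (meson subsetD)
        then obtain z where z: "z \<in> {p..q}" "y = U z" using seg by auto
        have 1: "U q - U p = (LINT t:{p..q}|lborel. g t)" using ac_derivD(3)[OF U, of p q] pq by simp
        have "D p q = (LINT t:{p..q}|lborel. \<Phi>' (U z) * g t - \<Phi>' (U t) * g t)"
          unfolding D_def y(2) z(2) 1 using gi Hi by (subst set_integral_diff) auto
        also have "\<bar>\<dots>\<bar> \<le> (LINT t:{p..q}|lborel. \<bar>\<Phi>' (U z) * g t - \<Phi>' (U t) * g t\<bar>)"
          using gi Hi by (intro set_integral_abs_le set_integral_diff(1)) auto
        also have "\<dots> \<le> (LINT t:{p..q}|lborel. e * \<bar>g t\<bar>)"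
        proof (rule set_integral_mono)
          show "set_integrable lborel {p..q} (\<lambda>t. \<bar>\<Phi>' (U z) * g t - \<Phi>' (U t) * g t\<bar>)"
            using gi Hi by (intro set_integrable_abs set_integral_diff(1)) auto
          show "set_integrable lborel {p..q} (\<lambda>t. e * \<bar>g t\<bar>)"
            using set_integrable_abs[OF gi] by (intro set_integrable_mult_right) auto
          fix t assume t: "t \<in> {p..q}"
          have "\<bar>\<Phi>' (U z) - \<Phi>' (U t)\<bar> \<le> e"
          proof -
            have "\<bar>z - x\<bar> < d" "\<bar>t - x\<bar> < d" using t z(1) pq by auto
            from d(2)[OF this(1)] d(2)[OF this(2)] show ?thesis by linarith
          qed
          then show "\<bar>\<Phi>' (U z) * g t - \<Phi>' (U t) * g t\<bar> \<le> e * \<bar>g t\<bar>"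
            unfolding left_diff_distrib[symmetric] abs_mult by (intro mult_right_mono) auto
        qed
        also have "\<dots> = e * N p q" unfolding N_def by simp
        finally show "\<bar>D p q\<bar> \<le> e * N p q" .
      qed (rule d(1))
    qed
    have "\<bar>D a b\<bar> \<le> 0"
    proof (rule field_le_epsilon)
      fix e :: real assume "e > 0"
      \<comment> \<open>The summand 1 keeps the quotient meaningful when the integral of |g|
        vanishes.\<close>
      then have "\<bar>D a b\<bar> \<le> e / (N a b + 1) * N a b" using N0[of a b] by (intro *) auto
      also have "\<dots> \<le> e" using N0[of a b] \<open>e > 0\<close> by (simp add: field_simps)
      finally show "\<bar>D a b\<bar> \<le> 0 + e" by simp
    qed
    then show ?thesis by (simp add: D_def)
  qed
  have "(\<lambda>x. \<Phi>' (U x) * g x) \<in> borel_measurable borel"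
    using ac_derivD(1)[OF U] by (intro borel_measurable_times borel_measurable_continuous_onI[OF H])
  then show ?thesis using Hi eq by (simp add: ac_deriv_def)
qed

lemma ac_deriv_square:
  assumes "ac_deriv U g"
  shows "ac_deriv (\<lambda>x. (U x)\<^sup>2) (\<lambda>x. 2 * U x * g x)"
  by (rule ac_deriv_chain[OF assms convex_UNIV, where \<Phi> = "\<lambda>y. y\<^sup>2" and \<Phi>' = "\<lambda>y. 2 * y"])
     (auto intro!: derivative_eq_intros continuous_intros)

text \<open>Polarization: U V = ((U + V)^2 - (U - V)^2) / 4 reduces the product rule to the chain
  rule for squares.\<close>

lemma ac_deriv_mult:
  assumes "ac_deriv U g" "ac_deriv V h"
  shows "ac_deriv (\<lambda>x. U x * V x) (\<lambda>x. g x * V x + U x * h x)"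
proof -
  note V' = ac_deriv_cmult[OF assms(2), of "-1"]
  have "ac_deriv (\<lambda>x. 1/4 * (U x + V x)\<^sup>2 + (-1/4) * (U x + (-1) * V x)\<^sup>2)
      (\<lambda>x. 1/4 * (2 * (U x + V x) * (g x + h x)) + (-1/4) * (2 * (U x + (-1) * V x) * (g x + (-1) * h x)))"
    using assms V' by (intro ac_deriv_add ac_deriv_cmult ac_deriv_square)
  then show ?thesis
    by (simp add: algebra_simps power2_eq_square)
qed

lemma ac_deriv_inverse:
  assumes "ac_deriv U g" "\<And>x. U x > 0"
  shows "ac_deriv (\<lambda>x. 1 / U x) (\<lambda>x. - 1 / (U x)\<^sup>2 * g x)"
proof (rule ac_deriv_chain[OF assms(1), of "{0<..}"])
  show "((\<lambda>y. 1 / y) has_real_derivative - 1 / y\<^sup>2) (at y)" if "y \<in> {0<..}" for y :: real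
    using that by (auto intro!: derivative_eq_intros simp: power2_eq_square)
qed (use assms(2) in \<open>auto intro!: continuous_intros\<close>)

text \<open>The counterpart of \<open>ac_deriv_chain\<close>: now the inner function is C1 and
  monotone and the outer one merely absolutely continuous, so the change of variables formula
  applies directly.\<close>

lemma ac_deriv_compose:
  assumes U: "ac_deriv U g" and X: "\<And>x. (X has_real_derivative P x) (at x)"
    "continuous_on UNIV P" "\<And>x. P x \<ge> 0"
  shows "ac_deriv (\<lambda>x. U (X x)) (\<lambda>x. g (X x) * P x)"
  unfolding ac_deriv_def
proof (intro conjI allI impI)
  have Xc: "continuous_on UNIV X"
    using X(1) by (meson continuous_at_imp_continuous_on DERIV_isCont)
  have [measurable]: "X \<in> borel_measurable borel" "P \<in> borel_measurable borel" "g \<in> borel_measurable borel"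
    using Xc X(2) ac_derivD(1)[OF U] by (auto intro: borel_measurable_continuous_onI)
  show "(\<lambda>x. g (X x) * P x) \<in> borel_measurable borel" by measurable
  fix a b :: real assume ab: "a \<le> b"
  note s = integral_substitution[OF ac_derivD(2)[OF U], of a b X P, OF X(1) continuous_on_subset[OF X(2) subset_UNIV] X(3) ab]
  show "set_integrable lborel {a..b} (\<lambda>x. g (X x) * P x)" by (rule s(1))
  have "X a \<le> X b" using ab DERIV_nonneg_imp_nondecreasing[OF ab] X by blast
  then show "(LINT x:{a..b}|lborel. g (X x) * P x) = U (X b) - U (X a)"
    using s(2) ac_derivD(3)[OF U, of "X a" "X b"] by (simp add: set_lebesgue_integral_def mult.commute)
qed

text \<open>Expand the nonnegative integral of (g - k)^2, where k is the mean of g over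
  [a, b].\<close>

lemma set_integral_cauchy_schwarz:
  fixes g :: "real \<Rightarrow> real"
  assumes ab: "a \<le> b" and gm: "g \<in> borel_measurable borel"
    and g2: "set_integrable lborel {a..b} (\<lambda>x. (g x)\<^sup>2)"
  shows "(LINT x:{a..b}|lborel. g x)\<^sup>2 \<le> (b - a) * (LINT x:{a..b}|lborel. (g x)\<^sup>2)"
proof (cases "a = b")
  case False
  then have l: "b - a > 0" using ab by simp
  define I where "I = (LINT x:{a..b}|lborel. g x)"
  define k where "k = I / (b - a)"
  have gi: "set_integrable lborel {a..b} g" by (rule set_integrable_if_square[OF gm g2])
  have c: "set_integrable lborel {a..b} (\<lambda>x. k\<^sup>2 :: real)"
    by (intro set_integrable_continuous) auto
  have ck: "(LINT x:{a..b}|lborel. k\<^sup>2) = k\<^sup>2 * (b - a)"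
    using ab by (simp add: set_lebesgue_integral_def)
  have "0 \<le> (LINT x:{a..b}|lborel. (g x - k)\<^sup>2)"
    unfolding set_lebesgue_integral_def by (intro integral_nonneg_AE) auto
  also have "\<dots> = (LINT x:{a..b}|lborel. ((g x)\<^sup>2 - 2 * k * g x) + k\<^sup>2)"
    by (simp add: power2_diff algebra_simps)
  also have "\<dots> = (LINT x:{a..b}|lborel. (g x)\<^sup>2 - 2 * k * g x) + k\<^sup>2 * (b - a)"
    using g2 gi c by (subst set_integral_add(2)) (auto simp: ck)
  also have "(LINT x:{a..b}|lborel. (g x)\<^sup>2 - 2 * k * g x) = (LINT x:{a..b}|lborel. (g x)\<^sup>2) - 2 * k * I"
    unfolding I_def using g2 gi by (subst set_integral_diff(2)) auto
  finally have "2 * k * I - k\<^sup>2 * (b - a) \<le> (LINT x:{a..b}|lborel. (g x)\<^sup>2)" by simp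
  moreover have "2 * k * I - k\<^sup>2 * (b - a) = I\<^sup>2 / (b - a)"
  proof -
    have "k * (b - a) = I" using l by (simp add: k_def)
    then have "k\<^sup>2 * (b - a) = k * I" by (metis power2_eq_square mult.assoc)
    then show ?thesis by (simp add: k_def power2_eq_square)
  qed
  ultimately have "I\<^sup>2 / (b - a) \<le> (LINT x:{a..b}|lborel. (g x)\<^sup>2)" by simp
  then show ?thesis using l by (simp add: I_def pos_divide_le_eq mult.commute)
next
  case True
  then have "AE x in lborel. indicator {a..b} x *\<^sub>R g x = 0"
    by (intro eventually_mono[OF AE_lborel_singleton[of b]]) (auto split: split_indicator)
  then have "(LINT x:{a..b}|lborel. g x) = 0"
    unfolding set_lebesgue_integral_def by (rule integral_eq_zero_AE)
  then show ?thesis using True by simp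
qed

definition primitive :: "(real \<Rightarrow> real) \<Rightarrow> real \<Rightarrow> real"
  where "primitive g x = (if 0 \<le> x then LINT t:{0..x}|lborel. g t else - (LINT t:{x..0}|lborel. g t))"

lemma ac_deriv_primitive:
  assumes gm: "g \<in> borel_measurable borel" and gi: "\<And>a b. set_integrable lborel {a..b} g"
  shows "ac_deriv (primitive g) g"
  unfolding ac_deriv_def
proof (intro conjI allI impI gm gi)
  fix a b :: real assume ab: "a \<le> b"
  show "(LINT x:{a..b}|lborel. g x) = primitive g b - primitive g a"
    using ab set_integral_combine[OF _ _ gi, of a b 0] set_integral_combine[OF _ _ gi, of a 0 b]
      set_integral_combine[OF _ _ gi, of 0 a b]
    by (auto simp: primitive_def)
qed

lemma ex_le_unit_mean:
  fixes f :: "real \<Rightarrow> real"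
  assumes "continuous_on {0..1} f"
  shows "\<exists>t\<in>{0..1}. f t \<le> (LINT x:{0..1}|lborel. f x)"
proof -
  have "{0..1::real} \<noteq> {}" by simp
  then obtain m where m: "m \<in> {0..1}" "\<And>x. x \<in> {0..1} \<Longrightarrow> f m \<le> f x"
    using continuous_attains_inf[OF compact_Icc[of 0 1] _ assms] by blast
  have "f m = (LINT x:{0..1::real}|lborel. f m)" by (simp add: set_lebesgue_integral_def)
  also have "\<dots> \<le> (LINT x:{0..1}|lborel. f x)"
    by (intro set_integral_mono set_integrable_continuous assms continuous_on_const m(2))
  finally show ?thesis using m(1) by blast
qed

lemma continuous_antiderivative:
  fixes f :: "real \<Rightarrow> real"
  assumes "continuous_on UNIV f"
  shows "\<exists>F. F 0 = 0 \<and> (\<forall>x. (F has_real_derivative f x) (at x))"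
proof -
  have "isCont f x" for x using assms by (simp add: continuous_on_eq_continuous_at)
  then obtain F where "\<forall>x. -\<infinity> < ereal x \<longrightarrow> ereal x < \<infinity> \<longrightarrow> (F has_vector_derivative f x) (at x)"
    using einterval_antiderivative[of "-\<infinity>" "\<infinity>" f] by auto
  then have F: "(F has_real_derivative f x) (at x)" for x
    by (simp add: has_real_derivative_iff_has_vector_derivative)
  have "((\<lambda>x. F x - F 0) has_real_derivative f x) (at x)" for x
    using DERIV_diff[OF F[of x] DERIV_const[of "F 0"]] by simp
  then show ?thesis by (intro exI[of _ "\<lambda>x. F x - F 0"]) simp
qed

section \<open>Weak derivatives on the circle\<close>

lemma integral_lebesgue_circle:
  fixes f :: "circle \<Rightarrow> real"
  assumes "f \<in> borel_measurable borel"
  shows "(\<integral>x. f x \<partial>lebesgue_circle) = (LINT x:{0..<1}|lborel. f (to_circle x))"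
proof -
  have "(LINT x:{0..<1}|lborel. f (to_circle x)) = (LINT x:{0..1}|lborel. f (to_circle x))"
    by (rule set_integral_discrete_difference[of "{1}"]) auto
  then show ?thesis
    using integral_lebesgue_circle_window[OF assms, of 0] by simp
qed

lemma AE_lebesgue_circleD:
  assumes "AE p in lebesgue_circle. Q p" "{p. Q p} \<in> sets borel"
  shows "AE x in lborel. x \<in> {a..a+1} \<longrightarrow> Q (to_circle x)"
proof -
  have m: "(indicator {p. \<not> Q p} :: circle \<Rightarrow> ennreal) \<in> borel_measurable borel"
    using sets.compl_sets[OF assms(2)] by (intro borel_measurable_indicator) (simp add: Collect_neg_eq Compl_eq_Diff_UNIV)
  have "(\<integral>\<^sup>+p. indicator {p. \<not> Q p} p \<partial>lebesgue_circle) = (\<integral>\<^sup>+p. 0 \<partial>lebesgue_circle)"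
    by (rule nn_integral_cong_AE) (use assms(1) in \<open>auto elim!: eventually_mono\<close>)
  then have 0: "(\<integral>\<^sup>+x. indicator {p. \<not> Q p} (to_circle x) * indicator {a..a+1} x \<partial>lborel) = 0"
    using nn_integral_lebesgue_circle_window[OF m, of a] by simp
  have "(\<lambda>x. indicator {p. \<not> Q p} (to_circle x) * indicator {a..a+1} x :: ennreal) \<in> borel_measurable lborel"
    using measurable_compose[OF measurable_to_circle m] by (intro borel_measurable_times_ennreal) auto
  from nn_integral_0_iff_AE[OF this] 0
  have "AE x in lborel. indicator {p. \<not> Q p} (to_circle x) * indicator {a..a+1} x = (0::ennreal)" by simp
  then show ?thesis
    by (rule eventually_mono) (auto split: split_indicator_asm simp: indicator_def split: if_splits)
qed

text \<open>A closed set containing almost every point of an open interval contains all of it. This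
  turns bounds on a density, known only almost everywhere, into bounds everywhere on its continuous
  representative.\<close>

lemma AE_lebesgue_circle_le_continuous:
  assumes U: "continuous_on UNIV U" "\<And>x. U (x + 1) = U x"
    and ae: "AE p in lebesgue_circle. a \<le> U (circle_rep p)"
  shows "a \<le> (U x :: real)"
proof -
  have [measurable]: "U \<in> borel_measurable borel" using U(1) by (rule borel_measurable_continuous_onI)
  have "{p. a \<le> U (circle_rep p)} \<in> sets borel" by measurable
  \<comment> \<open>Centring the window at x makes x an interior point.\<close>
  from AE_lebesgue_circleD[OF ae this, of "x - 1/2"]
  have "AE y in lborel. y \<in> {x - 1/2..x - 1/2 + 1} \<longrightarrow> a \<le> U y"
    unfolding circle_rep_periodic[of U, OF U(2)] .
  then have "AE y in lborel. y \<in> {x - 1/2<..<x + 1/2} \<longrightarrow> y \<in> {y. a \<le> U y}"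
    by (rule eventually_mono) auto
  then have "AE y \<in> {x - 1/2<..<x + 1/2} in lebesgue. y \<in> {y. a \<le> U y}"
    by (rule AE_completion)
  from mem_closed_if_AE_lebesgue_open[OF _ closed_Collect_le[OF continuous_on_const U(1)] this]
  have "x \<in> {y. a \<le> U y}" by simp
  then show ?thesis by simp
qed

lemma set_integrable_circle:
  fixes f :: "circle \<Rightarrow> real"
  assumes "integrable lebesgue_circle f"
  shows "set_integrable lborel {a..b} (\<lambda>x. f (to_circle x))"
proof -
  have [measurable]: "f \<in> borel_measurable borel"
    using borel_measurable_integrable[OF assms] by simp
  have w: "set_integrable lborel {a..a+1} (\<lambda>x. f (to_circle x))" for a
    using assms integrable_lebesgue_circle_window[of f a] by simp
  have *: "set_integrable lborel {a..a + of_nat n} (\<lambda>x. f (to_circle x))" for n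
  proof (induction n)
    case 0
    have "set_integrable lborel {a..a} (\<lambda>x. f (to_circle x))"
      by (rule set_integrable_subset[OF w[of a]]) auto
    then show ?case by simp
  next
    case (Suc n)
    have "set_integrable lborel ({a..a + of_nat n} \<union> {a + of_nat n..(a + of_nat n) + 1}) (\<lambda>x. f (to_circle x))"
      by (rule set_integrable_Un[OF Suc w]) auto
    moreover have "{a..a + of_nat n} \<union> {a + of_nat n..(a + of_nat n) + 1} = {a..a + of_nat (Suc n)}"
      by auto
    ultimately show ?case by simp
  qed
  obtain n where "b - a \<le> of_nat n" using real_arch_simple by blast
  then show ?thesis by (intro set_integrable_subset[OF *[of n]]) auto
qed

lemma L2_circle_integrable:
  assumes "u \<in> L2_circle"
  shows "u \<in> borel_measurable borel" "integrable lebesgue_circle u"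
    "set_integrable lborel {a..b} (\<lambda>x. (u (to_circle x))\<^sup>2)"
    "set_integrable lborel {a..b} (\<lambda>x. u (to_circle x))"
proof -
  show [measurable]: "u \<in> borel_measurable borel" using assms by (simp add: L2_circle_def)
  show sq: "set_integrable lborel {a..b} (\<lambda>x. (u (to_circle x))\<^sup>2)" for a b
    using assms set_integrable_circle[of "\<lambda>x. (u x)\<^sup>2"] by (simp add: L2_circle_def)
  show i: "set_integrable lborel {a..b} (\<lambda>x. u (to_circle x))" for a b
    by (rule set_integrable_if_square[OF _ sq]) simp
  show "integrable lebesgue_circle u"
    by (subst integrable_lebesgue_circle_window[of _ 0]) (auto intro: i)
qed

lemma integrable_circle_mult:
  fixes f :: "circle \<Rightarrow> real" and \<phi> :: "real \<Rightarrow> real"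
  assumes f: "integrable lebesgue_circle f"
    and \<phi>: "continuous_on UNIV \<phi>" "\<And>x. \<phi> (x + 1) = \<phi> x"
  shows "integrable lebesgue_circle (\<lambda>p. f p * \<phi> (circle_rep p))"
proof -
  have [measurable]: "f \<in> borel_measurable borel" "\<phi> \<in> borel_measurable borel"
    using borel_measurable_integrable[OF f] \<phi>(1) by (auto intro: borel_measurable_continuous_onI)
  have "set_integrable lborel {0..0+1} (\<lambda>x. \<phi> x * f (to_circle x))"
    by (rule set_integrable_continuous_mult[OF set_integrable_circle[OF f] continuous_on_subset[OF \<phi>(1) subset_UNIV]])
  then show ?thesis
    by (subst integrable_lebesgue_circle_window[of _ 0])
      (auto simp: circle_rep_periodic[of \<phi>, OF \<phi>(2)] mult.commute)
qed

lemma integrable_circle_continuous: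
  fixes \<phi> :: "real \<Rightarrow> real"
  assumes \<phi>: "continuous_on UNIV \<phi>" "\<And>x. \<phi> (x + 1) = \<phi> x"
  shows "integrable lebesgue_circle (\<lambda>p. \<phi> (circle_rep p))"
proof -
  interpret prob_space lebesgue_circle by (rule prob_space_lebesgue_circle)
  show ?thesis using integrable_circle_mult[of "\<lambda>_. 1" \<phi>] \<phi> by simp
qed

section \<open>Test functions and the density of trigonometric polynomials\<close>

lemma test_functionsI:
  assumes "f \<in> S" and "\<And>f. f \<in> S \<Longrightarrow> deriv f \<in> S"
    and "\<And>f x. f \<in> S \<Longrightarrow> f (x + 1) = f x" "\<And>f x. f \<in> S \<Longrightarrow> f differentiable (at x)"
  shows "f \<in> test_functions"
proof -
  have "(deriv ^^ n) f \<in> S" for n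
    by (induction n) (use assms in auto)
  then show ?thesis using assms by (auto simp: test_functions_def)
qed

lemma test_functionsD:
  assumes "f \<in> test_functions"
  shows "f (x + 1) = f x" "(f has_real_derivative deriv f x) (at x)" "deriv f \<in> test_functions"
proof -
  have p: "f (x + 1) = f x" and d: "(deriv ^^ n) f differentiable (at x)" for n x
    using assms by (auto simp: test_functions_def)
  show "f (x + 1) = f x" by (rule p)
  show D: "(f has_real_derivative deriv f x) (at x)" for x
    using d[of 0 x] DERIV_deriv_iff_real_differentiable by simp
  have "deriv f (x + 1) = deriv f x" for x
  proof -
    have "((\<lambda>y. f (y + 1)) has_real_derivative deriv f (x + 1)) (at x)"
      using D[of "x + 1"] by (subst DERIV_shift[symmetric])
    then have "(f has_real_derivative deriv f (x + 1)) (at x)" by (simp add: p)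
    then show ?thesis using D[of x] DERIV_unique by blast
  qed
  moreover have "(deriv ^^ n) (deriv f) differentiable (at x)" for n x
    using d[of "Suc n" x] by (simp add: funpow_swap1)
  ultimately show "deriv f \<in> test_functions" by (simp add: test_functions_def)
qed

lemma test_functions_continuous: "f \<in> test_functions \<Longrightarrow> continuous_on S f"
  using test_functionsD(2) by (meson DERIV_isCont continuous_at_imp_continuous_on)

text \<open>Zero mean is what makes the primitive F periodic: F (x + 1) - F x has derivative zero,
  and its constant value is the mean.\<close>

lemma test_functions_antiderivative:
  assumes \<psi>: "\<psi> \<in> test_functions" and mean: "(LINT x:{0..1}|lborel. \<psi> x) = 0"
  shows "\<exists>\<phi>\<in>test_functions. deriv \<phi> = \<psi>"
proof -
  obtain F where F: "\<And>x. (F has_real_derivative \<psi> x) (at x)"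
    using continuous_antiderivative[OF test_functions_continuous[OF \<psi>]] by blast
  have ac: "ac_deriv F \<psi>" by (rule ac_deriv_C1[OF F test_functions_continuous[OF \<psi>]])
  have "((\<lambda>y. F (y + 1) - F y) has_real_derivative 0) (at x)" for x
  proof -
    have "((\<lambda>y. F (y + 1)) has_real_derivative \<psi> (x + 1)) (at x)"
      using F[of "x + 1"] by (subst DERIV_shift[symmetric])
    then show ?thesis using F[of x] test_functionsD(1)[OF \<psi>, of x]
      by (auto intro!: derivative_eq_intros)
  qed
  then have const: "F (x + 1) - F x = F (0 + 1) - F 0" for x
    using DERIV_isconst_all[of "\<lambda>y. F (y + 1) - F y"] by blast
  have "F 1 - F 0 = 0" using ac_derivD(3)[OF ac, of 0 1] mean by simp
  then have per: "F (x + 1) = F x" for x using const[of x] by simp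
  have dF: "deriv F = \<psi>" using F by (auto intro: DERIV_imp_deriv)
  have "(deriv ^^ n) F differentiable (at x)" for n x
  proof (cases n)
    case 0
    then show ?thesis using F real_differentiable_def by auto
  next
    case (Suc k)
    then have "(deriv ^^ n) F = (deriv ^^ k) \<psi>" by (simp add: funpow_swap1 dF)
    then show ?thesis using \<psi> by (simp add: test_functions_def)
  qed
  with per dF show ?thesis by (auto simp: test_functions_def)
qed

text \<open>Presented as the algebra generated by the constants and the first harmonics: closure
  under products is what Stone-Weierstrass asks for, and closure under derivatives makes every
  member a test function.\<close>

inductive_set trig_polys :: "(real \<Rightarrow> real) set" where
  const: "(\<lambda>x. c) \<in> trig_polys"
| cos: "(\<lambda>x. cos (2 * pi * x)) \<in> trig_polys"
| sin: "(\<lambda>x. sin (2 * pi * x)) \<in> trig_polys"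
| add: "f \<in> trig_polys \<Longrightarrow> g \<in> trig_polys \<Longrightarrow> (\<lambda>x. f x + g x) \<in> trig_polys"
| mult: "f \<in> trig_polys \<Longrightarrow> g \<in> trig_polys \<Longrightarrow> (\<lambda>x. f x * g x) \<in> trig_polys"

lemma trig_polys_periodic: "f \<in> trig_polys \<Longrightarrow> f (x + 1) = f x"
  by (induction rule: trig_polys.induct) (auto simp: distrib_left)

lemma trig_polys_deriv: "f \<in> trig_polys \<Longrightarrow> \<exists>f'\<in>trig_polys. \<forall>x. (f has_real_derivative f' x) (at x)"
proof (induction rule: trig_polys.induct)
  case (const c)
  show ?case by (intro bexI[OF _ trig_polys.const[of 0]] allI DERIV_const)
next
  case cos
  have "((\<lambda>x. cos (2 * pi * x)) has_real_derivative (- 2 * pi) * sin (2 * pi * x)) (at x)" for x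
    by (auto intro!: derivative_eq_intros)
  then show ?case
    by (intro bexI[OF _ trig_polys.mult[OF trig_polys.const[of "- 2 * pi"] trig_polys.sin]] allI)
next
  case sin
  have "((\<lambda>x. sin (2 * pi * x)) has_real_derivative (2 * pi) * cos (2 * pi * x)) (at x)" for x
    by (auto intro!: derivative_eq_intros)
  then show ?case
    by (intro bexI[OF _ trig_polys.mult[OF trig_polys.const[of "2 * pi"] trig_polys.cos]] allI)
next
  case (add f g)
  then obtain f' g' where *: "f' \<in> trig_polys" "g' \<in> trig_polys"
    "\<And>x. (f has_real_derivative f' x) (at x)" "\<And>x. (g has_real_derivative g' x) (at x)" by blast
  show ?case by (intro bexI[OF _ trig_polys.add[OF *(1,2)]] allI DERIV_add *(3,4))
next
  case (mult f g)
  then obtain f' g' where *: "f' \<in> trig_polys" "g' \<in> trig_polys"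
    "\<And>x. (f has_real_derivative f' x) (at x)" "\<And>x. (g has_real_derivative g' x) (at x)" by blast
  have "((\<lambda>x. f x * g x) has_real_derivative f' x * g x + f x * g' x) (at x)" for x
    by (auto intro!: derivative_eq_intros *)
  moreover have "(\<lambda>x. f' x * g x + f x * g' x) \<in> trig_polys"
    by (rule trig_polys.add[OF trig_polys.mult[OF *(1) mult.hyps(2)] trig_polys.mult[OF mult.hyps(1) *(2)]])
  ultimately show ?case by (intro bexI[where x = "\<lambda>x. f' x * g x + f x * g' x"] allI)
qed

lemma trig_polys_test: "f \<in> trig_polys \<Longrightarrow> f \<in> test_functions"
proof (rule test_functionsI[of f trig_polys])
  fix f x assume f: "f \<in> trig_polys"
  then obtain f' where f': "f' \<in> trig_polys" "\<And>x. (f has_real_derivative f' x) (at x)"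
    using trig_polys_deriv by blast
  then have "deriv f = f'" by (intro ext DERIV_imp_deriv)
  then show "deriv f \<in> trig_polys" using f'(1) by simp
  show "f differentiable (at x)" using f'(2)[of x] unfolding real_differentiable_def by (rule exI)
  show "f (x + 1) = f x" using f by (rule trig_polys_periodic)
qed

text \<open>Stone-Weierstrass on the compact circle. Sine and cosine of the first harmonic separate
  points jointly, since equality of both forces the representatives to differ by an integer.\<close>

lemma trig_polys_dense:
  fixes f :: "circle \<Rightarrow> real"
  assumes "continuous_on UNIV f" "e > 0"
  shows "\<exists>\<psi>\<in>trig_polys. \<forall>p. \<bar>f p - \<psi> (circle_rep p)\<bar> < e"
proof -
  interpret function_ring_on "{f. (\<lambda>x. f (to_circle x)) \<in> trig_polys}" "UNIV :: circle set"
  proof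
    show "compact (UNIV :: circle set)" by (rule compact_circle)
    show "continuous_on UNIV f" if "f \<in> {f. (\<lambda>x. f (to_circle x)) \<in> trig_polys}" for f
      using that by (intro continuous_on_circle test_functions_continuous trig_polys_test) simp
    fix p q :: circle assume "p \<noteq> q"
    then have ne: "circle_rep p - circle_rep q \<notin> \<int>"
      by (metis to_circle_eq_iff to_circle_rep)
    let ?x = "circle_rep p" and ?y = "circle_rep q"
    have "sin (2 * pi * ?x) \<noteq> sin (2 * pi * ?y) \<or> cos (2 * pi * ?x) \<noteq> cos (2 * pi * ?y)"
    proof (rule ccontr)
      assume "\<not> ?thesis"
      then obtain n :: int where "2 * pi * ?x = 2 * pi * ?y + 2 * pi * of_int n"
        using sin_cos_eq_iff[of "2 * pi * ?x" "2 * pi * ?y"] by auto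
      then have "2 * pi * ?x = 2 * pi * (?y + of_int n)" by (simp add: distrib_left)
      then have "?x - ?y = of_int n" by simp
      then show False using ne by simp
    qed
    then show "\<exists>f\<in>{f. (\<lambda>x. f (to_circle x)) \<in> trig_polys}. f p \<noteq> f q"
    proof
      assume "sin (2 * pi * ?x) \<noteq> sin (2 * pi * ?y)"
      then show ?thesis
        using circle_rep_periodic[of "\<lambda>x. sin (2 * pi * x)", OF trig_polys_periodic[OF trig_polys.sin]]
        by (intro bexI[of _ "\<lambda>p. sin (2 * pi * circle_rep p)"]) (simp_all add: trig_polys.sin)
    next
      assume "cos (2 * pi * ?x) \<noteq> cos (2 * pi * ?y)"
      then show ?thesis
        using circle_rep_periodic[of "\<lambda>x. cos (2 * pi * x)", OF trig_polys_periodic[OF trig_polys.cos]]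
        by (intro bexI[of _ "\<lambda>p. cos (2 * pi * circle_rep p)"]) (simp_all add: trig_polys.cos)
    qed
  next
    fix f g :: "circle \<Rightarrow> real"
    assume fg: "f \<in> {f. (\<lambda>x. f (to_circle x)) \<in> trig_polys}" "g \<in> {f. (\<lambda>x. f (to_circle x)) \<in> trig_polys}"
    show "(\<lambda>x. f x + g x) \<in> {f. (\<lambda>x. f (to_circle x)) \<in> trig_polys}"
      unfolding mem_Collect_eq by (rule trig_polys.add) (use fg in simp_all)
    show "(\<lambda>x. f x * g x) \<in> {f. (\<lambda>x. f (to_circle x)) \<in> trig_polys}"
      unfolding mem_Collect_eq by (rule trig_polys.mult) (use fg in simp_all)
  next
    show "(\<lambda>_. c) \<in> {f. (\<lambda>x. f (to_circle x)) \<in> trig_polys}" for c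
      unfolding mem_Collect_eq by (rule trig_polys.const)
  qed
  obtain g where g: "(\<lambda>x. g (to_circle x)) \<in> trig_polys" "\<And>p. \<bar>f p - g p\<bar> < e"
    using Stone_Weierstrass_basic[OF assms] by auto
  then show ?thesis by (intro bexI[OF _ g(1)]) simp
qed

text \<open>Orthogonality passes from trigonometric polynomials to continuous functions by uniform
  density, from these to indicators of closed sets by dominated convergence of cutoffs, and to all
  Borel sets by Dynkin's argument, the closed sets being an intersection-stable generator.\<close>

lemma circle_integral_zero_imp_AE_zero:
  fixes h :: "circle \<Rightarrow> real"
  assumes h: "integrable lebesgue_circle h"
    and orth: "\<And>\<psi>. \<psi> \<in> trig_polys \<Longrightarrow> (\<integral>p. h p * \<psi> (circle_rep p) \<partial>lebesgue_circle) = 0"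
  shows "AE p in lebesgue_circle. h p = 0"
proof -
  have hm [measurable]: "h \<in> borel_measurable borel"
    using borel_measurable_integrable[OF h] by simp
  have cont: "(\<integral>p. h p * f p \<partial>lebesgue_circle) = 0" if f: "continuous_on UNIV f" for f
  proof -
    have fm [measurable]: "f \<in> borel_measurable borel" using f by (rule borel_measurable_continuous_onI)
    have fc: "continuous_on UNIV (\<lambda>x. f (to_circle x))"
      by (rule continuous_on_compose2[OF f continuous_to_circle]) auto
    have hf: "integrable lebesgue_circle (\<lambda>p. h p * f p)"
      using integrable_circle_mult[OF h fc] by simp
    define N where "N = (\<integral>p. \<bar>h p\<bar> \<partial>lebesgue_circle)"
    have N: "N \<ge> 0" unfolding N_def by (rule integral_nonneg_AE) auto
    have *: "\<bar>\<integral>p. h p * f p \<partial>lebesgue_circle\<bar> \<le> e * N" if "e > 0" for e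
    proof -
      obtain \<psi> where \<psi>: "\<psi> \<in> trig_polys" "\<And>p. \<bar>f p - \<psi> (circle_rep p)\<bar> < e"
        using trig_polys_dense[OF f \<open>e > 0\<close>] by blast
      have \<psi>i: "integrable lebesgue_circle (\<lambda>p. h p * \<psi> (circle_rep p))"
        using \<psi>(1) by (intro integrable_circle_mult[OF h] test_functions_continuous trig_polys_test trig_polys_periodic)
      have "(\<integral>p. h p * f p \<partial>lebesgue_circle) = (\<integral>p. h p * f p - h p * \<psi> (circle_rep p) \<partial>lebesgue_circle)"
        using orth[OF \<psi>(1)] hf \<psi>i by simp
      also have "\<bar>\<dots>\<bar> \<le> (\<integral>p. \<bar>h p * f p - h p * \<psi> (circle_rep p)\<bar> \<partial>lebesgue_circle)"
        by (rule integral_abs_bound)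
      also have "\<dots> \<le> (\<integral>p. e * \<bar>h p\<bar> \<partial>lebesgue_circle)"
      proof (rule integral_mono)
        show "\<bar>h p * f p - h p * \<psi> (circle_rep p)\<bar> \<le> e * \<bar>h p\<bar>" for p
          unfolding right_diff_distrib[symmetric] abs_mult
          using \<psi>(2)[of p] by (subst mult.commute) (intro mult_right_mono, auto)
      qed (use h hf \<psi>i in auto)
      finally show ?thesis by (simp add: N_def)
    qed
    have "\<bar>\<integral>p. h p * f p \<partial>lebesgue_circle\<bar> \<le> 0"
    proof (rule field_le_epsilon)
      fix e :: real assume "e > 0"
      have "\<bar>\<integral>p. h p * f p \<partial>lebesgue_circle\<bar> \<le> e / (N + 1) * N" using N \<open>e > 0\<close> by (intro *) auto
      also have "\<dots> \<le> e" using N \<open>e > 0\<close> by (simp add: field_simps)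
      finally show "\<bar>\<integral>p. h p * f p \<partial>lebesgue_circle\<bar> \<le> 0 + e" by simp
    qed
    then show ?thesis by simp
  qed
  have closed: "(LINT p:C|lebesgue_circle. h p) = 0" if C: "closed C" for C
  proof (cases "C = {}")
    case False
    \<comment> \<open>Equal to 1 on C and eventually 0 at each point off C. The empty set was split
      off because \<open>infdist\<close> to it is 0 by convention.\<close>
    define f where "f n p = max 0 (1 - of_nat n * infdist p C)" for n p
    have "(\<lambda>n. \<integral>p. h p * f n p \<partial>lebesgue_circle) \<longlonglongrightarrow> (\<integral>p. indicator C p *\<^sub>R h p \<partial>lebesgue_circle)"
    proof (rule integral_dominated_convergence)
      show "integrable lebesgue_circle (\<lambda>p. \<bar>h p\<bar>)" using h by simp
      have [measurable]: "C \<in> sets borel" using C by (rule borel_closed)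
      show "(\<lambda>p. indicator C p *\<^sub>R h p) \<in> borel_measurable lebesgue_circle" by measurable
      have "f n \<in> borel_measurable borel" for n
        unfolding f_def by (intro borel_measurable_continuous_onI continuous_intros)
      then show "(\<lambda>p. h p * f n p) \<in> borel_measurable lebesgue_circle" for n by simp
      show "AE p in lebesgue_circle. norm (h p * f n p) \<le> \<bar>h p\<bar>" for n
      proof (rule AE_I2)
        fix p
        have "0 \<le> real n * infdist p C" by (simp add: infdist_nonneg)
        then have "\<bar>f n p\<bar> \<le> 1" by (auto simp: f_def)
        then show "norm (h p * f n p) \<le> \<bar>h p\<bar>" by (simp add: abs_mult mult_left_le)
      qed
      show "AE p in lebesgue_circle. (\<lambda>n. h p * f n p) \<longlonglongrightarrow> indicator C p *\<^sub>R h p"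
      proof (rule AE_I2)
        fix p
        show "(\<lambda>n. h p * f n p) \<longlonglongrightarrow> indicator C p *\<^sub>R h p"
        proof (cases "p \<in> C")
          case True
          then show ?thesis by (simp add: f_def)
        next
          case False
          then have d: "infdist p C > 0"
            using in_closed_iff_infdist_zero[OF C \<open>C \<noteq> {}\<close>, of p] infdist_nonneg[of p C] by auto
          obtain N where N: "1 / infdist p C < of_nat N" using reals_Archimedean2 by blast
          have "f n p = 0" if "n \<ge> N" for n
          proof -
            have "1 < of_nat N * infdist p C" using N d by (simp add: pos_divide_less_eq)
            also have "\<dots> \<le> of_nat n * infdist p C" using that d by (intro mult_right_mono) auto
            finally show ?thesis by (simp add: f_def)
          qed
          then have "\<forall>\<^sub>F n in sequentially. h p * f n p = 0"
            by (auto simp: eventually_sequentially)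
          then show ?thesis using False by (auto intro: tendsto_eventually)
        qed
      qed
    qed
    moreover have "(\<integral>p. h p * f n p \<partial>lebesgue_circle) = 0" for n
      unfolding f_def by (intro cont continuous_intros)
    ultimately show ?thesis
      unfolding set_lebesgue_integral_def by (simp add: LIMSEQ_const_iff)
  qed (simp add: set_lebesgue_integral_def)
  have hi: "set_integrable lebesgue_circle A h" if "A \<in> sets borel" for A
    unfolding set_integrable_def using that by (intro integrable_mult_indicator h) simp
  have all: "(LINT p:A|lebesgue_circle. h p) = 0" if "A \<in> sets (borel :: circle measure)" for A
  proof -
    have A: "A \<in> sigma_sets UNIV (Collect closed)"
      using that by (subst (asm) borel_eq_closed) simp
    have cl: "sets (borel :: circle measure) = sigma_sets UNIV (Collect closed)"
      by (subst borel_eq_closed) simp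
    show ?thesis
    proof (rule sigma_sets_induct_disjoint[OF _ _ A, where P = "\<lambda>A. (LINT p:A|lebesgue_circle. h p) = 0"])
      show "Int_stable (Collect closed :: circle set set)" by (auto simp: Int_stable_def)
      fix A assume "A \<in> sigma_sets UNIV (Collect closed)" and A0: "(LINT p:A|lebesgue_circle. h p) = 0"
      then have Am: "A \<in> sets borel" by (simp add: cl)
      have "(LINT p:A \<union> (UNIV - A)|lebesgue_circle. h p) = (LINT p:A|lebesgue_circle. h p) + (LINT p:UNIV - A|lebesgue_circle. h p)"
        using Am by (intro set_integral_Un hi) auto
      moreover have "A \<union> (UNIV - A) = UNIV" by auto
      ultimately show "(LINT p:UNIV - A|lebesgue_circle. h p) = 0" using A0 closed[of UNIV] by simp
    next
      fix A :: "nat \<Rightarrow> circle set"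
      assume dj: "disjoint_family A" and Am: "range A \<subseteq> sigma_sets UNIV (Collect closed)"
        and A0: "\<And>i. (LINT p:A i|lebesgue_circle. h p) = 0"
      have Am': "A i \<in> sets borel" for i using Am by (auto simp: cl)
      have "(LINT p:(\<Union>i. A i)|lebesgue_circle. h p) = (\<Sum>i. (LINT p:A i|lebesgue_circle. h p))"
        using dj Am' by (intro lebesgue_integral_countable_add hi sets.countable_UN) (auto simp: disjoint_family_on_def)
      then show "(LINT p:(\<Union>i. A i)|lebesgue_circle. h p) = 0" by (simp add: A0)
    qed (use closed in \<open>auto simp: set_lebesgue_integral_def\<close>)
  qed
  show ?thesis
    by (rule density_unique_real[OF h, of "\<lambda>_. 0"]) (use all in \<open>auto simp: set_lebesgue_integral_def\<close>)
qed

section \<open>Uniqueness and absolutely continuous representatives\<close>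

lemma is_weak_deriv_iff:
  assumes [measurable]: "u \<in> borel_measurable borel" "g \<in> borel_measurable borel"
  shows "is_weak_deriv u g \<longleftrightarrow> (\<forall>\<phi>\<in>test_functions.
    (\<integral>p. u p * deriv \<phi> (circle_rep p) \<partial>lebesgue_circle) = - (\<integral>p. g p * \<phi> (circle_rep p) \<partial>lebesgue_circle))"
proof -
  have *: "(\<integral>p. f p * \<phi> (circle_rep p) \<partial>lebesgue_circle) = (LINT x:{0..<1}|lborel. f (to_circle x) * \<phi> x)"
    if [measurable]: "f \<in> borel_measurable borel" and \<phi>: "\<phi> \<in> test_functions" for f \<phi>
  proof -
    have [measurable]: "\<phi> \<in> borel_measurable borel"
      by (rule borel_measurable_continuous_onI[OF test_functions_continuous[OF \<phi>]])
    show ?thesis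
      by (subst integral_lebesgue_circle) (simp_all add: circle_rep_periodic[of \<phi>, OF test_functionsD(1)[OF \<phi>]])
  qed
  show ?thesis
    unfolding is_weak_deriv_def
    by (intro ball_cong refl) (simp only: *[OF assms(1) test_functionsD(3)] *[OF assms(2)])
qed

text \<open>The two derivatives pair equally with every trigonometric polynomial \<psi>, because u
  and u' pair equally with the derivative of \<psi>. This makes the choice operator in
  \<open>weak_deriv\<close> harmless.\<close>

lemma weak_deriv_unique:
  assumes u: "u \<in> borel_measurable borel" "u' \<in> borel_measurable borel" "AE p in lebesgue_circle. u p = u' p"
    and g: "g \<in> L2_circle" "g' \<in> L2_circle" and d: "is_weak_deriv u g" "is_weak_deriv u' g'"
  shows "AE p in lebesgue_circle. g p = g' p"
proof -
  note gm = L2_circle_integrable(1)[OF g(1)] L2_circle_integrable(1)[OF g(2)]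
  note gi = L2_circle_integrable(2)[OF g(1)] L2_circle_integrable(2)[OF g(2)]
  have "AE p in lebesgue_circle. g p - g' p = 0"
  proof (rule circle_integral_zero_imp_AE_zero)
    show "integrable lebesgue_circle (\<lambda>p. g p - g' p)" using gi by simp
    fix \<psi> assume "\<psi> \<in> trig_polys"
    then have \<psi>: "\<psi> \<in> test_functions" by (rule trig_polys_test)
    note c = test_functions_continuous[OF \<psi>] test_functionsD(1)[OF \<psi>]
    have [measurable]: "deriv \<psi> \<in> borel_measurable borel"
      by (rule borel_measurable_continuous_onI[OF test_functions_continuous[OF test_functionsD(3)[OF \<psi>]]])
    note [measurable] = u(1,2)
    have "(\<integral>p. u p * deriv \<psi> (circle_rep p) \<partial>lebesgue_circle) = (\<integral>p. u' p * deriv \<psi> (circle_rep p) \<partial>lebesgue_circle)"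
      by (rule integral_cong_AE) (use u(3) in \<open>auto elim!: eventually_mono\<close>)
    then have "(\<integral>p. g p * \<psi> (circle_rep p) \<partial>lebesgue_circle) = (\<integral>p. g' p * \<psi> (circle_rep p) \<partial>lebesgue_circle)"
      using d \<psi> unfolding is_weak_deriv_iff[OF u(1) gm(1)] is_weak_deriv_iff[OF u(2) gm(2)] by force
    then show "(\<integral>p. (g p - g' p) * \<psi> (circle_rep p) \<partial>lebesgue_circle) = 0"
      using integrable_circle_mult[OF gi(1) c] integrable_circle_mult[OF gi(2) c]
      by (simp add: left_diff_distrib)
  qed
  then show ?thesis by simp
qed

text \<open>Integrate the derivative of U \<phi> over one period; the boundary terms cancel.\<close>

lemma ac_deriv_is_weak_deriv:
  assumes U: "ac_deriv U (\<lambda>x. g (to_circle x))" "\<And>x. U (x + 1) = U x"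
    and g: "g \<in> L2_circle"
  shows "is_weak_deriv (\<lambda>p. U (circle_rep p)) g"
proof -
  note gm [measurable] = L2_circle_integrable(1)[OF g]
  note Uc = ac_deriv_continuous[OF U(1)]
  have Um [measurable]: "U \<in> borel_measurable borel" by (rule borel_measurable_continuous_onI[OF Uc])
  have "(\<integral>p. U (circle_rep p) * deriv \<phi> (circle_rep p) \<partial>lebesgue_circle) = - (\<integral>p. g p * \<phi> (circle_rep p) \<partial>lebesgue_circle)"
    if \<phi>: "\<phi> \<in> test_functions" for \<phi>
  proof -
    note \<phi>' = test_functionsD(3)[OF \<phi>]
    note c = test_functions_continuous[OF \<phi>] test_functions_continuous[OF \<phi>']
    note per = test_functionsD(1)[OF \<phi>] test_functionsD(1)[OF \<phi>']
    have [measurable]: "\<phi> \<in> borel_measurable borel" "deriv \<phi> \<in> borel_measurable borel"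
      by (rule borel_measurable_continuous_onI[OF c(1)] borel_measurable_continuous_onI[OF c(2)])+
    have i1: "integrable lebesgue_circle (\<lambda>p. U (circle_rep p) * deriv \<phi> (circle_rep p))"
      by (rule integrable_circle_mult[OF integrable_circle_continuous[OF Uc U(2)] c(2) per(2)])
    have i2: "integrable lebesgue_circle (\<lambda>p. g p * \<phi> (circle_rep p))"
      by (rule integrable_circle_mult[OF L2_circle_integrable(2)[OF g] c(1) per(1)])
    have "ac_deriv \<phi> (deriv \<phi>)" by (rule ac_deriv_C1[OF test_functionsD(2)[OF \<phi>] c(2)])
    from ac_derivD(3)[OF ac_deriv_mult[OF U(1) this], of 0 1]
    have "(LINT x:{0..0+1}|lborel. g (to_circle x) * \<phi> x + U x * deriv \<phi> x) = 0"
      using U(2)[of 0] per(1)[of 0] by simp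
    then have "(\<integral>p. g p * \<phi> (circle_rep p) + U (circle_rep p) * deriv \<phi> (circle_rep p) \<partial>lebesgue_circle) = 0"
      by (subst integral_lebesgue_circle_window[of _ 0])
        (simp_all add: circle_rep_periodic[of \<phi>, OF per(1)] circle_rep_periodic[of "deriv \<phi>", OF per(2)]
          circle_rep_periodic[of U, OF U(2)])
    then show ?thesis using i1 i2 by simp
  qed
  then show ?thesis by (simp add: is_weak_deriv_iff)
qed

lemma L2_circle_continuous:
  assumes "continuous_on UNIV U" "\<And>x. U (x + 1) = U x"
  shows "(\<lambda>p. U (circle_rep p)) \<in> L2_circle"
proof -
  have [measurable]: "U \<in> borel_measurable borel" using assms(1) by (rule borel_measurable_continuous_onI)
  have "integrable lebesgue_circle (\<lambda>p. (\<lambda>x. (U x)\<^sup>2) (circle_rep p))"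
    by (rule integrable_circle_continuous) (use assms in \<open>auto intro!: continuous_intros\<close>)
  then show ?thesis by (simp add: L2_circle_def)
qed

text \<open>The du Bois-Reymond lemma on the circle. A primitive V of g has the same weak derivative
  as u, so u - V annihilates all derivatives of test functions and must be constant.\<close>

lemma weak_deriv_ac_representative:
  assumes u: "u \<in> L2_circle" and g: "g \<in> L2_circle" and d: "is_weak_deriv u g"
  shows "\<exists>U. ac_deriv U (\<lambda>x. g (to_circle x)) \<and> (\<forall>x. U (x + 1) = U x) \<and>
    (AE p in lebesgue_circle. u p = U (circle_rep p))"
proof -
  interpret prob_space lebesgue_circle by (rule prob_space_lebesgue_circle)
  note um [measurable] = L2_circle_integrable(1)[OF u]
  note gm [measurable] = L2_circle_integrable(1)[OF g]
  define V where "V = primitive (\<lambda>x. g (to_circle x))"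
  have V: "ac_deriv V (\<lambda>x. g (to_circle x))"
    unfolding V_def by (rule ac_deriv_primitive) (use L2_circle_integrable(4)[OF g] in auto)
  \<comment> \<open>Testing with the constant 1 shows that g has mean zero, which is the periodicity
    of V.\<close>
  have one: "(\<lambda>x. 1) \<in> test_functions" by (rule trig_polys_test[OF trig_polys.const])
  have "(\<integral>p. g p \<partial>lebesgue_circle) = 0"
    using d one unfolding is_weak_deriv_iff[OF um gm] by force
  then have Vper: "V (x + 1) = V x" for x
    using ac_derivD(3)[OF V, of x "x + 1"] integral_lebesgue_circle_window[OF gm, of x] by simp
  note Vc = ac_deriv_continuous[OF V, of UNIV]
  have Vm [measurable]: "V \<in> borel_measurable borel" by (rule borel_measurable_continuous_onI[OF Vc])
  have Vi: "integrable lebesgue_circle (\<lambda>p. V (circle_rep p))"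
    by (rule integrable_circle_continuous[OF Vc Vper])
  note ui = L2_circle_integrable(2)[OF u]
  define k where "k = (\<integral>p. u p - V (circle_rep p) \<partial>lebesgue_circle)"
  have hi: "integrable lebesgue_circle (\<lambda>p. u p - V (circle_rep p) - k)"
    using ui Vi by (intro Bochner_Integration.integrable_diff integrable_const)
  have "AE p in lebesgue_circle. u p - V (circle_rep p) - k = 0"
  proof (rule circle_integral_zero_imp_AE_zero[OF hi])
    fix \<psi> assume \<psi>: "\<psi> \<in> trig_polys"
    define m where "m = (LINT x:{0..1}|lborel. \<psi> x)"
    \<comment> \<open>The weak identity only sees derivatives of test functions. Subtracting the
      mean turns \<psi> into one, and the constant m left over is harmless because k was chosen to
      give u - V - k mean zero.\<close>
    have \<psi>': "(\<lambda>x. \<psi> x + - m) \<in> trig_polys" by (rule trig_polys.add[OF \<psi> trig_polys.const])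
    have si: "set_integrable lborel {0..1::real} \<psi>"
      by (rule set_integrable_continuous[OF test_functions_continuous[OF trig_polys_test[OF \<psi>]]])
    have "(LINT x:{0..1}|lborel. \<psi> x + - m) = (LINT x:{0..1}|lborel. \<psi> x) + (LINT x:{0..1::real}|lborel. - m)"
      by (rule set_integral_add(2)[OF si set_integrable_continuous]) simp
    also have "\<dots> = 0" by (simp add: m_def set_lebesgue_integral_def)
    finally have z: "(LINT x:{0..1}|lborel. \<psi> x + - m) = 0" .
    obtain \<phi> where \<phi>: "\<phi> \<in> test_functions" "deriv \<phi> = (\<lambda>x. \<psi> x + - m)"
      using test_functions_antiderivative[OF trig_polys_test[OF \<psi>'] z] by blast
    have c: "continuous_on UNIV (deriv \<phi>)" "deriv \<phi> (x + 1) = deriv \<phi> x" for x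
      using test_functions_continuous[OF test_functionsD(3)[OF \<phi>(1)]] test_functionsD(1)[OF test_functionsD(3)[OF \<phi>(1)]] by auto
    have "(\<integral>p. u p * deriv \<phi> (circle_rep p) \<partial>lebesgue_circle) = (\<integral>p. V (circle_rep p) * deriv \<phi> (circle_rep p) \<partial>lebesgue_circle)"
      using d ac_deriv_is_weak_deriv[OF V Vper g] \<phi>(1)
      by (simp add: is_weak_deriv_iff)
    then have 1: "(\<integral>p. (u p - V (circle_rep p)) * deriv \<phi> (circle_rep p) \<partial>lebesgue_circle) = 0"
      using integrable_circle_mult[OF ui c] integrable_circle_mult[OF Vi c] by (simp add: left_diff_distrib)
    have 2: "(\<integral>p. deriv \<phi> (circle_rep p) \<partial>lebesgue_circle) = 0"
    proof -
      have [measurable]: "deriv \<phi> \<in> borel_measurable borel" by (rule borel_measurable_continuous_onI[OF c(1)])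
      have "(\<integral>p. deriv \<phi> (circle_rep p) \<partial>lebesgue_circle) = (LINT x:{0..0+1}|lborel. deriv \<phi> (circle_rep (to_circle x)))"
        by (rule integral_lebesgue_circle_window) measurable
      also have "\<dots> = (LINT x:{0..1}|lborel. deriv \<phi> x)"
        unfolding circle_rep_periodic[of "deriv \<phi>", OF c(2)] by simp
      finally show ?thesis using z by (simp only: \<phi>(2))
    qed
    have 3: "(\<integral>p. u p - V (circle_rep p) - k \<partial>lebesgue_circle) = 0"
      using ui Vi prob_space by (simp add: k_def)
    have uV: "integrable lebesgue_circle (\<lambda>p. u p - V (circle_rep p))" using ui Vi by simp
    have "(u p - V (circle_rep p) - k) * \<psi> (circle_rep p) =
       ((u p - V (circle_rep p)) * deriv \<phi> (circle_rep p) - k * deriv \<phi> (circle_rep p)) + m * (u p - V (circle_rep p) - k)" for p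
      by (simp add: \<phi>(2) algebra_simps)
    then have "(\<integral>p. (u p - V (circle_rep p) - k) * \<psi> (circle_rep p) \<partial>lebesgue_circle) =
      (\<integral>p. ((u p - V (circle_rep p)) * deriv \<phi> (circle_rep p) - k * deriv \<phi> (circle_rep p)) + m * (u p - V (circle_rep p) - k) \<partial>lebesgue_circle)"
      by (simp only:)
    also have "\<dots> = ((\<integral>p. (u p - V (circle_rep p)) * deriv \<phi> (circle_rep p) \<partial>lebesgue_circle) - k * (\<integral>p. deriv \<phi> (circle_rep p) \<partial>lebesgue_circle))
       + m * (\<integral>p. u p - V (circle_rep p) - k \<partial>lebesgue_circle)"
    proof -
      note i1 = integrable_circle_mult[OF uV c]
      note i2 = integrable_mult_right[OF integrable_circle_continuous[OF c], of k]
      show ?thesis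
        unfolding Bochner_Integration.integral_add[OF Bochner_Integration.integrable_diff[OF i1 i2] integrable_mult_right[OF hi, of m]]
          Bochner_Integration.integral_diff[OF i1 i2] by simp
    qed
    also have "\<dots> = 0" by (simp add: 1 2 3)
    finally show "(\<integral>p. (u p - V (circle_rep p) - k) * \<psi> (circle_rep p) \<partial>lebesgue_circle) = 0" .
  qed
  then have "AE p in lebesgue_circle. u p = V (circle_rep p) + k"
    by (rule eventually_mono) simp
  moreover have "ac_deriv (\<lambda>x. V x + k) (\<lambda>x. g (to_circle x))" using V by (simp add: ac_deriv_def)
  ultimately show ?thesis using Vper by (intro exI[of _ "\<lambda>x. V x + k"]) simp
qed

section \<open>The energy freed from choice operators\<close>

lemma has_density_unique:
  assumes "has_density \<mu> u" "has_density \<mu> v"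
  shows "AE p in lebesgue_circle. u p = v p"
proof -
  interpret prob_space lebesgue_circle by (rule prob_space_lebesgue_circle)
  have "AE p in lebesgue_circle. ennreal (u p) = ennreal (v p)"
    using assms unfolding has_density_def by (intro density_unique) auto
  moreover have "AE p in lebesgue_circle. 0 \<le> u p" "AE p in lebesgue_circle. 0 \<le> v p"
    using assms by (auto simp: has_density_def)
  ultimately show ?thesis by eventually_elim simp
qed

text \<open>The density and the weak derivative picked in \<open>dirichlet_energy\<close> are unique
  up to null sets, so any periodic absolutely continuous density may be used to compute the
  energy.\<close>

lemma dirichlet_energy_eq:
  assumes U: "ac_deriv U (\<lambda>x. g (to_circle x))" "\<And>x. U (x + 1) = U x"
    and g: "g \<in> L2_circle" and \<mu>: "has_density \<mu> (\<lambda>p. U (circle_rep p))"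
  shows "dirichlet_energy \<mu> = ereal (1 / 2 * (\<integral>p. (g p)\<^sup>2 \<partial>lebesgue_circle))"
proof -
  let ?U = "\<lambda>p. U (circle_rep p)"
  have UL: "?U \<in> L2_circle" by (rule L2_circle_continuous[OF ac_deriv_continuous[OF U(1)] U(2)])
  have Um: "?U \<in> borel_measurable borel" by (rule L2_circle_integrable(1)[OF UL])
  have UH: "?U \<in> H1_circle"
    using UL g ac_deriv_is_weak_deriv[OF U g] by (auto simp: H1_circle_def)
  then have ex: "\<exists>u\<in>H1_circle. has_density \<mu> u" using \<mu> by blast
  define u where "u = (SOME u. u \<in> H1_circle \<and> has_density \<mu> u)"
  have u: "u \<in> H1_circle" "has_density \<mu> u"
    using someI_ex[of "\<lambda>u. u \<in> H1_circle \<and> has_density \<mu> u"] ex unfolding u_def by blast+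
  have "weak_deriv u \<in> L2_circle \<and> is_weak_deriv u (weak_deriv u)"
    using u(1) unfolding weak_deriv_def H1_circle_def by (intro someI_ex[of "\<lambda>g. g \<in> L2_circle \<and> is_weak_deriv u g"]) auto
  then have w: "weak_deriv u \<in> L2_circle" "is_weak_deriv u (weak_deriv u)" by auto
  have um: "u \<in> borel_measurable borel" using u(2) by (simp add: has_density_def)
  have ae: "AE p in lebesgue_circle. u p = ?U p" by (rule has_density_unique[OF u(2) \<mu>])
  have "AE p in lebesgue_circle. weak_deriv u p = g p"
    by (rule weak_deriv_unique[OF um Um ae w(1) g w(2) ac_deriv_is_weak_deriv[OF U g]])
  then have "(\<integral>p. (weak_deriv u p)\<^sup>2 \<partial>lebesgue_circle) = (\<integral>p. (g p)\<^sup>2 \<partial>lebesgue_circle)"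
    using L2_circle_integrable(1)[OF w(1)] L2_circle_integrable(1)[OF g]
    by (intro integral_cong_AE) (auto elim!: eventually_mono)
  then show ?thesis using ex by (simp add: dirichlet_energy_def u_def Let_def)
qed

lemma dirichlet_energy_finiteE:
  assumes "dirichlet_energy \<mu> < \<infinity>"
  obtains U g where "ac_deriv U (\<lambda>x. g (to_circle x))" "\<And>x. U (x + 1) = U x" "g \<in> L2_circle"
    "has_density \<mu> (\<lambda>p. U (circle_rep p))" "\<And>x. 0 \<le> U x"
    "dirichlet_energy \<mu> = ereal (1 / 2 * (\<integral>p. (g p)\<^sup>2 \<partial>lebesgue_circle))"
proof -
  obtain u g where u: "u \<in> L2_circle" "has_density \<mu> u" "g \<in> L2_circle" "is_weak_deriv u g"
    using assms by (auto simp: dirichlet_energy_def H1_circle_def split: if_splits)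
  then obtain U where U: "ac_deriv U (\<lambda>x. g (to_circle x))" "\<And>x. U (x + 1) = U x"
    "AE p in lebesgue_circle. u p = U (circle_rep p)"
    using weak_deriv_ac_representative by blast
  note Uc = ac_deriv_continuous[OF U(1)]
  have Um [measurable]: "U \<in> borel_measurable borel" by (rule borel_measurable_continuous_onI[OF Uc])
  have um [measurable]: "u \<in> borel_measurable borel" using u(2) by (simp add: has_density_def)
  have "AE p in lebesgue_circle. 0 \<le> u p" using u(2) by (simp add: has_density_def)
  with U(3) have U0: "AE p in lebesgue_circle. 0 \<le> U (circle_rep p)" by eventually_elim simp
  have "\<mu> = density lebesgue_circle (\<lambda>p. ennreal (U (circle_rep p)))"
    using u(2) U(3) unfolding has_density_def by (auto intro!: density_cong elim!: eventually_mono)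
  with U0 have hd: "has_density \<mu> (\<lambda>p. U (circle_rep p))" by (simp add: has_density_def)
  show ?thesis
    by (rule that[OF U(1,2) u(3) hd AE_lebesgue_circle_le_continuous[OF Uc U(2) U0] dirichlet_energy_eq[OF U(1,2) u(3) hd]])
qed

section \<open>Quantile maps\<close>

lemma degree_one_add_int:
  fixes F :: "real \<Rightarrow> real"
  assumes "\<And>x. F (x + 1) = F x + 1"
  shows "F (x + of_int k) = F x + of_int k"
  using periodic_add_int[of "\<lambda>x. F x - x" x k] assms by (simp add: algebra_simps)

text \<open>F is the lift of a circle diffeomorphism. It is onto because F n = F 0 + n for integers
  n makes it unbounded in both directions, and injective because it increases.\<close>

lemma degree_one_inverse:
  fixes F f :: "real \<Rightarrow> real"
  assumes F: "\<And>x. (F has_real_derivative f x) (at x)" and pos: "\<And>x. f x > 0"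
    and per: "\<And>x. F (x + 1) = F x + 1"
  obtains G where "\<And>x. G (F x) = x" "\<And>y. F (G y) = y"
    "\<And>y. (G has_real_derivative 1 / f (G y)) (at y)" "\<And>y. G (y + 1) = G y + 1"
proof -
  have lt: "F a < F b" if "a < b" for a b
    by (rule DERIV_pos_imp_increasing[OF that]) (use F pos in blast)
  have inj: "inj F"
    by (rule injI) (metis lt linorder_neqE_linordered_idom order_less_irrefl)
  have cont: "isCont F x" for x using F DERIV_isCont by blast
  have surj: "\<exists>x. F x = y" for y
  proof -
    obtain n :: nat where n: "\<bar>y\<bar> + \<bar>F 0\<bar> \<le> of_nat n" using real_arch_simple by blast
    have "F (of_int (int n)) = F 0 + of_nat n" "F (of_int (- int n)) = F 0 - of_nat n"
      using degree_one_add_int[of F 0, OF per] by (metis add_0 of_int_of_nat_eq, metis add_0 diff_conv_add_uminus of_int_minus of_int_of_nat_eq)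
    then have "F (- of_nat n) \<le> y" "y \<le> F (of_nat n)" using n by auto
    then show ?thesis using IVT[of F "- of_nat n" y "of_nat n"] cont by auto
  qed
  define G where "G = inv F"
  have GF: "G (F x) = x" for x using inj by (simp add: G_def)
  have FG: "F (G y) = y" for y using surj by (metis G_def f_inv_into_f rangeI)
  have Gc: "isCont G y" for y
    using isCont_inverse_function[of 1 "G y" G F] GF FG cont by simp
  have "(G has_real_derivative inverse (f (G y))) (at y)" for y
  proof (rule DERIV_inverse_function)
    show "(F has_real_derivative f (G y)) (at (G y))" by (rule F)
    show "f (G y) \<noteq> 0" using pos[of "G y"] by simp
    show "y - 1 < y" "y < y + 1" by simp_all
    show "F (G z) = z" for z by (rule FG)
    show "isCont G y" by (rule Gc)
  qed
  moreover have "G (y + 1) = G y + 1" for y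
    by (metis GF FG per)
  ultimately show ?thesis using that[of G] GF FG by (simp add: inverse_eq_divide)
qed

text \<open>\<open>X\<close> is a quantile function, lifted to the line, of a measure on the circle whose density at
  \<open>X z\<close> is \<open>1 / P z\<close>.\<close>

definition quantile_map :: "(real \<Rightarrow> real) \<Rightarrow> (real \<Rightarrow> real) \<Rightarrow> (real \<Rightarrow> real) \<Rightarrow> bool"
  where "quantile_map X P A \<longleftrightarrow> (\<forall>z. (X has_real_derivative P z) (at z)) \<and> (\<forall>z. P z > 0) \<and>
    ac_deriv P A \<and> (\<forall>z. X (z + 1) = X z + 1) \<and> (\<forall>z. A (z + 1) = A z) \<and>
    (\<forall>a b. set_integrable lborel {a..b} (\<lambda>z. (A z)\<^sup>2))"

lemma quantile_mapD:
  assumes "quantile_map X P A"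
  shows "(X has_real_derivative P z) (at z)" "P z > 0" "ac_deriv P A" "X (z + 1) = X z + 1"
    "P (z + 1) = P z" "A (z + 1) = A z" "set_integrable lborel {a..b} (\<lambda>z. (A z)\<^sup>2)"
    "continuous_on S X" "continuous_on S P" "A \<in> borel_measurable borel"
proof -
  show D: "(X has_real_derivative P z) (at z)" for z using assms by (simp add: quantile_map_def)
  show per: "X (z + 1) = X z + 1" for z using assms by (simp add: quantile_map_def)
  show "P z > 0" "A (z + 1) = A z" "set_integrable lborel {a..b} (\<lambda>z. (A z)\<^sup>2)"
    using assms by (simp_all add: quantile_map_def)
  show ac: "ac_deriv P A" using assms by (simp add: quantile_map_def)
  show "continuous_on S P" by (rule ac_deriv_continuous[OF ac])
  show "A \<in> borel_measurable borel" by (rule ac_derivD(1)[OF ac])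
  show "continuous_on S X" using D by (meson DERIV_isCont continuous_at_imp_continuous_on)
  have "((\<lambda>y. X (y + 1)) has_real_derivative P (z + 1)) (at z)"
    using D[of "z + 1"] by (subst DERIV_shift[symmetric])
  then have "((\<lambda>y. X y + 1) has_real_derivative P (z + 1)) (at z)" by (simp add: per)
  moreover have "((\<lambda>y. X y + 1) has_real_derivative P z) (at z)"
    using DERIV_add[OF D[of z] DERIV_const[of 1]] by simp
  ultimately show "P (z + 1) = P z" by (rule DERIV_unique)
qed

text \<open>X maps [0, 1] onto the unit window [X 0, X 0 + 1], and the circle integral may be taken
  over any such window.\<close>

lemma nn_integral_circle_substitution:
  fixes f :: "circle \<Rightarrow> ennreal"
  assumes X: "\<And>z. (X has_real_derivative P z) (at z)" "continuous_on UNIV P" "\<And>z. P z \<ge> 0"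
    and per: "X (0 + 1) = X 0 + 1"
    and [measurable]: "f \<in> borel_measurable borel"
  shows "(\<integral>\<^sup>+p. f p \<partial>lebesgue_circle) =
    (\<integral>\<^sup>+z. f (to_circle (X z)) * ennreal (P z) * indicator {0..1} z \<partial>lborel)"
proof -
  have "(\<integral>\<^sup>+p. f p \<partial>lebesgue_circle) = (\<integral>\<^sup>+x. f (to_circle x) * indicator {X 0..X 1} x \<partial>lborel)"
    using nn_integral_lebesgue_circle_window[of f "X 0"] per by simp
  also have "\<dots> = (\<integral>\<^sup>+z. f (to_circle (X z)) * ennreal (P z) * indicator {0..1} z \<partial>lborel)"
    by (rule nn_integral_substitution_aux[where f = "\<lambda>x. f (to_circle x)"])
      (use X continuous_on_subset in \<open>auto intro: continuous_on_subset[OF X(2)]\<close>)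
  finally show ?thesis .
qed

section \<open>Laws of lifted maps and their energy\<close>

definition circle_law :: "(real \<Rightarrow> real) \<Rightarrow> circle measure"
  where "circle_law X = distr (restrict_space lborel {0..<1}) borel (\<lambda>z. to_circle (X z))"

lemma sets_circle_law [measurable_cong, simp]: "sets (circle_law X) = sets borel"
  and space_circle_law [simp]: "space (circle_law X) = UNIV"
  by (simp_all add: circle_law_def)


lemma nn_integral_circle_law:
  assumes [measurable]: "X \<in> borel_measurable borel" "f \<in> borel_measurable borel"
  shows "(\<integral>\<^sup>+p. f p \<partial>circle_law X) = (\<integral>\<^sup>+z. f (to_circle (X z)) * indicator {0..1} z \<partial>lborel)"
proof -
  have "(\<integral>\<^sup>+p. f p \<partial>circle_law X) = (\<integral>\<^sup>+z. f (to_circle (X z)) * indicator {0..<1} z \<partial>lborel)"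
    unfolding circle_law_def
    by (subst nn_integral_distr) (auto simp: nn_integral_restrict_space intro!: measurable_restrict_space1)
  also have "\<dots> = (\<integral>\<^sup>+z. f (to_circle (X z)) * indicator {0..1} z \<partial>lborel)"
    by (rule nn_integral_cong_AE, rule eventually_mono[OF AE_lborel_singleton[of 1]])
      (auto split: split_indicator)
  finally show ?thesis .
qed

lemma prob_space_circle_law:
  assumes [measurable]: "X \<in> borel_measurable borel"
  shows "prob_space (circle_law X)"
  by standard (simp add: circle_law_def emeasure_distr emeasure_restrict_space
      measurable_restrict_space1 space_restrict_space)

lemma integral_circle_law:
  fixes f :: "circle \<Rightarrow> real"
  assumes [measurable]: "X \<in> borel_measurable borel" "f \<in> borel_measurable borel"
  shows "(\<integral>p. f p \<partial>circle_law X) = (LINT z:{0..1}|lborel. f (to_circle (X z)))"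
proof -
  have "(\<integral>p. f p \<partial>circle_law X) = (\<integral>z. f (to_circle (X z)) \<partial>restrict_space lborel {0..<1})"
    unfolding circle_law_def by (rule integral_distr) (auto intro!: measurable_restrict_space1)
  also have "\<dots> = (LINT z:{0..<1}|lborel. f (to_circle (X z)))"
    unfolding set_lebesgue_integral_def by (subst integral_restrict_space) auto
  also have "\<dots> = (LINT z:{0..1}|lborel. f (to_circle (X z)))"
    by (rule set_integral_discrete_difference[of "{1}"]) auto
  finally show ?thesis .
qed

text \<open>In the change of variables the density U (X z) is cancelled by the Jacobian P z. The
  lemma serves in both directions, from a density to its quantile maps and from a quantile map to
  its density.\<close>

lemma density_eq_circle_law:
  assumes X: "\<And>z. (X has_real_derivative P z) (at z)" "continuous_on UNIV P" "\<And>z. P z > 0"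
    and per: "X (0 + 1) = X 0 + 1"
    and U: "U \<in> borel_measurable borel" "\<And>x. U (x + 1) = U x" "\<And>z. U (X z) * P z = 1"
  shows "density lebesgue_circle (\<lambda>p. ennreal (U (circle_rep p))) = circle_law X"
proof (rule measure_eqI)
  have [measurable]: "X \<in> borel_measurable borel"
    using X(1) by (intro borel_measurable_continuous_onI) (meson DERIV_isCont continuous_at_imp_continuous_on)
  note [measurable] = U(1)
  fix A assume "A \<in> sets (density lebesgue_circle (\<lambda>p. ennreal (U (circle_rep p))))"
  then have [measurable]: "A \<in> sets borel" by simp
  have *: "ennreal (U (X z)) * i * ennreal (P z) * j = i * j" for z and i j :: ennreal
  proof -
    have "U (X z) = 1 / P z" using U(3)[of z] X(3)[of z] by (simp add: field_simps)
    then have "ennreal (U (X z)) * ennreal (P z) = 1"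
      using X(3)[of z] by (simp flip: ennreal_mult)
    then show ?thesis by (metis mult.assoc mult.commute mult.left_neutral)
  qed
  have "emeasure (density lebesgue_circle (\<lambda>p. ennreal (U (circle_rep p)))) A =
     (\<integral>\<^sup>+p. ennreal (U (circle_rep p)) * indicator A p \<partial>lebesgue_circle)"
    by (rule emeasure_density) auto
  also have "\<dots> = (\<integral>\<^sup>+z. ennreal (U (X z)) * indicator A (to_circle (X z)) * ennreal (P z) * indicator {0..1} z \<partial>lborel)"
    by (subst nn_integral_circle_substitution[OF X(1,2) less_imp_le[OF X(3)] per])
      (simp_all add: circle_rep_periodic[of U, OF U(2)])
  also have "\<dots> = (\<integral>\<^sup>+z. indicator A (to_circle (X z)) * indicator {0..1} z \<partial>lborel)"
    by (simp only: *)
  also have "\<dots> = (\<integral>\<^sup>+p. indicator A p \<partial>circle_law X)"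
    by (rule nn_integral_circle_law[symmetric]) auto
  finally show "emeasure (density lebesgue_circle (\<lambda>p. ennreal (U (circle_rep p)))) A = emeasure (circle_law X) A"
    by simp
qed simp

text \<open>With G inverse to X, the density is 1 / P (G x), whose derivative at x = X z is - A z /
  (P z)^3. Squaring it and substituting with Jacobian P z leaves A^2 / P^5.\<close>

lemma dirichlet_energy_circle_law:
  assumes q: "quantile_map X P A"
  shows "dirichlet_energy (circle_law X) = ereal (1 / 2 * (LINT z:{0..1}|lborel. (A z)\<^sup>2 / P z ^ 5))"
proof -
  note D = quantile_mapD[OF q]
  obtain G where G: "\<And>x. G (X x) = x" "\<And>y. X (G y) = y"
    "\<And>y. (G has_real_derivative 1 / P (G y)) (at y)" "\<And>y. G (y + 1) = G y + 1"
    using degree_one_inverse[of X P, OF D(1,2,4)] by metis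
  have Gc: "continuous_on UNIV G" using G(3) by (meson DERIV_isCont continuous_at_imp_continuous_on)
  define U where "U x = 1 / P (G x)" for x
  define g where "g x = (- 1 / (P (G x))\<^sup>2 * A (G x)) * (1 / P (G x))" for x
  have Uc: "continuous_on UNIV U"
    unfolding U_def using D(2) by (intro continuous_intros continuous_on_compose2[OF D(9) Gc]) (auto simp: less_imp_neq[symmetric])
  have U: "ac_deriv U g"
    unfolding U_def g_def
    by (rule ac_deriv_compose[OF ac_deriv_inverse[OF D(3,2)] G(3)])
      (use Uc D(2) in \<open>auto simp: U_def[abs_def] less_imp_le\<close>)
  have Uper: "U (x + 1) = U x" and gper: "g (x + 1) = g x" for x
    by (simp_all add: U_def g_def G(4) D)
  define gc where "gc p = g (circle_rep p)" for p
  have gc: "gc (to_circle x) = g x" for x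
    unfolding gc_def by (rule circle_rep_periodic[of g, OF gper])
  have gm [measurable]: "g \<in> borel_measurable borel" by (rule ac_derivD(1)[OF U])
  have gcm [measurable]: "gc \<in> borel_measurable borel" unfolding gc_def[abs_def] by measurable
  have Am [measurable]: "A \<in> borel_measurable borel" by (rule D(10))
  have Pm [measurable]: "P \<in> borel_measurable borel" by (rule borel_measurable_continuous_onI[OF D(9)])
  have si: "set_integrable lborel {0..1} (\<lambda>z. (A z)\<^sup>2 / P z ^ 5)"
  proof -
    have "P z \<noteq> 0" for z using D(2)[of z] by simp
    then have "continuous_on {0..1} (\<lambda>z. 1 / P z ^ 5)"
      by (intro continuous_on_divide continuous_on_const continuous_on_power D(9)) auto
    from set_integrable_continuous_mult[OF D(7) this] show ?thesis by simp
  qed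
  have eq: "(g (X z))\<^sup>2 * P z = (A z)\<^sup>2 / P z ^ 5" for z
    using D(2)[of z] by (simp add: g_def G(1) power_mult_distrib power_divide field_simps eval_nat_numeral)
  have nn: "(\<integral>\<^sup>+p. ennreal ((gc p)\<^sup>2) \<partial>lebesgue_circle) =
      (\<integral>\<^sup>+z. ennreal (indicator {0..1} z *\<^sub>R ((A z)\<^sup>2 / P z ^ 5)) \<partial>lborel)"
  proof -
    have "(\<integral>\<^sup>+p. ennreal ((gc p)\<^sup>2) \<partial>lebesgue_circle) =
      (\<integral>\<^sup>+z. ennreal ((gc (to_circle (X z)))\<^sup>2) * ennreal (P z) * indicator {0..1} z \<partial>lborel)"
      by (rule nn_integral_circle_substitution[OF D(1) D(9) less_imp_le[OF D(2)] D(4)]) simp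
    also have "\<dots> = (\<integral>\<^sup>+z. ennreal (indicator {0..1} z *\<^sub>R ((A z)\<^sup>2 / P z ^ 5)) \<partial>lborel)"
      unfolding gc using D(2)
      by (intro nn_integral_cong) (auto simp: eq ennreal_mult[symmetric] less_imp_le split: split_indicator)
    finally show ?thesis .
  qed
  have nonneg: "0 \<le> indicator {0..1} z *\<^sub>R ((A z)\<^sup>2 / P z ^ 5)" for z :: real
    using D(2)[of z] by (auto split: split_indicator)
  have "(\<integral>\<^sup>+z. ennreal (indicator {0..1} z *\<^sub>R ((A z)\<^sup>2 / P z ^ 5)) \<partial>lborel) < \<infinity>"
    using si unfolding set_integrable_def integrable_iff_bounded real_norm_def abs_of_nonneg[OF nonneg]
    by blast
  then have L2: "gc \<in> L2_circle"
    unfolding L2_circle_def by (auto intro!: integrableI_nonneg simp: nn)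
  have U0: "0 \<le> U x" for x using D(2) by (simp add: U_def less_imp_le)
  have Um [measurable]: "U \<in> borel_measurable borel" by (rule borel_measurable_continuous_onI[OF Uc])
  have UX: "U (X z) * P z = 1" for z using D(2)[of z] by (simp add: U_def G(1))
  have "has_density (circle_law X) (\<lambda>p. U (circle_rep p))"
    unfolding has_density_def using U0 density_eq_circle_law[OF D(1,9,2,4) Um Uper UX] by simp
  moreover have "ac_deriv U (\<lambda>x. gc (to_circle x))" using U by (simp add: gc)
  ultimately have "dirichlet_energy (circle_law X) = ereal (1 / 2 * (\<integral>p. (gc p)\<^sup>2 \<partial>lebesgue_circle))"
    using dirichlet_energy_eq[of U gc, OF _ Uper L2] by blast
  also have "(\<integral>p. (gc p)\<^sup>2 \<partial>lebesgue_circle) = (LINT z:{0..1}|lborel. (A z)\<^sup>2 / P z ^ 5)"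
  proof -
    have "(\<integral>p. (gc p)\<^sup>2 \<partial>lebesgue_circle) = enn2real (\<integral>\<^sup>+p. ennreal ((gc p)\<^sup>2) \<partial>lebesgue_circle)"
      by (rule integral_eq_nn_integral) auto
    also have "\<dots> = (LINT z:{0..1}|lborel. (A z)\<^sup>2 / P z ^ 5)"
      unfolding nn set_lebesgue_integral_def
      by (rule integral_eq_nn_integral[symmetric]) (use nonneg in auto)
    finally show ?thesis .
  qed
  finally show ?thesis .
qed

text \<open>X is the inverse of the distribution function F, which has degree one because every unit
  window carries mass 1. F is returned as well, since closeness of quantile maps is later measured
  through distribution functions.\<close>

lemma quantile_map_exists:
  assumes U: "ac_deriv U (\<lambda>x. g (to_circle x))" "\<And>x. U (x + 1) = U x" "\<And>x. U x > 0"
    and g: "g \<in> L2_circle" and mass: "\<And>x. (LINT t:{x..x+1}|lborel. U t) = 1"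
  obtains X P A F where "quantile_map X P A" "\<And>z. U (X z) * P z = 1"
    "density lebesgue_circle (\<lambda>p. ennreal (U (circle_rep p))) = circle_law X"
    "\<And>z. F (X z) = z" "\<And>x. X (F x) = x" "F 0 = 0" "\<And>x. F (x + 1) = F x + 1" "\<And>x. (F has_real_derivative U x) (at x)"
proof -
  note Uc = ac_deriv_continuous[OF U(1)]
  obtain F where F: "F 0 = 0" "\<And>x. (F has_real_derivative U x) (at x)"
    using continuous_antiderivative[OF Uc] by blast
  have "F (x + 1) = F x + 1" for x
    using ac_derivD(3)[OF ac_deriv_C1[OF F(2) Uc], of x "x + 1"] mass[of x] by simp
  note Fper = this
  obtain X where X: "\<And>x. X (F x) = x" "\<And>y. F (X y) = y"
    "\<And>y. (X has_real_derivative 1 / U (X y)) (at y)" "\<And>y. X (y + 1) = X y + 1"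
    using degree_one_inverse[of F U, OF F(2) U(3) Fper] by metis
  have Xc: "continuous_on S X" for S using X(3) by (meson DERIV_isCont continuous_at_imp_continuous_on)
  define P where "P z = 1 / U (X z)" for z
  have Ppos: "P z > 0" for z using U(3) by (simp add: P_def)
  have UXc: "continuous_on S (\<lambda>z. U (X z))" for S
    by (rule continuous_on_compose2[OF Uc[of UNIV] Xc]) auto
  have Pc: "continuous_on S P" for S
    unfolding P_def using U(3) UXc by (intro continuous_on_divide continuous_on_const) (auto simp: less_imp_neq[symmetric])
  define A where "A z = (- 1 / (U (X z))\<^sup>2 * g (to_circle (X z))) * P z" for z
  have XP: "(X has_real_derivative P z) (at z)" for z unfolding P_def by (rule X(3))
  have ac: "ac_deriv P A"
    using ac_deriv_compose[OF ac_deriv_inverse[OF U(1,3)] XP Pc less_imp_le[OF Ppos]]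
    unfolding A_def[symmetric] by (simp add: P_def[symmetric])
  \<comment> \<open>Since A = - g (X) P^3, the square is P^5 times g (X)^2 P: a continuous factor
    times one that is integrable by substitution.\<close>
  have A2: "set_integrable lborel {a..b} (\<lambda>z. (A z)\<^sup>2)" for a b
  proof -
    have "ac_deriv (primitive (\<lambda>x. (g (to_circle x))\<^sup>2)) (\<lambda>x. (g (to_circle x))\<^sup>2)"
      using L2_circle_integrable[OF g] by (intro ac_deriv_primitive) auto
    from ac_derivD(2)[OF ac_deriv_compose[OF this XP Pc less_imp_le[OF Ppos]], of a b]
    have "set_integrable lborel {a..b} (\<lambda>z. (g (to_circle (X z)))\<^sup>2 * P z)" .
    from set_integrable_continuous_mult[OF this continuous_on_power[OF Pc], of 5]
    have "set_integrable lborel {a..b} (\<lambda>z. P z ^ 5 * ((g (to_circle (X z)))\<^sup>2 * P z))" .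
    moreover have "P z ^ 5 * ((g (to_circle (X z)))\<^sup>2 * P z) = (A z)\<^sup>2" for z
      using U(3)[of "X z"] by (simp add: A_def P_def power_mult_distrib power_divide field_simps eval_nat_numeral)
    ultimately show ?thesis by simp
  qed
  have q: "quantile_map X P A"
    unfolding quantile_map_def using XP Ppos ac X(4) A2
    by (auto simp: A_def P_def U(2))
  have Um: "U \<in> borel_measurable borel" by (rule borel_measurable_continuous_onI[OF Uc])
  have UX: "U (X z) * P z = 1" for z using U(3)[of "X z"] by (simp add: P_def)
  show ?thesis
    by (rule that[OF q UX density_eq_circle_law[OF XP Pc Ppos X(4) Um U(2) UX] X(2,1) F(1) Fper F(2)])
qed

section \<open>Closeness of densities\<close>

text \<open>The embedding of H1 into Hoelder functions of exponent 1/2: Cauchy-Schwarz on [a, b],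
  then the interval is enlarged to a full period.\<close>

lemma ac_deriv_holder:
  assumes U: "ac_deriv U (\<lambda>x. g (to_circle x))" and g: "g \<in> L2_circle" and ab: "a \<le> b" "b \<le> a + 1"
  shows "(U b - U a)\<^sup>2 \<le> (b - a) * (\<integral>p. (g p)\<^sup>2 \<partial>lebesgue_circle)"
proof -
  note gm [measurable] = L2_circle_integrable(1)[OF g]
  note g2 = L2_circle_integrable(3)[OF g]
  have "(U b - U a)\<^sup>2 \<le> (b - a) * (LINT x:{a..b}|lborel. (g (to_circle x))\<^sup>2)"
    using set_integral_cauchy_schwarz[OF ab(1) ac_derivD(1)[OF U] g2] ac_derivD(3)[OF U ab(1)] by simp
  also have "(LINT x:{a..b}|lborel. (g (to_circle x))\<^sup>2) \<le> (LINT x:{a..a+1}|lborel. (g (to_circle x))\<^sup>2)"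
  proof -
    have "0 \<le> (LINT x:{b..a+1}|lborel. (g (to_circle x))\<^sup>2)"
      unfolding set_lebesgue_integral_def by (rule integral_nonneg_AE) auto
    then show ?thesis using set_integral_combine[OF ab g2] by simp
  qed
  also have "\<dots> = (\<integral>p. (g p)\<^sup>2 \<partial>lebesgue_circle)"
    by (rule integral_lebesgue_circle_window[symmetric]) simp
  finally show ?thesis using ab by (simp add: mult_left_mono)
qed

lemma density_mass:
  assumes U: "continuous_on UNIV U" "\<And>x. U (x + 1) = U x" "\<And>x. 0 \<le> U x"
    and \<mu>: "has_density \<mu> (\<lambda>p. U (circle_rep p))" "prob_space \<mu>"
  shows "(LINT t:{x..x+1}|lborel. U t) = 1"
proof -
  have [measurable]: "U \<in> borel_measurable borel" by (rule borel_measurable_continuous_onI[OF U(1)])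
  have "emeasure \<mu> UNIV = 1"
    using prob_space.emeasure_space_1[OF \<mu>(2)] \<mu>(1) by (simp add: has_density_def)
  moreover have "emeasure \<mu> UNIV = (\<integral>\<^sup>+p. ennreal (U (circle_rep p)) \<partial>lebesgue_circle)"
    using \<mu>(1) by (simp add: has_density_def emeasure_density)
  ultimately have "(\<integral>p. U (circle_rep p) \<partial>lebesgue_circle) = 1"
    using U(3) by (subst integral_eq_nn_integral) auto
  then show ?thesis
    using integral_lebesgue_circle_window[of "\<lambda>p. U (circle_rep p)" x]
    by (simp add: circle_rep_periodic[of U, OF U(2)])
qed

text \<open>A density of mean 1 is at most 1 somewhere, and the Hoelder bound controls its growth
  from there over one period.\<close>

lemma density_upper_bound:
  assumes U: "ac_deriv U (\<lambda>x. g (to_circle x))" "\<And>x. U (x + 1) = U x"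
    and g: "g \<in> L2_circle" and mass: "(LINT t:{0..1}|lborel. U t) = 1"
  shows "U x \<le> 1 + sqrt (\<integral>p. (g p)\<^sup>2 \<partial>lebesgue_circle)"
proof -
  note Uc = ac_deriv_continuous[OF U(1)]
  obtain t where t: "U t \<le> 1" using ex_le_unit_mean[OF Uc] mass by auto
  define k where "k = \<lfloor>x - t\<rfloor>"
  have k: "t \<le> x + of_int (- k)" "x + of_int (- k) \<le> t + 1" unfolding k_def by (simp_all, linarith+)
  have "0 \<le> (\<integral>p. (g p)\<^sup>2 \<partial>lebesgue_circle)" by (rule integral_nonneg_AE) auto
  then have "(x + of_int (- k) - t) * (\<integral>p. (g p)\<^sup>2 \<partial>lebesgue_circle) \<le> (\<integral>p. (g p)\<^sup>2 \<partial>lebesgue_circle)"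
    using k by (intro mult_left_le_one_le) auto
  with ac_deriv_holder[OF U(1) g k]
  have "(U (x + of_int (- k)) - U t)\<^sup>2 \<le> (\<integral>p. (g p)\<^sup>2 \<partial>lebesgue_circle)" by linarith
  then have "U (x + of_int (- k)) - U t \<le> sqrt (\<integral>p. (g p)\<^sup>2 \<partial>lebesgue_circle)"
    by (rule real_le_rsqrt)
  then show ?thesis using t periodic_add_int[of U x "- k", OF U(2)] by simp
qed

text \<open>Witnessed by the product measure. Lower bounds for the infimum in \<open>W2\<close>
  require a nonempty index set.\<close>

lemma couplings_nonempty:
  assumes "\<mu> \<in> P2" "\<nu> \<in> P2"
  shows "couplings \<mu> \<nu> \<noteq> {}"
proof -
  have m: "sets \<mu> = sets borel" "prob_space \<mu>" and n: "sets \<nu> = sets borel" "prob_space \<nu>"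
    using assms by (auto simp: P2_def)
  interpret M: prob_space \<mu> by (rule m)
  interpret N: prob_space \<nu> by (rule n)
  interpret pair_prob_space \<mu> \<nu> ..
  have sp: "space \<mu> = UNIV" "space \<nu> = UNIV"
    using sets_eq_imp_space_eq[OF m(1)] sets_eq_imp_space_eq[OF n(1)] by simp_all
  have "sets (\<mu> \<Otimes>\<^sub>M \<nu>) = sets (borel \<Otimes>\<^sub>M borel :: (circle \<times> circle) measure)"
    by (rule sets_pair_measure_cong) (use m n in auto)
  then have s: "sets (\<mu> \<Otimes>\<^sub>M \<nu>) = sets (borel :: (circle \<times> circle) measure)"
    by (simp only: borel_prod)
  have "distr (\<mu> \<Otimes>\<^sub>M \<nu>) borel fst = \<mu>"
  proof (rule measure_eqI)
    fix A assume "A \<in> sets (distr (\<mu> \<Otimes>\<^sub>M \<nu>) borel fst)"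
    then have A: "A \<in> sets \<mu>" using m by simp
    have "fst \<in> \<mu> \<Otimes>\<^sub>M \<nu> \<rightarrow>\<^sub>M borel" using m(1) by (metis measurable_cong_sets measurable_fst refl)
    moreover have "fst -` A \<inter> space (\<mu> \<Otimes>\<^sub>M \<nu>) = A \<times> space \<nu>"
      using sp by (auto simp: space_pair_measure)
    ultimately show "emeasure (distr (\<mu> \<Otimes>\<^sub>M \<nu>) borel fst) A = emeasure \<mu> A"
      using A m N.emeasure_space_1 by (simp add: emeasure_distr N.emeasure_pair_measure_Times)
  qed (simp add: m)
  moreover have "distr (\<mu> \<Otimes>\<^sub>M \<nu>) borel snd = \<nu>"
  proof (rule measure_eqI)
    fix A assume "A \<in> sets (distr (\<mu> \<Otimes>\<^sub>M \<nu>) borel snd)"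
    then have A: "A \<in> sets \<nu>" using n by simp
    have "snd \<in> \<mu> \<Otimes>\<^sub>M \<nu> \<rightarrow>\<^sub>M borel" using n(1) by (metis measurable_cong_sets measurable_snd refl)
    moreover have "snd -` A \<inter> space (\<mu> \<Otimes>\<^sub>M \<nu>) = space \<mu> \<times> A"
      using sp by (auto simp: space_pair_measure)
    ultimately show "emeasure (distr (\<mu> \<Otimes>\<^sub>M \<nu>) borel snd) A = emeasure \<nu> A"
      using A n M.emeasure_space_1 by (simp add: emeasure_distr N.emeasure_pair_measure_Times)
  qed (simp add: n)
  ultimately show ?thesis using s by (auto simp: couplings_def)
qed

lemma borel_measurable_dist_circle [measurable]:
  "(\<lambda>p::circle \<times> circle. dist (fst p) (snd p)) \<in> borel_measurable borel"
  by (intro borel_measurable_continuous_onI continuous_intros)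

text \<open>The easy half of Kantorovich-Rubinstein duality together with Jensen's inequality: for
  each coupling the difference of integrals is the expectation of ?X, and nonnegativity of the
  variance bounds its square by the expectation of ?X^2.\<close>

lemma lipschitz_integral_diff_le_W2:
  fixes \<phi> :: "circle \<Rightarrow> real"
  assumes P: "\<mu> \<in> P2" "\<nu> \<in> P2" and lip: "\<And>x y. \<bar>\<phi> x - \<phi> y\<bar> \<le> dist x y"
  shows "\<bar>(\<integral>x. \<phi> x \<partial>\<mu>) - (\<integral>x. \<phi> x \<partial>\<nu>)\<bar> \<le> W2 \<mu> \<nu>"
proof -
  have "continuous_on UNIV \<phi>"
    unfolding continuous_on_iff using lip by (metis dist_real_def order_le_less_trans dist_commute)
  then have \<phi>m [measurable]: "\<phi> \<in> borel_measurable borel" by (rule borel_measurable_continuous_onI)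
  have bd: "\<bar>\<phi> x\<bar> \<le> \<bar>\<phi> undefined\<bar> + 1/2" for x
    using lip[of x undefined] dist_circle_le_half[of x undefined] by linarith
  have "((\<integral>x. \<phi> x \<partial>\<mu>) - (\<integral>x. \<phi> x \<partial>\<nu>))\<^sup>2 \<le> (\<integral>p. (dist (fst p) (snd p))\<^sup>2 \<partial>\<pi>)"
    if \<pi>: "\<pi> \<in> couplings \<mu> \<nu>" for \<pi>
  proof -
    have s [measurable_cong]: "sets \<pi> = sets borel" and d: "distr \<pi> borel fst = \<mu>" "distr \<pi> borel snd = \<nu>"
      using \<pi> by (auto simp: couplings_def)
    have fm: "fst \<in> \<pi> \<rightarrow>\<^sub>M borel" "snd \<in> \<pi> \<rightarrow>\<^sub>M borel"
      unfolding measurable_cong_sets[OF s refl]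
      by (intro borel_measurable_continuous_onI continuous_intros)+
    note [measurable] = fm
    have "prob_space \<pi>"
      using P(1) d(1) fm(1) by (intro prob_space_distrD[OF fm(1)]) (simp add: P2_def)
    then interpret prob_space \<pi> .
    let ?X = "\<lambda>p. \<phi> (fst p) - \<phi> (snd p)"
    have [measurable]: "?X \<in> borel_measurable \<pi>" by measurable
    have i: "integrable \<pi> (\<lambda>p. \<phi> (fst p))" "integrable \<pi> (\<lambda>p. \<phi> (snd p))"
      by (auto intro!: integrable_const_bound[where B = "\<bar>\<phi> undefined\<bar> + 1/2"] bd)
    have sq: "(?X p)\<^sup>2 \<le> (dist (fst p) (snd p))\<^sup>2" for p
      using lip[of "fst p" "snd p"] by (simp add: abs_le_square_iff[symmetric])
    have d1: "(dist (fst p) (snd p))\<^sup>2 \<le> 1" for p :: "circle \<times> circle"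
      using dist_circle_le_half[of "fst p" "snd p"] by (auto intro!: power_le_one)
    have dm: "(\<lambda>p. (dist (fst p) (snd p))\<^sup>2) \<in> borel_measurable \<pi>"
      unfolding measurable_cong_sets[OF s refl] by measurable
    have di: "integrable \<pi> (\<lambda>p. (dist (fst p) (snd p))\<^sup>2)"
      by (rule integrable_const_bound[where B = 1, OF _ dm]) (use d1 in auto)
    have Xi: "integrable \<pi> (\<lambda>p. (?X p)\<^sup>2)"
      by (rule integrable_const_bound[where B = 1]) (use order_trans[OF sq d1] in auto)
    have "(\<integral>x. \<phi> x \<partial>\<mu>) - (\<integral>x. \<phi> x \<partial>\<nu>) = expectation ?X"
      unfolding d[symmetric] using i by (simp add: integral_distr)
    then have "((\<integral>x. \<phi> x \<partial>\<mu>) - (\<integral>x. \<phi> x \<partial>\<nu>))\<^sup>2 \<le> expectation (\<lambda>p. (?X p)\<^sup>2)"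
      using variance_eq[of ?X] variance_positive[of ?X] i Xi by simp
    also have "\<dots> \<le> (\<integral>p. (dist (fst p) (snd p))\<^sup>2 \<partial>\<pi>)"
      by (rule integral_mono[OF Xi di]) (rule sq)
    finally show ?thesis .
  qed
  then have "((\<integral>x. \<phi> x \<partial>\<mu>) - (\<integral>x. \<phi> x \<partial>\<nu>))\<^sup>2 \<le> (INF \<pi>\<in>couplings \<mu> \<nu>. \<integral>p. (dist (fst p) (snd p))\<^sup>2 \<partial>\<pi>)"
    by (intro cINF_greatest couplings_nonempty P)
  then show ?thesis
    unfolding W2_def by (metis real_sqrt_abs real_sqrt_le_iff)
qed

text \<open>On the interval of length r around x0 the tent is at least r / 2, which gives k * (r /
  2) * r.\<close>

lemma tent_integral_ge:
  fixes f :: "real \<Rightarrow> real"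
  assumes f: "continuous_on UNIV f" "\<And>x. f (x + 1) = f x"
    and r: "0 < r" "r \<le> 1/2" and k: "0 \<le> k" "\<And>x. \<bar>x - x0\<bar> \<le> r \<Longrightarrow> k \<le> f x"
  shows "k * r\<^sup>2 / 2 \<le> (\<integral>p. max 0 (r - dist p (to_circle x0)) * f (circle_rep p) \<partial>lebesgue_circle)"
proof -
  have fm [measurable]: "f \<in> borel_measurable borel" by (rule borel_measurable_continuous_onI[OF f(1)])
  let ?t = "\<lambda>x. max 0 (r - \<bar>x - x0\<bar>)"
  let ?I = "{x0 - 1/2..x0 - 1/2 + 1}"
  \<comment> \<open>In the window of half-width 1/2 around x0 the circle distance to x0 is the
    distance on the line.\<close>
  have t: "max 0 (r - dist (to_circle x) (to_circle x0)) = ?t x" if "x \<in> ?I" for x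
    using that by (subst dist_to_circle_eq) (auto simp: abs_if)
  have dm [measurable]: "(\<lambda>p::circle. dist p (to_circle x0)) \<in> borel_measurable borel"
    by (intro borel_measurable_continuous_onI continuous_intros)
  have "(\<integral>p. max 0 (r - dist p (to_circle x0)) * f (circle_rep p) \<partial>lebesgue_circle) =
     (LINT x:?I|lborel. max 0 (r - dist (to_circle x) (to_circle x0)) * f (circle_rep (to_circle x)))"
    by (rule integral_lebesgue_circle_window) measurable
  also have "\<dots> = (LINT x:?I|lborel. ?t x * f x)"
    by (rule set_lebesgue_integral_cong) (use t circle_rep_periodic[of f, OF f(2)] in auto)
  finally have eq: "(\<integral>p. max 0 (r - dist p (to_circle x0)) * f (circle_rep p) \<partial>lebesgue_circle) =
      (LINT x:?I|lborel. ?t x * f x)" .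
  have "k * r\<^sup>2 / 2 = (LINT x:{x0 - r/2..x0 + r/2}|lborel. k * r / 2)"
    using r by (simp add: set_lebesgue_integral_def power2_eq_square)
  also have "\<dots> = (LINT x:?I|lborel. indicator {x0 - r/2..x0 + r/2} x * (k * r / 2))"
    unfolding set_lebesgue_integral_def using r
    by (intro Bochner_Integration.integral_cong) (auto split: split_indicator)
  also have "\<dots> \<le> (LINT x:?I|lborel. ?t x * f x)"
  proof (rule set_integral_mono)
    show "set_integrable lborel ?I (\<lambda>x. indicator {x0 - r/2..x0 + r/2} x * (k * r / 2))"
      by (rule set_integrable_bounded[of _ _ _ "\<lambda>_. k * r / 2"])
        (use r k in \<open>auto intro!: set_integrable_continuous split: split_indicator\<close>)
    show "set_integrable lborel ?I (\<lambda>x. ?t x * f x)"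
      by (intro set_integrable_continuous continuous_intros continuous_on_subset[OF f(1)] subset_UNIV)
    fix x
    have "0 \<le> ?t x * f x"
      using k(1) k(2)[of x] by (cases "\<bar>x - x0\<bar> \<le> r") auto
    moreover have "k * r / 2 \<le> ?t x * f x" if "x \<in> {x0 - r/2..x0 + r/2}"
    proof -
      have "(r / 2) * k \<le> ?t x * f x"
        using that k r by (intro mult_mono) (auto simp: abs_if)
      then show ?thesis by (simp add: mult.commute)
    qed
    ultimately show "indicator {x0 - r/2..x0 + r/2} x * (k * r / 2) \<le> ?t x * f x"
      by (auto split: split_indicator)
  qed
  finally show ?thesis by (simp only: eq)
qed

text \<open>With r B at most (e / 4)^2, each density varies by at most e / 4 within distance r. A
  gap e at x would therefore persist as e / 2 on that neighbourhood, and testing with the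
  1-Lipschitz tent of height r would force the distance to be at least e / 4 * r^2.\<close>

lemma sup_close_if_W2_close:
  assumes U: "ac_deriv U (\<lambda>x. g (to_circle x))" "\<And>x. U (x + 1) = U x" "\<And>x. 0 \<le> U x"
      "g \<in> L2_circle" "(\<integral>p. (g p)\<^sup>2 \<partial>lebesgue_circle) \<le> B" "has_density \<mu> (\<lambda>p. U (circle_rep p))"
    and V: "ac_deriv V (\<lambda>x. h (to_circle x))" "\<And>x. V (x + 1) = V x" "\<And>x. 0 \<le> V x"
      "h \<in> L2_circle" "(\<integral>p. (h p)\<^sup>2 \<partial>lebesgue_circle) \<le> B" "has_density \<nu> (\<lambda>p. V (circle_rep p))"
    and P: "\<mu> \<in> P2" "\<nu> \<in> P2"
    and e: "0 < e" and B: "0 < B"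
    and W: "W2 \<mu> \<nu> < e / 4 * (min (1/2) (e\<^sup>2 / (16 * B)))\<^sup>2"
  shows "\<bar>U x - V x\<bar> < e"
proof -
  define r where "r = min (1/2) (e\<^sup>2 / (16 * B))"
  have r: "0 < r" "r \<le> 1/2" "16 * B * r \<le> e\<^sup>2"
  proof -
    show "0 < r" "r \<le> 1/2" using e B by (simp_all add: r_def)
    have "r \<le> e\<^sup>2 / (16 * B)" by (simp add: r_def)
    then show "16 * B * r \<le> e\<^sup>2" using B by (simp add: field_simps)
  qed
  note Uc = ac_deriv_continuous[OF U(1)] and Vc = ac_deriv_continuous[OF V(1)]
  have holder: "\<bar>F y - F x\<bar> \<le> e / 4"
    if F: "ac_deriv F (\<lambda>x. k (to_circle x))" "k \<in> L2_circle" "(\<integral>p. (k p)\<^sup>2 \<partial>lebesgue_circle) \<le> B"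
      and xy: "\<bar>y - x\<bar> \<le> r" for F k x y
  proof -
    have *: "(F b - F a)\<^sup>2 \<le> (e / 4)\<^sup>2" if "a \<le> b" "b - a \<le> r" for a b
    proof -
      have "(F b - F a)\<^sup>2 \<le> (b - a) * (\<integral>p. (k p)\<^sup>2 \<partial>lebesgue_circle)"
        using that r by (intro ac_deriv_holder[OF F(1,2)]) auto
      also have "\<dots> \<le> r * B" using that r F(3) by (intro mult_mono) (auto intro!: integral_nonneg_AE)
      also have "\<dots> \<le> (e / 4)\<^sup>2" using r(3) by (simp add: power_divide mult_ac)
      finally show ?thesis .
    qed
    have "(F y - F x)\<^sup>2 \<le> (e / 4)\<^sup>2"
      using *[of x y] *[of y x] xy by (cases "x \<le> y") (auto simp: power2_commute)
    then have "\<bar>F y - F x\<bar> \<le> \<bar>e / 4\<bar>" by (simp only: abs_le_square_iff)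
    then show ?thesis using e by simp
  qed
  have int: "(\<integral>p. \<phi> p \<partial>\<mu>') = (\<integral>p. \<phi> p * F (circle_rep p) \<partial>lebesgue_circle)"
    if \<mu>': "has_density \<mu>' (\<lambda>p. F (circle_rep p))" "\<And>x. 0 \<le> F x" "continuous_on UNIV F"
      and \<phi>: "\<phi> \<in> borel_measurable borel" for \<mu>' F and \<phi> :: "circle \<Rightarrow> real"
  proof -
    have [measurable]: "F \<in> borel_measurable borel" by (rule borel_measurable_continuous_onI[OF \<mu>'(3)])
    have "\<mu>' = density lebesgue_circle (\<lambda>p. ennreal (F (circle_rep p)))" using \<mu>'(1) by (simp add: has_density_def)
    then show ?thesis using \<phi> \<mu>'(2) by (simp add: integral_density mult.commute)
  qed
  let ?\<phi> = "\<lambda>p. max 0 (r - dist p (to_circle x))"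
  have lip: "\<bar>?\<phi> p - ?\<phi> q\<bar> \<le> dist p q" for p q :: circle
  proof -
    have "\<bar>dist p (to_circle x) - dist q (to_circle x)\<bar> \<le> dist p q"
      using dist_triangle[of p "to_circle x" q] dist_triangle[of q "to_circle x" p]
      by (simp add: dist_commute abs_le_iff)
    then show ?thesis by (auto simp: max_def)
  qed
  have \<phi>m: "?\<phi> \<in> borel_measurable borel"
    by (intro borel_measurable_continuous_onI continuous_intros)
  have per: "?\<phi> (to_circle (y + 1)) = ?\<phi> (to_circle y)" for y by simp
  have \<phi>c: "continuous_on UNIV (\<lambda>y. ?\<phi> (to_circle y))"
    by (intro continuous_intros continuous_to_circle)
  have i: "integrable lebesgue_circle (\<lambda>p. ?\<phi> p * F (circle_rep p))"
    if F: "continuous_on UNIV F" "\<And>x. F (x + 1) = F x" for F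
    using integrable_circle_mult[OF integrable_circle_continuous[OF \<phi>c per] F] by simp
  have "\<not> e \<le> U x - V x"
  proof
    assume "e \<le> U x - V x"
    then have "e / 2 \<le> U y - V y" if "\<bar>y - x\<bar> \<le> r" for y
      using holder[OF U(1,4,5) that] holder[OF V(1,4,5) that] by linarith
    then have "e / 2 * r\<^sup>2 / 2 \<le> (\<integral>p. ?\<phi> p * (U (circle_rep p) - V (circle_rep p)) \<partial>lebesgue_circle)"
      by (intro tent_integral_ge[of "\<lambda>y. U y - V y"] continuous_on_diff Uc Vc) (use U(2) V(2) r e in auto)
    also have "\<dots> = (\<integral>p. ?\<phi> p \<partial>\<mu>) - (\<integral>p. ?\<phi> p \<partial>\<nu>)"
      unfolding int[OF U(6,3) Uc \<phi>m] int[OF V(6,3) Vc \<phi>m] right_diff_distrib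
      by (rule Bochner_Integration.integral_diff[OF i[OF Uc U(2)] i[OF Vc V(2)]])
    also have "\<dots> \<le> W2 \<mu> \<nu>" using lipschitz_integral_diff_le_W2[OF P lip] by linarith
    finally show False using W unfolding r_def[symmetric] by simp
  qed
  moreover have "\<not> e \<le> V x - U x"
  proof
    assume "e \<le> V x - U x"
    then have "e / 2 \<le> V y - U y" if "\<bar>y - x\<bar> \<le> r" for y
      using holder[OF U(1,4,5) that] holder[OF V(1,4,5) that] by linarith
    then have "e / 2 * r\<^sup>2 / 2 \<le> (\<integral>p. ?\<phi> p * (V (circle_rep p) - U (circle_rep p)) \<partial>lebesgue_circle)"
      by (intro tent_integral_ge[of "\<lambda>y. V y - U y"] continuous_on_diff Uc Vc) (use U(2) V(2) r e in auto)
    also have "\<dots> = (\<integral>p. ?\<phi> p \<partial>\<nu>) - (\<integral>p. ?\<phi> p \<partial>\<mu>)"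
      unfolding int[OF U(6,3) Uc \<phi>m] int[OF V(6,3) Vc \<phi>m] right_diff_distrib
      by (rule Bochner_Integration.integral_diff[OF i[OF Vc V(2)] i[OF Uc U(2)]])
    also have "\<dots> \<le> W2 \<mu> \<nu>" using lipschitz_integral_diff_le_W2[OF P lip] by linarith
    finally show False using W unfolding r_def[symmetric] by simp
  qed
  ultimately show ?thesis by linarith
qed

section \<open>Optimal transport\<close>

lemma continuous_circle_bounded:
  fixes f :: "circle \<Rightarrow> real"
  assumes "continuous_on UNIV f"
  shows "\<exists>B. \<forall>p. \<bar>f p\<bar> \<le> B"
  using compact_imp_bounded[OF compact_continuous_image[OF assms compact_circle]]
  by (auto simp: bounded_iff)

text \<open>Since \<open>S\<close> has mean displacement zero, \<open>2 (x - S x)\<close> has a periodic primitive \<open>\<Phi>\<close>.  For fixed \<open>y\<close>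
  the function \<open>(x - y)\<^sup>2 - \<Phi> x\<close> has derivative \<open>2 (S x - y)\<close>, so its strict minimum is at the preimage
  of \<open>y\<close>; this makes \<open>\<Phi>\<close> a Kantorovich potential whose contact set is the graph of \<open>S\<close>.\<close>

lemma transport_potentials:
  fixes S R :: "real \<Rightarrow> real"
  assumes S: "continuous_on UNIV S" "strict_mono S" "\<And>x. S (x + 1) = S x + 1"
    and R: "continuous_on UNIV R" "\<And>x. R (S x) = x" "\<And>y. S (R y) = y"
    and mean: "(LINT x:{0..1}|lborel. x - S x) = 0"
  obtains \<phi> \<psi> :: "circle \<Rightarrow> real" where "continuous_on UNIV \<phi>" "continuous_on UNIV \<psi>"
    "\<And>p q. \<phi> p + \<psi> q \<le> (dist p q)\<^sup>2"
    "\<And>p q. \<phi> p + \<psi> q = (dist p q)\<^sup>2 \<Longrightarrow> q = to_circle (S (circle_rep p))"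
    "\<And>x. \<phi> (to_circle x) + \<psi> (to_circle (S x)) = (S x - x)\<^sup>2"
proof -
  have Rper: "R (y + 1) = R y + 1" for y
    using R(2)[of "R y + 1"] by (simp add: S(3) R(3))
  have dc: "continuous_on UNIV (\<lambda>x. x - S x)" by (intro continuous_on_diff continuous_on_id S(1))
  obtain \<Phi>0 where \<Phi>0: "\<And>x. (\<Phi>0 has_real_derivative x - S x) (at x)"
    using continuous_antiderivative[OF dc] by blast
  have ac: "ac_deriv \<Phi>0 (\<lambda>x. x - S x)" by (rule ac_deriv_C1[OF \<Phi>0 dc])
  have dper: "(x + 1) - S (x + 1) = x - S x" for x by (simp add: S(3))
  have dm: "(\<lambda>p. circle_rep p - S (circle_rep p)) \<in> borel_measurable borel"
  proof -
    have [measurable]: "S \<in> borel_measurable borel" by (rule borel_measurable_continuous_onI[OF S(1)])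
    show ?thesis by measurable
  qed
  have "(LINT t:{x..x+1}|lborel. t - S t) = 0" for x
    using integral_lebesgue_circle_window[OF dm, of x] integral_lebesgue_circle_window[OF dm, of 0] mean
    unfolding circle_rep_periodic[of "\<lambda>x. x - S x", OF dper] by simp
  then have \<Phi>0per: "\<Phi>0 (x + 1) = \<Phi>0 x" for x
    using ac_derivD(3)[OF ac, of x "x + 1"] by simp
  define \<Phi> where "\<Phi> x = 2 * \<Phi>0 x" for x
  \<comment> \<open>The minimum over x of (x - y)^2 - \<Phi> x, evaluated at its minimizer R
    y.\<close>
  define \<Psi> where "\<Psi> y = (y - R y)\<^sup>2 - \<Phi> (R y)" for y
  have \<Phi>per: "\<Phi> (x + 1) = \<Phi> x" for x by (simp add: \<Phi>_def \<Phi>0per)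
  have \<Psi>per: "\<Psi> (y + 1) = \<Psi> y" for y by (simp add: \<Psi>_def Rper \<Phi>per)
  have \<Phi>c: "continuous_on UNIV \<Phi>"
    unfolding \<Phi>_def by (intro continuous_on_mult continuous_on_const ac_deriv_continuous[OF ac])
  have \<Psi>c: "continuous_on UNIV \<Psi>"
    unfolding \<Psi>_def
    by (intro continuous_on_diff continuous_on_power continuous_on_id R(1) continuous_on_compose2[OF \<Phi>c R(1)]) auto
  have strict: "\<Phi> x + \<Psi> y < (x - y)\<^sup>2" if "x \<noteq> R y" for x y
  proof -
    define h where "h x = (x - y)\<^sup>2 - \<Phi> x" for x
    have h': "(h has_real_derivative 2 * (S x - y)) (at x)" for x
      unfolding h_def \<Phi>_def by (auto intro!: derivative_eq_intros \<Phi>0)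
    have hc: "continuous_on T h" for T
      unfolding h_def by (intro continuous_on_diff continuous_on_power continuous_on_id continuous_on_const continuous_on_subset[OF \<Phi>c]) auto
    have "h (R y) < h x"
    proof (cases "R y < x")
      case True
      show ?thesis
      proof (rule DERIV_pos_imp_increasing_open[OF True _ hc])
        fix t assume "R y < t" "t < x"
        then have "y < S t" using S(2) R(3)[of y] by (metis strict_monoD)
        then show "\<exists>d. (h has_real_derivative d) (at t) \<and> 0 < d" using h'[of t] by (intro exI[of _ "2 * (S t - y)"]) simp
      qed
    next
      case False
      then have lt: "x < R y" using that by simp
      show ?thesis
      proof (rule DERIV_neg_imp_decreasing_open[OF lt _ hc])
        fix t assume "x < t" "t < R y"
        then have "S t < y" using S(2) R(3)[of y] by (metis strict_monoD)
        then show "\<exists>d. (h has_real_derivative d) (at t) \<and> d < 0" using h'[of t] by (intro exI[of _ "2 * (S t - y)"]) simp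
      qed
    qed
    then show ?thesis by (simp add: h_def \<Psi>_def power2_commute)
  qed
  have eq: "\<Phi> (R y) + \<Psi> y = (R y - y)\<^sup>2" for y by (simp add: \<Psi>_def power2_commute)
  have key: "\<Phi> (circle_rep p) + \<Psi> (circle_rep q) \<le> (dist p q)\<^sup>2 \<and>
      (\<Phi> (circle_rep p) + \<Psi> (circle_rep q) = (dist p q)\<^sup>2 \<longrightarrow> q = to_circle (S (circle_rep p)))" for p q
  proof -
    \<comment> \<open>With the lift of q nearest to the representative of p, the inequality on the
      circle becomes the one on the line, including the equality case.\<close>
    obtain y where y: "q = to_circle y" "\<bar>circle_rep p - y\<bar> = dist (to_circle (circle_rep p)) q"
      using to_circle_near by blast
    have d: "(dist p q)\<^sup>2 = (circle_rep p - y)\<^sup>2" using y(2) by (metis power2_abs to_circle_rep)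
    have \<Psi>q: "\<Psi> (circle_rep q) = \<Psi> y" unfolding y(1) by (rule circle_rep_periodic[of \<Psi>, OF \<Psi>per])
    show ?thesis
    proof (cases "circle_rep p = R y")
      case True
      then show ?thesis using eq[of y] R(3)[of y] y(1) unfolding d \<Psi>q by simp
    next
      case False
      then show ?thesis using strict[OF False] by (simp add: d \<Psi>q)
    qed
  qed
  show ?thesis
  proof (rule that[of "\<lambda>p. \<Phi> (circle_rep p)" "\<lambda>q. \<Psi> (circle_rep q)"])
    show "continuous_on UNIV (\<lambda>p. \<Phi> (circle_rep p))" "continuous_on UNIV (\<lambda>q. \<Psi> (circle_rep q))"
      by (rule continuous_on_circle,
          simp add: circle_rep_periodic[of \<Phi>, OF \<Phi>per] circle_rep_periodic[of \<Psi>, OF \<Psi>per] \<Phi>c \<Psi>c)+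
    show "\<Phi> (circle_rep p) + \<Psi> (circle_rep q) \<le> (dist p q)\<^sup>2" for p q using key by blast
    show "q = to_circle (S (circle_rep p))" if "\<Phi> (circle_rep p) + \<Psi> (circle_rep q) = (dist p q)\<^sup>2" for p q
      using key that by blast
    show "\<Phi> (circle_rep (to_circle x)) + \<Psi> (circle_rep (to_circle (S x))) = (S x - x)\<^sup>2" for x
      unfolding circle_rep_periodic[of \<Phi>, OF \<Phi>per] circle_rep_periodic[of \<Psi>, OF \<Psi>per]
      using eq[of "S x"] by (simp add: R(2) power2_commute)
  qed
qed

section \<open>Identification of optimal maps and geodesics\<close>

lemma AE_circle_lawD:
  assumes [measurable]: "X \<in> borel_measurable borel" and "AE p in circle_law X. Q p"
  shows "AE z in restrict_space lborel {0..<1}. Q (to_circle (X z))"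
  by (rule AE_distrD[OF _ assms(2)[unfolded circle_law_def]]) (auto intro!: measurable_restrict_space1)

text \<open>The joint law of both maps at a common parameter z is a coupling, and projecting to the
  circle does not increase distances.\<close>

lemma W2_circle_law_le:
  assumes X: "continuous_on UNIV X" and Y: "continuous_on UNIV Y"
  shows "(W2 (circle_law X) (circle_law Y))\<^sup>2 \<le> (LINT z:{0..1}|lborel. (Y z - X z)\<^sup>2)"
proof -
  have [measurable]: "X \<in> borel_measurable borel" "Y \<in> borel_measurable borel"
    using X Y by (auto intro: borel_measurable_continuous_onI)
  let ?C = "couplings (circle_law X) (circle_law Y)"
  let ?c = "\<lambda>\<pi>. \<integral>p. (dist (fst p) (snd p))\<^sup>2 \<partial>\<pi>"
  let ?L = "restrict_space lborel {0..<1::real}"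
  define \<pi> where "\<pi> = distr ?L borel (\<lambda>z. (to_circle (X z), to_circle (Y z)))"
  have m: "(\<lambda>z. (to_circle (X z), to_circle (Y z))) \<in> ?L \<rightarrow>\<^sub>M borel"
  proof (rule measurable_restrict_space1)
    have "(\<lambda>z. (to_circle (X z), to_circle (Y z))) \<in> borel_measurable borel" by (intro borel_measurable_Pair) measurable
    then show "(\<lambda>z. (to_circle (X z), to_circle (Y z))) \<in> lborel \<rightarrow>\<^sub>M borel" by simp
  qed
  have fs: "fst \<in> (borel :: (circle \<times> circle) measure) \<rightarrow>\<^sub>M (borel :: circle measure)"
    "snd \<in> (borel :: (circle \<times> circle) measure) \<rightarrow>\<^sub>M (borel :: circle measure)"
    by (intro borel_measurable_continuous_onI continuous_intros)+
  have \<pi>: "\<pi> \<in> ?C"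
    by (simp add: couplings_def \<pi>_def circle_law_def distr_distr[OF fs(1) m] distr_distr[OF fs(2) m] o_def)
  have nn: "0 \<le> ?c \<pi>" for \<pi> by (rule integral_nonneg_AE) simp
  \<comment> \<open>Nonnegativity of the infimum is what lets the square undo the root in
    \<open>W2\<close>.\<close>
  have "0 \<le> (INF \<pi>\<in>?C. ?c \<pi>)" using \<pi> nn by (intro cINF_greatest) auto
  then have "(W2 (circle_law X) (circle_law Y))\<^sup>2 = (INF \<pi>\<in>?C. ?c \<pi>)" by (simp add: W2_def)
  also have "\<dots> \<le> ?c \<pi>" by (rule cINF_lower[OF _ \<pi>]) (auto intro!: bdd_belowI2[of _ 0] nn)
  also have "\<dots> = (\<integral>z. (dist (to_circle (X z)) (to_circle (Y z)))\<^sup>2 \<partial>?L)"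
    unfolding \<pi>_def by (subst integral_distr[OF m]) auto
  also have "\<dots> = (LINT z:{0..<1}|lborel. (dist (to_circle (X z)) (to_circle (Y z)))\<^sup>2)"
    unfolding set_lebesgue_integral_def by (subst integral_restrict_space) auto
  also have "\<dots> = (LINT z:{0..1}|lborel. (dist (to_circle (X z)) (to_circle (Y z)))\<^sup>2)"
    by (rule set_integral_discrete_difference[of "{1}"]) auto
  also have "\<dots> \<le> (LINT z:{0..1}|lborel. (Y z - X z)\<^sup>2)"
  proof (rule set_integral_mono)
    show "set_integrable lborel {0..1} (\<lambda>z. (dist (to_circle (X z)) (to_circle (Y z)))\<^sup>2)"
      by (intro set_integrable_continuous continuous_on_power continuous_on_dist
          continuous_on_compose2[OF continuous_to_circle] continuous_on_subset[OF X] continuous_on_subset[OF Y]) auto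
    show "set_integrable lborel {0..1} (\<lambda>z. (Y z - X z)\<^sup>2)"
      by (intro set_integrable_continuous continuous_on_power continuous_on_diff
          continuous_on_subset[OF X] continuous_on_subset[OF Y]) auto
    fix z
    have "dist (to_circle (X z)) (to_circle (Y z)) \<le> \<bar>Y z - X z\<bar>"
      using dist_to_circle_le[of "X z" "Y z"] by (simp add: abs_minus_commute)
    then show "(dist (to_circle (X z)) (to_circle (Y z)))\<^sup>2 \<le> (Y z - X z)\<^sup>2"
      by (metis power2_abs power_mono zero_le_dist)
  qed
  finally show ?thesis .
qed

text \<open>A duality squeeze. The potentials give D as a lower bound for the cost of T, that cost
  is W2^2 by optimality, and the common-parameter coupling gives W2^2 at most D. So the nonnegative
  slack ?k has integral zero, and T runs almost everywhere in the contact set, the graph of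
  S.\<close>

lemma optimal_map_circle_law:
  fixes X Y S R :: "real \<Rightarrow> real"
  assumes X: "continuous_on UNIV X" and Y: "\<And>z. Y z = S (X z)"
    and S: "continuous_on UNIV S" "strict_mono S" "\<And>x. S (x + 1) = S x + 1"
    and R: "continuous_on UNIV R" "\<And>x. R (S x) = x" "\<And>y. S (R y) = y"
    and mean: "(LINT x:{0..1}|lborel. x - S x) = 0"
    and T: "optimal_map (circle_law X) (circle_law Y) T"
  shows "(W2 (circle_law X) (circle_law Y))\<^sup>2 = (LINT z:{0..1}|lborel. (Y z - X z)\<^sup>2)"
    and "AE z in restrict_space lborel {0..<1}. T (to_circle (X z)) = to_circle (Y z)"
proof -
  obtain \<phi> \<psi> where c: "continuous_on UNIV \<phi>" "continuous_on UNIV \<psi>"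
    and le: "\<And>p q. \<phi> p + \<psi> q \<le> (dist p q)\<^sup>2"
    and eq: "\<And>p q. \<phi> p + \<psi> q = (dist p q)\<^sup>2 \<Longrightarrow> q = to_circle (S (circle_rep p))"
    and val: "\<And>x. \<phi> (to_circle x) + \<psi> (to_circle (S x)) = (S x - x)\<^sup>2"
    using transport_potentials[OF S R mean] by blast
  have Yc: "continuous_on UNIV Y"
    unfolding Y by (rule continuous_on_compose2[OF S(1) X]) auto
  have [measurable]: "X \<in> borel_measurable borel" "Y \<in> borel_measurable borel"
    "\<phi> \<in> borel_measurable borel" "\<psi> \<in> borel_measurable borel"
    using X Yc c by (auto intro: borel_measurable_continuous_onI)
  let ?\<mu> = "circle_law X" and ?\<nu> = "circle_law Y"
  define D where "D = (LINT z:{0..1}|lborel. (Y z - X z)\<^sup>2)"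
  have Tm [measurable]: "T \<in> borel_measurable borel" and Td: "distr ?\<mu> borel T = ?\<nu>"
    and Tc: "(\<integral>x. (dist x (T x))\<^sup>2 \<partial>?\<mu>) = (W2 ?\<mu> ?\<nu>)\<^sup>2"
    using T by (auto simp: optimal_map_def)
  interpret prob_space ?\<mu> by (rule prob_space_circle_law) simp
  have "(\<integral>p. \<phi> p \<partial>?\<mu>) + (\<integral>q. \<psi> q \<partial>?\<nu>) =
      (LINT z:{0..1}|lborel. \<phi> (to_circle (X z))) + (LINT z:{0..1}|lborel. \<psi> (to_circle (Y z)))"
    by (simp add: integral_circle_law)
  also have "\<dots> = (LINT z:{0..1}|lborel. \<phi> (to_circle (X z)) + \<psi> (to_circle (Y z)))"
  proof (rule set_integral_add(2)[symmetric])
    have "continuous_on UNIV (\<lambda>z. \<phi> (to_circle (X z)))" "continuous_on UNIV (\<lambda>z. \<psi> (to_circle (Y z)))"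
      by (rule continuous_on_compose2[OF c(1)] continuous_on_compose2[OF c(2)],
          rule continuous_on_compose2[OF continuous_to_circle], (rule X Yc), auto)+
    then show "set_integrable lborel {0..1} (\<lambda>z. \<phi> (to_circle (X z)))" "set_integrable lborel {0..1} (\<lambda>z. \<psi> (to_circle (Y z)))"
      by (auto intro!: set_integrable_continuous intro: continuous_on_subset)
  qed
  also have "\<dots> = D" by (simp add: D_def Y val)
  finally have dual: "(\<integral>p. \<phi> p \<partial>?\<mu>) + (\<integral>q. \<psi> q \<partial>?\<nu>) = D" .
  obtain B1 B2 where B: "\<And>p. \<bar>\<phi> p\<bar> \<le> B1" "\<And>p. \<bar>\<psi> p\<bar> \<le> B2"
    using continuous_circle_bounded[OF c(1)] continuous_circle_bounded[OF c(2)] by blast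
  have dm [measurable]: "(\<lambda>p. dist p (T p)) \<in> borel_measurable borel"
    by (rule borel_measurable_dist) auto
  have i: "integrable ?\<mu> \<phi>" "integrable ?\<mu> (\<lambda>p. \<psi> (T p))" "integrable ?\<mu> (\<lambda>p. (dist p (T p))\<^sup>2)"
  proof -
    show "integrable ?\<mu> \<phi>" by (rule integrable_const_bound[where B = B1]) (use B in auto)
    show "integrable ?\<mu> (\<lambda>p. \<psi> (T p))" by (rule integrable_const_bound[where B = B2]) (use B in auto)
    have "dist p (T p) \<le> 1" for p using dist_circle_le_half[of p "T p"] by linarith
    then show "integrable ?\<mu> (\<lambda>p. (dist p (T p))\<^sup>2)"
      by (intro integrable_const_bound[where B = 1]) (auto intro!: power_le_one AE_I2)
  qed
  let ?k = "\<lambda>p. (dist p (T p))\<^sup>2 - (\<phi> p + \<psi> (T p))"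
  have ki: "integrable ?\<mu> ?k" using i by simp
  have k0: "AE p in ?\<mu>. 0 \<le> ?k p" using le by (simp add: AE_I2)
  have "(\<integral>q. \<psi> q \<partial>?\<nu>) = (\<integral>p. \<psi> (T p) \<partial>?\<mu>)"
    unfolding Td[symmetric] by (rule integral_distr) auto
  then have kint: "expectation ?k = (W2 ?\<mu> ?\<nu>)\<^sup>2 - D"
    using i dual Tc by simp
  have W: "(W2 ?\<mu> ?\<nu>)\<^sup>2 \<le> D" unfolding D_def by (rule W2_circle_law_le[OF X Yc])
  moreover have "0 \<le> expectation ?k" by (rule integral_nonneg_AE[OF k0])
  ultimately have W2: "(W2 ?\<mu> ?\<nu>)\<^sup>2 = D" and k00: "expectation ?k = 0" using kint by simp_all
  show "(W2 ?\<mu> ?\<nu>)\<^sup>2 = (LINT z:{0..1}|lborel. (Y z - X z)\<^sup>2)" using W2 by (simp add: D_def)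
  have "AE p in ?\<mu>. ?k p = 0" using integral_nonneg_eq_0_iff_AE[OF ki k0] k00 by simp
  then have "AE p in ?\<mu>. T p = to_circle (S (circle_rep p))"
    by (rule eventually_mono) (rule eq, simp)
  from AE_circle_lawD[OF _ this]
  have "AE z in restrict_space lborel {0..<1}. T (to_circle (X z)) = to_circle (S (circle_rep (to_circle (X z))))" by simp
  moreover have "to_circle (S (circle_rep (to_circle x))) = to_circle (S x)" for x
    by (rule circle_rep_periodic[of "\<lambda>x. to_circle (S x)"]) (simp add: S(3))
  ultimately show "AE z in restrict_space lborel {0..<1}. T (to_circle (X z)) = to_circle (Y z)"
    by (simp add: Y)
qed

text \<open>Whatever T and v witness the geodesic, T agrees almost everywhere with the projection of
  S, and then the displacement v at X z can only be Y z - X z.\<close>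

lemma wasserstein_geodesic_circle_law:
  fixes X Y S R :: "real \<Rightarrow> real"
  assumes X: "continuous_on UNIV X" and Y: "\<And>z. Y z = S (X z)"
    and S: "continuous_on UNIV S" "strict_mono S" "\<And>x. S (x + 1) = S x + 1"
    and R: "continuous_on UNIV R" "\<And>x. R (S x) = x" "\<And>y. S (R y) = y"
    and mean: "(LINT x:{0..1}|lborel. x - S x) = 0"
    and small: "\<And>z. \<bar>Y z - X z\<bar> \<le> 1 / 4"
    and \<gamma>: "wasserstein_geodesic (circle_law X) (circle_law Y) \<gamma>"
  shows "(W2 (circle_law X) (circle_law Y))\<^sup>2 = (LINT z:{0..1}|lborel. (Y z - X z)\<^sup>2)"
    and "s \<in> {0..1} \<Longrightarrow> \<gamma> s = circle_law (\<lambda>z. (1 - s) * X z + s * Y z)"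
proof -
  obtain T v where T: "optimal_map (circle_law X) (circle_law Y) T" and v: "displacement T v"
    and g: "\<And>s. s \<in> {0..1} \<Longrightarrow> \<gamma> s = distr (circle_law X) borel (\<lambda>x. x + to_circle (s * v x))"
    using \<gamma> by (auto simp: wasserstein_geodesic_def)
  note o = optimal_map_circle_law[OF X Y S R mean T]
  show "(W2 (circle_law X) (circle_law Y))\<^sup>2 = (LINT z:{0..1}|lborel. (Y z - X z)\<^sup>2)" by (rule o(1))
  have Yc: "continuous_on UNIV Y"
    unfolding Y by (rule continuous_on_compose2[OF S(1) X]) auto
  have [measurable]: "X \<in> borel_measurable borel" "Y \<in> borel_measurable borel"
    using X Yc by (auto intro: borel_measurable_continuous_onI)
  have vm [measurable]: "v \<in> borel_measurable borel"
    and vT: "\<And>x. T x = x + to_circle (v x)" "\<And>x. \<bar>v x\<bar> = dist x (T x)"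
    using v by (auto simp: displacement_def)
  have v_eq: "v (to_circle (X z)) = Y z - X z" if "T (to_circle (X z)) = to_circle (Y z)" for z
  proof -
    have "to_circle (Y z) = to_circle (X z + v (to_circle (X z)))"
      using that vT(1)[of "to_circle (X z)"] by (simp add: to_circle_add)
    then obtain k :: int where k: "Y z - (X z + v (to_circle (X z))) = of_int k"
      by (auto simp: to_circle_eq_iff elim!: Ints_cases)
    have "\<bar>v (to_circle (X z))\<bar> \<le> 1 / 2" using vT(2) dist_circle_le_half by simp
    \<comment> \<open>The integer k separates two real displacements of sizes at most 1/2 and 1/4.
      With 1/2 in place of 1/4 antipodal points would leave the sign open.\<close>
    then have "\<bar>of_int k :: real\<bar> < 1" using k small[of z] by linarith
    then have "k = 0" by linarith
    then show ?thesis using k by simp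
  qed
  assume s: "s \<in> {0..1}"
  have [measurable]: "(\<lambda>x. x + to_circle (s * v x)) \<in> borel_measurable borel"
  proof -
    have "(\<lambda>x. x + to_circle (s * v x)) = (\<lambda>x. to_circle (circle_rep x + s * v x))"
      by (simp add: to_circle_add)
    then show ?thesis by simp
  qed
  have m: "(\<lambda>z. to_circle (X z)) \<in> restrict_space lborel {0..<1} \<rightarrow>\<^sub>M borel"
    by (rule measurable_restrict_space1) simp
  have "\<gamma> s = distr (restrict_space lborel {0..<1}) borel (\<lambda>z. to_circle (X z) + to_circle (s * v (to_circle (X z))))"
    unfolding g[OF s] circle_law_def by (subst distr_distr[OF _ m]) (auto simp: o_def)
  also have "\<dots> = circle_law (\<lambda>z. (1 - s) * X z + s * Y z)"
    unfolding circle_law_def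
  proof (rule distr_cong_AE)
    show "AE z in restrict_space lborel {0..<1}. to_circle (X z) + to_circle (s * v (to_circle (X z))) = to_circle ((1 - s) * X z + s * Y z)"
      using o(2)
    proof (rule eventually_mono)
      fix z assume "T (to_circle (X z)) = to_circle (Y z)"
      from v_eq[OF this] show "to_circle (X z) + to_circle (s * v (to_circle (X z))) = to_circle ((1 - s) * X z + s * Y z)"
        by (simp add: to_circle_add[symmetric]) (simp add: algebra_simps)
    qed
  qed (auto intro!: measurable_restrict_space1)
  finally show "\<gamma> s = circle_law (\<lambda>z. (1 - s) * X z + s * Y z)" .
qed

section \<open>Choosing the shift of the second quantile map\<close>

lemma quantile_map_shift:
  assumes q: "quantile_map X P A"
  shows "quantile_map (\<lambda>z. X (z + t)) (\<lambda>z. P (z + t)) (\<lambda>z. A (z + t))"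
proof -
  note D = quantile_mapD[OF q]
  have s: "((\<lambda>z. z + t) has_real_derivative (\<lambda>_. 1) z) (at z)" for z
    by (auto intro!: derivative_eq_intros)
  have "ac_deriv (primitive (\<lambda>z. (A z)\<^sup>2)) (\<lambda>z. (A z)\<^sup>2)"
    using D(7,10) by (intro ac_deriv_primitive) auto
  from ac_derivD(2)[OF ac_deriv_compose[OF this s]]
  have "set_integrable lborel {a..b} (\<lambda>z. (A (z + t))\<^sup>2)" for a b by simp
  moreover have "ac_deriv (\<lambda>z. P (z + t)) (\<lambda>z. A (z + t))"
    using ac_deriv_compose[OF D(3) s] by simp
  moreover have "((\<lambda>z. X (z + t)) has_real_derivative P (z + t)) (at z)" for z
    using D(1)[of "z + t"] by (subst DERIV_shift[symmetric])
  moreover have "X (z + 1 + t) = X (z + t) + 1" "A (z + 1 + t) = A (z + t)" for z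
    using D(4)[of "z + t"] D(6)[of "z + t"] by (simp_all add: ac_simps)
  ultimately show ?thesis using D(2) by (simp add: quantile_map_def)
qed

text \<open>Raising t by an integer k lowers the integral by k, so it takes both signs and the
  intermediate value theorem applies.\<close>

lemma mean_zero_shift:
  fixes Y F :: "real \<Rightarrow> real"
  assumes Y: "continuous_on UNIV Y" "\<And>z. Y (z + 1) = Y z + 1" and F: "continuous_on UNIV F"
  shows "\<exists>t. (LINT x:{0..1}|lborel. x - Y (F x + t)) = 0"
proof -
  define G where "G t = integral {0..1} (\<lambda>x. x - Y (F x + t))" for t
  have cont: "continuous_on {0..1} (\<lambda>x. x - Y (F x + t))" for t
    by (intro continuous_on_diff continuous_on_id continuous_on_compose2[OF Y(1)] continuous_on_add
        continuous_on_const continuous_on_subset[OF F]) auto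
  have GL: "(LINT x:{0..1}|lborel. x - Y (F x + t)) = G t" for t
    unfolding G_def by (rule set_borel_integral_eq_integral(2)[OF set_integrable_continuous[OF cont]])
  have "continuous_on UNIV (\<lambda>t. integral (cbox 0 1) (\<lambda>x. x - Y (F x + t)))"
  proof (rule integral_continuous_on_param)
    have "continuous_on (UNIV \<times> cbox 0 1) (\<lambda>p. snd p - Y (F (snd p) + fst p))"
      by (intro continuous_on_diff continuous_on_snd continuous_on_fst continuous_on_id continuous_on_add
          continuous_on_compose2[OF Y(1)] continuous_on_compose2[OF F]) auto
    then show "continuous_on (UNIV \<times> cbox 0 1) (\<lambda>(t, x). x - Y (F x + t))" by (simp add: split_def)
  qed
  then have Gc: "isCont G t" for t
    by (simp add: G_def[abs_def] continuous_on_eq_continuous_at)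
  have step: "G (t + of_int k) = G t - of_int k" for t k
  proof -
    have "x - Y (F x + (t + of_int k)) = (x - Y (F x + t)) - of_int k" for x
      using degree_one_add_int[of Y "F x + t" k, OF Y(2)] by (simp add: add.assoc)
    then have "G (t + of_int k) = integral {0..1} (\<lambda>x. (x - Y (F x + t)) - of_int k)" by (simp only: G_def)
    also have "\<dots> = G t - of_int k"
      unfolding G_def
      by (subst Henstock_Kurzweil_Integration.integral_diff)
        (auto intro!: integrable_continuous_real cont)
    finally show ?thesis .
  qed
  obtain n :: nat where n: "\<bar>G 0\<bar> \<le> of_nat n" using real_arch_simple by blast
  have "G (of_int (int n)) \<le> 0" "0 \<le> G (of_int (- int n))"
    using n step[of 0 "int n"] step[of 0 "- int n"] by simp_all
  then obtain t where "G t = 0"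
    using IVT2[of G "of_int (int n)" 0 "of_int (- int n)"] Gc by auto
  then show ?thesis using GL by auto
qed

text \<open>If the densities are uniformly close then so are the distribution functions, hence (the mean
  displacement being zero) the quantile maps.\<close>

lemma quantile_maps_close:
  fixes X Y F0 F1 U0 U1 :: "real \<Rightarrow> real"
  assumes F0: "\<And>z. F0 (X z) = z" "\<And>x. X (F0 x) = x" "F0 0 = 0" "\<And>x. F0 (x + 1) = F0 x + 1"
      "\<And>x. (F0 has_real_derivative U0 x) (at x)"
    and F1: "\<And>z. F1 (Y z) = z + t" "F1 0 = 0" "\<And>x. F1 (x + 1) = F1 x + 1"
      "\<And>x. (F1 has_real_derivative U1 x) (at x)"
    and Yc: "continuous_on UNIV Y"
    and l: "0 < l" "\<And>x. l \<le> U1 x" and e: "\<And>x. \<bar>U1 x - U0 x\<bar> \<le> e"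
    and mean: "(LINT x:{0..1}|lborel. x - Y (F0 x)) = 0"
  shows "l * \<bar>Y z - X z\<bar> \<le> 2 * e"
proof -
  have F0c: "continuous_on S F0" for S using F0(5) by (meson DERIV_isCont continuous_at_imp_continuous_on)
  \<comment> \<open>The difference of the distribution functions vanishes at 0 and is periodic, so
    the slope bound e on [0, 1] bounds it everywhere.\<close>
  define E where "E x = F1 x - F0 x" for x
  have Ed: "(E has_real_derivative U1 x - U0 x) (at x)" for x
    unfolding E_def by (rule DERIV_diff[OF F1(4) F0(5)])
  have Eper: "E (x + 1) = E x" for x by (simp add: E_def F0 F1)
  have Ebd: "\<bar>E x\<bar> \<le> e" for x
  proof -
    define y where "y = x + of_int (- \<lfloor>x\<rfloor>)"
    have y: "0 \<le> y" "y \<le> 1" unfolding y_def by (simp_all, linarith+)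
    obtain c where c: "E y - E 0 = (U1 c - U0 c) * (y - 0)"
      using mvt_closed_segment[of 0 y E "\<lambda>x. U1 x - U0 x"] Ed by blast
    have "\<bar>E y\<bar> = \<bar>U1 c - U0 c\<bar> * y" using c y by (simp add: E_def F0 F1 abs_mult)
    also have "\<dots> \<le> e * 1" using y e[of c] by (intro mult_mono) auto
    finally show ?thesis unfolding y_def using periodic_add_int[of E x "- \<lfloor>x\<rfloor>", OF Eper] by simp
  qed
  have Sc: "continuous_on T (\<lambda>x. x - Y (F0 x))" for T
    by (intro continuous_on_diff continuous_on_id continuous_on_compose2[OF Yc F0c]) auto
  let ?d = "\<lambda>x. x - Y (F0 x)"
  have neg: "(LINT x:{0..1}|lborel. - ?d x) = - (LINT x:{0..1}|lborel. ?d x)"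
    by (simp only: set_lebesgue_integral_def scaleR_minus_right Bochner_Integration.integral_minus)
  \<comment> \<open>A continuous function of mean zero takes values of both signs, so the transport
    map has a fixed point x0.\<close>
  obtain a where a: "a \<in> {0..1}" "?d a \<le> 0" using ex_le_unit_mean[OF Sc] mean by auto
  obtain b where b: "b \<in> {0..1}" "0 \<le> ?d b"
    using ex_le_unit_mean[OF continuous_on_minus[OF Sc]] unfolding neg mean by force
  have "connected (?d ` {0..1})" by (intro connected_continuous_image Sc) simp
  then have "{?d a..?d b} \<subseteq> ?d ` {0..1}" using a b by (intro connected_contains_Icc) auto
  then have "0 \<in> ?d ` {0..1}" using a(2) b(2) by auto
  then obtain x0 where "?d x0 = 0" by auto
  then have x0: "Y (F0 x0) = x0" by simp
  have lip: "l * \<bar>b - a\<bar> \<le> \<bar>F1 b - F1 a\<bar>" for a b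
  proof -
    obtain c where c: "F1 b - F1 a = U1 c * (b - a)"
      using mvt_closed_segment[of a b F1 U1] F1(4) by blast
    have "l * \<bar>b - a\<bar> \<le> U1 c * \<bar>b - a\<bar>" using l(2)[of c] by (intro mult_right_mono) auto
    also have "\<dots> = \<bar>F1 b - F1 a\<bar>" using l(1) l(2)[of c] c by (simp add: abs_mult)
    finally show ?thesis .
  qed
  have tt: "F1 (Y z) - F1 (X z) = t - E (X z)" for z by (simp add: E_def F0 F1)
  \<comment> \<open>At the fixed point the two quantile maps agree, which pins down the shift t and
    bounds it by e; E (X z) contributes the other e.\<close>
  have "t = E x0" using tt[of "F0 x0"] x0 by (simp add: F0(2))
  then have "\<bar>F1 (Y z) - F1 (X z)\<bar> \<le> 2 * e" using tt[of z] Ebd[of x0] Ebd[of "X z"] by linarith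
  then show ?thesis using lip[of "Y z" "X z"] by linarith
qed

section \<open>Convexity of the energy\<close>

lemma square_convex_comb_le:
  fixes a b s :: real
  assumes "s \<in> {0..1}"
  shows "((1 - s) * a + s * b)\<^sup>2 \<le> a\<^sup>2 + b\<^sup>2"
proof -
  have "a\<^sup>2 + b\<^sup>2 - ((1 - s) * a + s * b)\<^sup>2 = s * a\<^sup>2 + (1 - s) * b\<^sup>2 + s * (1 - s) * (a - b)\<^sup>2"
    by (simp add: power2_eq_square algebra_simps)
  moreover have "0 \<le> s * a\<^sup>2 + (1 - s) * b\<^sup>2 + s * (1 - s) * (a - b)\<^sup>2" using assms by simp
  ultimately show ?thesis by linarith
qed

text \<open>The second derivative of \<open>a\<^sup>2 q\<^sup>5\<close>, \<open>q = 1 / p\<close>, along affine \<open>a\<close> and \<open>p\<close> with slopes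
  \<open>\<alpha>\<close> and \<open>w\<close> is \<open>2 \<alpha>\<^sup>2 q\<^sup>5 - 20 a \<alpha> w q\<^sup>6 + 30 a\<^sup>2 w\<^sup>2 q\<^sup>7 = q\<^sup>5 (\<alpha> - 10 a w q)\<^sup>2 + \<alpha>\<^sup>2 q\<^sup>5 - 70 a\<^sup>2 w\<^sup>2 q\<^sup>7\<close>.\<close>

lemma energy_density_semiconvex:
  fixes a0 a1 p0 p1 k L s :: real
  assumes k: "0 < k" "k \<le> p0" "k \<le> p1" and L: "p0 \<le> L" "p1 \<le> L" and s: "s \<in> {0..1}"
  shows "((1 - s) * a0 + s * a1)\<^sup>2 / ((1 - s) * p0 + s * p1) ^ 5 \<le>
    (1 - s) * (a0\<^sup>2 / p0 ^ 5) + s * (a1\<^sup>2 / p1 ^ 5)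
    + s * (1 - s) / 2 * (70 / k ^ 7 * ((a0\<^sup>2 + a1\<^sup>2) * (p1 - p0)\<^sup>2) - (a1 - a0)\<^sup>2 / L ^ 5)"
proof -
  define \<alpha> w where "\<alpha> = a1 - a0" and "w = p1 - p0"
  define K where "K = \<alpha>\<^sup>2 / L ^ 5 - 70 / k ^ 7 * ((a0\<^sup>2 + a1\<^sup>2) * w\<^sup>2)"
  define a p q where "a t = (1 - t) * a0 + t * a1" and "p t = (1 - t) * p0 + t * p1" and "q t = 1 / p t" for t
  have Lpos: "0 < L" using k L by linarith
  have p: "k \<le> p t" "p t \<le> L" if "t \<in> {0..1}" for t
  proof -
    have "(1 - t) * k + t * k \<le> p t" unfolding p_def using that k by (intro add_mono mult_left_mono) auto
    then show "k \<le> p t" by (simp add: algebra_simps)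
    have "p t \<le> (1 - t) * L + t * L" unfolding p_def using that L by (intro add_mono mult_left_mono) auto
    then show "p t \<le> L" by (simp add: algebra_simps)
  qed
  have a': "(a has_real_derivative \<alpha>) (at t)" for t
    unfolding a_def \<alpha>_def by (auto intro!: derivative_eq_intros)
  have p': "(p has_real_derivative w) (at t)" for t
    unfolding p_def w_def by (auto intro!: derivative_eq_intros)
  have q': "(q has_real_derivative - w * (q t)\<^sup>2) (at t)" if "t \<in> {0..1}" for t
  proof -
    have "p t \<noteq> 0" using p[OF that] k by simp
    then show ?thesis
      unfolding q_def by (auto intro!: derivative_eq_intros p' simp: power2_eq_square field_simps)
  qed
  \<comment> \<open>K is the claimed lower bound for the second derivative, so subtracting K t^2 / 2
    should leave a convex function. Convexity of h between 0 and 1 then gives back the term K / 2 *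
    s (1 - s).\<close>
  define h where "h t = (a t)\<^sup>2 * q t ^ 5 - K / 2 * t\<^sup>2" for t
  define h' where "h' t = 2 * a t * \<alpha> * q t ^ 5 - 5 * (a t)\<^sup>2 * w * q t ^ 6 - K * t" for t
  define h'' where "h'' t = 2 * \<alpha>\<^sup>2 * q t ^ 5 - 20 * a t * \<alpha> * w * q t ^ 6 + 30 * (a t)\<^sup>2 * w\<^sup>2 * q t ^ 7 - K" for t
  have "convex_on {0..1} h"
  proof (rule f''_ge0_imp_convex)
    fix t :: real assume t: "t \<in> {0..1}"
    show "(h has_real_derivative h' t) (at t)"
      unfolding h_def h'_def by (auto intro!: derivative_eq_intros a' q'[OF t] simp: eval_nat_numeral algebra_simps)
    show "(h' has_real_derivative h'' t) (at t)"
      unfolding h'_def h''_def by (auto intro!: derivative_eq_intros a' q'[OF t] simp: eval_nat_numeral algebra_simps)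
    have q: "1 / L \<le> q t" "q t \<le> 1 / k" "0 \<le> q t"
      unfolding q_def using p[OF t] k by (auto intro!: divide_left_mono mult_pos_pos)
    have "h'' t = q t ^ 5 * (\<alpha> - 10 * a t * w * q t)\<^sup>2 + (\<alpha>\<^sup>2 * q t ^ 5 - \<alpha>\<^sup>2 * (1 / L) ^ 5)
       + 70 * (w\<^sup>2 * ((a0\<^sup>2 + a1\<^sup>2) * (1 / k) ^ 7 - (a t)\<^sup>2 * q t ^ 7))"
      unfolding h''_def K_def by (simp add: eval_nat_numeral power_divide algebra_simps)
    moreover have "0 \<le> q t ^ 5 * (\<alpha> - 10 * a t * w * q t)\<^sup>2" using q by simp
    moreover have "\<alpha>\<^sup>2 * (1 / L) ^ 5 \<le> \<alpha>\<^sup>2 * q t ^ 5" using q Lpos by (intro mult_left_mono power_mono) auto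
    moreover have "(a t)\<^sup>2 * q t ^ 7 \<le> (a0\<^sup>2 + a1\<^sup>2) * (1 / k) ^ 7"
      using q square_convex_comb_le[OF t, of a0 a1] unfolding a_def by (intro mult_mono power_mono) auto
    ultimately show "0 \<le> h'' t" by simp
  qed simp
  from convex_onD[OF this, of s 0 1] s
  have "h s \<le> (1 - s) * h 0 + s * h 1" by simp
  then have "(a s)\<^sup>2 * q s ^ 5 \<le> (1 - s) * ((a 0)\<^sup>2 * q 0 ^ 5) + s * ((a 1)\<^sup>2 * q 1 ^ 5) + s * (1 - s) / 2 * (- K)"
    unfolding h_def by (simp add: power2_eq_square algebra_simps) (simp add: field_simps)
  then show ?thesis
    by (simp add: K_def a_def p_def q_def \<alpha>_def w_def power_divide)
qed

lemma quantile_map_convex_comb: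
  assumes q: "quantile_map X P A" "quantile_map Y Q B" and s: "s \<in> {0..1}"
  shows "quantile_map (\<lambda>z. (1 - s) * X z + s * Y z) (\<lambda>z. (1 - s) * P z + s * Q z) (\<lambda>z. (1 - s) * A z + s * B z)"
proof -
  note D = quantile_mapD[OF q(1)] and E = quantile_mapD[OF q(2)]
  have "((\<lambda>z. (1 - s) * X z + s * Y z) has_real_derivative (1 - s) * P z + s * Q z) (at z)" for z
    by (rule DERIV_add[OF DERIV_cmult[OF D(1)] DERIV_cmult[OF E(1)]])
  moreover have "0 < (1 - s) * P z + s * Q z" for z
    using s D(2)[of z] E(2)[of z] by (cases "s = 0") (auto intro!: add_nonneg_pos)
  moreover have "ac_deriv (\<lambda>z. (1 - s) * P z + s * Q z) (\<lambda>z. (1 - s) * A z + s * B z)"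
    by (rule ac_deriv_add[OF ac_deriv_cmult[OF D(3)] ac_deriv_cmult[OF E(3)]])
  moreover have "set_integrable lborel {a..b} (\<lambda>z. ((1 - s) * A z + s * B z)\<^sup>2)" for a b
  proof (rule set_integrable_bounded)
    show "(\<lambda>z. ((1 - s) * A z + s * B z)\<^sup>2) \<in> borel_measurable borel" using D(10) E(10) by measurable
    show "set_integrable lborel {a..b} (\<lambda>z. (A z)\<^sup>2 + (B z)\<^sup>2)" by (rule set_integral_add(1)[OF D(7) E(7)])
    show "\<bar>((1 - s) * A z + s * B z)\<^sup>2\<bar> \<le> (A z)\<^sup>2 + (B z)\<^sup>2" for z
      using square_convex_comb_le[OF s] by simp
  qed
  ultimately show ?thesis
    unfolding quantile_map_def by (simp add: D(4,6) E(4,6) algebra_simps)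
qed

lemma set_integrable_divide_power:
  assumes q: "quantile_map X P A"
  shows "set_integrable lborel {a..b} (\<lambda>z. (A z)\<^sup>2 / P z ^ n)"
proof -
  note D = quantile_mapD[OF q]
  have "P z \<noteq> 0" for z using D(2)[of z] by simp
  then have "continuous_on {a..b} (\<lambda>z. 1 / P z ^ n)"
    by (intro continuous_on_divide continuous_on_const continuous_on_power D(9)) auto
  from set_integrable_continuous_mult[OF D(7) this] show ?thesis by simp
qed

text \<open>The pointwise estimate, integrated. The squared difference of first derivatives is
  replaced by its supremum M because it multiplies A^2 + B^2, which is merely integrable; this is
  why a sup norm of v' has to be controlled.\<close>

lemma energy_semiconvex:
  assumes q: "quantile_map X P A" "quantile_map Y Q B"
    and k: "0 < k" "\<And>z. k \<le> P z" "\<And>z. k \<le> Q z" and L: "\<And>z. P z \<le> L" "\<And>z. Q z \<le> L"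
    and M: "\<And>z. z \<in> {0..1} \<Longrightarrow> (Q z - P z)\<^sup>2 \<le> M" and s: "s \<in> {0..1}"
  shows "(LINT z:{0..1}|lborel. ((1 - s) * A z + s * B z)\<^sup>2 / ((1 - s) * P z + s * Q z) ^ 5) \<le>
    (1 - s) * (LINT z:{0..1}|lborel. (A z)\<^sup>2 / P z ^ 5) + s * (LINT z:{0..1}|lborel. (B z)\<^sup>2 / Q z ^ 5)
    + s * (1 - s) / 2 * (70 / k ^ 7 * M * (LINT z:{0..1}|lborel. (A z)\<^sup>2 + (B z)\<^sup>2)
        - (LINT z:{0..1}|lborel. (B z - A z)\<^sup>2) / L ^ 5)"
proof -
  note D = quantile_mapD[OF q(1)] and E = quantile_mapD[OF q(2)]
  note [measurable] = D(10) E(10)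
  have i0: "set_integrable lborel {0..1} (\<lambda>z. (A z)\<^sup>2 / P z ^ 5)"
    and i1: "set_integrable lborel {0..1} (\<lambda>z. (B z)\<^sup>2 / Q z ^ 5)"
    and i2: "set_integrable lborel {0..1} (\<lambda>z. ((1 - s) * A z + s * B z)\<^sup>2 / ((1 - s) * P z + s * Q z) ^ 5)"
    using set_integrable_divide_power q quantile_map_convex_comb[OF q s] by blast+
  have i3: "set_integrable lborel {0..1} (\<lambda>z. (A z)\<^sup>2 + (B z)\<^sup>2)" by (rule set_integral_add(1)[OF D(7) E(7)])
  have i4: "set_integrable lborel {0..1} (\<lambda>z. (B z - A z)\<^sup>2)"
  proof (rule set_integrable_bounded[OF _ set_integrable_mult_right[OF i3, of 2]])
    have "(B z - A z)\<^sup>2 + (B z + A z)\<^sup>2 = 2 * ((A z)\<^sup>2 + (B z)\<^sup>2)" for z by (simp add: power2_eq_square algebra_simps)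
    then show "\<bar>(B z - A z)\<^sup>2\<bar> \<le> 2 * ((A z)\<^sup>2 + (B z)\<^sup>2)" for z
      by (metis abs_of_nonneg le_add_same_cancel1 zero_le_power2)
  qed simp_all
  define c1 c2 where "c1 = s * (1 - s) / 2 * (70 / k ^ 7 * M)" and "c2 = s * (1 - s) / 2 / L ^ 5"
  note j = set_integrable_mult_right[OF i0, of "1 - s"] set_integrable_mult_right[OF i1, of s]
    set_integrable_mult_right[OF i3, of c1] set_integrable_mult_right[OF i4, of c2]
  have "(LINT z:{0..1}|lborel. ((1 - s) * A z + s * B z)\<^sup>2 / ((1 - s) * P z + s * Q z) ^ 5) \<le>
      (LINT z:{0..1}|lborel. ((1 - s) * ((A z)\<^sup>2 / P z ^ 5) + s * ((B z)\<^sup>2 / Q z ^ 5))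
        + (c1 * ((A z)\<^sup>2 + (B z)\<^sup>2) - c2 * (B z - A z)\<^sup>2))"
  proof (rule set_integral_mono[OF i2])
    show "set_integrable lborel {0..1} (\<lambda>z. ((1 - s) * ((A z)\<^sup>2 / P z ^ 5) + s * ((B z)\<^sup>2 / Q z ^ 5))
        + (c1 * ((A z)\<^sup>2 + (B z)\<^sup>2) - c2 * (B z - A z)\<^sup>2))"
      by (intro set_integral_add(1) set_integral_diff(1) j)
    fix z :: real assume z: "z \<in> {0..1}"
    have "s * (1 - s) / 2 * (70 / k ^ 7 * (((A z)\<^sup>2 + (B z)\<^sup>2) * (Q z - P z)\<^sup>2)) \<le>
        s * (1 - s) / 2 * (70 / k ^ 7 * (((A z)\<^sup>2 + (B z)\<^sup>2) * M))"
      using s k(1) M[OF z] by (intro mult_left_mono) auto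
    also have "\<dots> = c1 * ((A z)\<^sup>2 + (B z)\<^sup>2)" by (simp add: c1_def)
    finally have le: "s * (1 - s) / 2 * (70 / k ^ 7 * (((A z)\<^sup>2 + (B z)\<^sup>2) * (Q z - P z)\<^sup>2)) \<le> c1 * ((A z)\<^sup>2 + (B z)\<^sup>2)" .
    have "s * (1 - s) / 2 * (70 / k ^ 7 * (((A z)\<^sup>2 + (B z)\<^sup>2) * (Q z - P z)\<^sup>2) - (B z - A z)\<^sup>2 / L ^ 5) \<le>
        c1 * ((A z)\<^sup>2 + (B z)\<^sup>2) - c2 * (B z - A z)\<^sup>2"
    proof -
      have "s * (1 - s) / 2 * ((B z - A z)\<^sup>2 / L ^ 5) = c2 * (B z - A z)\<^sup>2" by (simp add: c2_def)
      then show ?thesis using le unfolding right_diff_distrib[of "s * (1 - s) / 2"] by linarith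
    qed
    moreover have "((1 - s) * A z + s * B z)\<^sup>2 / ((1 - s) * P z + s * Q z) ^ 5 \<le>
        (1 - s) * ((A z)\<^sup>2 / P z ^ 5) + s * ((B z)\<^sup>2 / Q z ^ 5)
        + s * (1 - s) / 2 * (70 / k ^ 7 * (((A z)\<^sup>2 + (B z)\<^sup>2) * (Q z - P z)\<^sup>2) - (B z - A z)\<^sup>2 / L ^ 5)"
      by (rule energy_density_semiconvex[OF k(1) k(2,3) L s])
    ultimately show "((1 - s) * A z + s * B z)\<^sup>2 / ((1 - s) * P z + s * Q z) ^ 5 \<le>
        ((1 - s) * ((A z)\<^sup>2 / P z ^ 5) + s * ((B z)\<^sup>2 / Q z ^ 5))
        + (c1 * ((A z)\<^sup>2 + (B z)\<^sup>2) - c2 * (B z - A z)\<^sup>2)"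
      by linarith
  qed
  also have "\<dots> = (1 - s) * (LINT z:{0..1}|lborel. (A z)\<^sup>2 / P z ^ 5) + s * (LINT z:{0..1}|lborel. (B z)\<^sup>2 / Q z ^ 5)
      + (c1 * (LINT z:{0..1}|lborel. (A z)\<^sup>2 + (B z)\<^sup>2) - c2 * (LINT z:{0..1}|lborel. (B z - A z)\<^sup>2))"
    unfolding set_integral_add(2)[OF set_integral_add(1)[OF j(1,2)] set_integral_diff(1)[OF j(3,4)]]
      set_integral_add(2)[OF j(1,2)] set_integral_diff(2)[OF j(3,4)] set_integral_mult_right ..
  also have "c1 * (LINT z:{0..1}|lborel. (A z)\<^sup>2 + (B z)\<^sup>2) - c2 * (LINT z:{0..1}|lborel. (B z - A z)\<^sup>2) =
      s * (1 - s) / 2 * (70 / k ^ 7 * M * (LINT z:{0..1}|lborel. (A z)\<^sup>2 + (B z)\<^sup>2)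
        - (LINT z:{0..1}|lborel. (B z - A z)\<^sup>2) / L ^ 5)"
    unfolding c1_def c2_def right_diff_distrib[of "s * (1 - s) / 2"] by simp
  finally show ?thesis .
qed

section \<open>Interpolation between v and its second derivative\<close>

lemma abs_mult_le_weighted_squares:
  fixes x y t :: real
  assumes "0 < t"
  shows "\<bar>2 * x * y\<bar> \<le> x\<^sup>2 / t + t * y\<^sup>2"
proof -
  have "0 \<le> (\<bar>x\<bar> - t * \<bar>y\<bar>)\<^sup>2 / t" using assms by simp
  also have "\<dots> = x\<^sup>2 / t + t * y\<^sup>2 - \<bar>2 * x * y\<bar>"
    using assms by (simp add: power2_eq_square field_simps abs_mult)
  finally show ?thesis by simp
qed

text \<open>With \<open>w = v'\<close> vanishing somewhere, \<open>w\<^sup>2\<close> is at most \<open>\<integral> \<bar>2 w \<alpha>\<bar>\<close>, and \<open>\<integral> w\<^sup>2 = - \<integral> v \<alpha>\<close> by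
  periodicity.\<close>

lemma periodic_interpolation:
  fixes v w \<alpha> :: "real \<Rightarrow> real"
  assumes v: "\<And>z. (v has_real_derivative w z) (at z)" "v 1 = v 0" and w: "ac_deriv w \<alpha>" "w 1 = w 0"
    and \<alpha>2: "set_integrable lborel {0..1} (\<lambda>z. (\<alpha> z)\<^sup>2)" and t: "0 < t" and z: "z \<in> {0..1}"
  shows "(w z)\<^sup>2 \<le> 2 * t * (LINT z:{0..1}|lborel. (\<alpha> z)\<^sup>2) + (LINT z:{0..1}|lborel. (v z)\<^sup>2) / (4 * t ^ 3)"
proof -
  define \<Lambda> V W where "\<Lambda> = (LINT z:{0..1}|lborel. (\<alpha> z)\<^sup>2)"
    and "V = (LINT z:{0..1}|lborel. (v z)\<^sup>2)" and "W = (LINT z:{0..1}|lborel. (w z)\<^sup>2)"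
  note wc = ac_deriv_continuous[OF w(1)]
  have vc: "continuous_on S v" for S using v(1) by (meson DERIV_isCont continuous_at_imp_continuous_on)
  have v2: "set_integrable lborel {0..1} (\<lambda>z. (v z)\<^sup>2)" and w2: "set_integrable lborel {0..1} (\<lambda>z. (w z)\<^sup>2)"
    by (intro set_integrable_continuous continuous_on_power vc wc)+
  \<comment> \<open>Rolle's theorem for the periodic v.\<close>
  obtain z0 where z0: "0 < z0" "z0 < 1" "w z0 = 0"
    using MVT2[of 0 1 v w] v by auto
  let ?g = "\<lambda>z. 2 * w z * \<alpha> z"
  note sq = ac_deriv_square[OF w(1)]
  have gi: "set_integrable lborel {a..b} (\<lambda>z. \<bar>?g z\<bar>)" for a b by (rule set_integrable_abs[OF ac_derivD(2)[OF sq]])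
  have mono: "\<bar>LINT z:{a..b}|lborel. ?g z\<bar> \<le> (LINT z:{0..1}|lborel. \<bar>?g z\<bar>)" if "0 \<le> a" "a \<le> b" "b \<le> 1" for a b
  proof -
    have nn: "0 \<le> (LINT z:{c..d}|lborel. \<bar>?g z\<bar>)" for c d
      unfolding set_lebesgue_integral_def by (rule integral_nonneg_AE) auto
    have "\<bar>LINT z:{a..b}|lborel. ?g z\<bar> \<le> (LINT z:{a..b}|lborel. \<bar>?g z\<bar>)"
      by (rule set_integral_abs_le[OF ac_derivD(2)[OF sq]])
    also have "\<dots> \<le> (LINT z:{0..1}|lborel. \<bar>?g z\<bar>)"
      using set_integral_combine[of 0 a 1, OF _ _ gi] set_integral_combine[of a b 1, OF _ _ gi] that
        nn[of 0 a] nn[of b 1] by simp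
    finally show ?thesis .
  qed
  have "(w z)\<^sup>2 \<le> (LINT z:{0..1}|lborel. \<bar>?g z\<bar>)"
  proof (cases "z0 \<le> z")
    case True
    then show ?thesis using mono[of z0 z] ac_derivD(3)[OF sq True] z0 z by simp
  next
    case False
    then show ?thesis using mono[of z z0] ac_derivD(3)[OF sq, of z z0] z0 z by simp
  qed
  also have "\<dots> \<le> (LINT z:{0..1}|lborel. (w z)\<^sup>2 / t + t * (\<alpha> z)\<^sup>2)"
    using abs_mult_le_weighted_squares[OF t]
    by (intro set_integral_mono gi set_integral_add(1) set_integrable_divide set_integrable_mult_right w2 \<alpha>2) auto
  also have "\<dots> = W / t + t * \<Lambda>"
    unfolding W_def \<Lambda>_def using set_integral_add(2)[OF set_integrable_divide[OF w2, of t] set_integrable_mult_right[OF \<alpha>2, of t]] t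
    by simp
  also have "W \<le> V / (4 * t\<^sup>2) + t\<^sup>2 * \<Lambda>"
  proof -
    have vac: "ac_deriv v w" by (rule ac_deriv_C1[OF v(1) wc])
    have va: "set_integrable lborel {0..1} (\<lambda>z. v z * \<alpha> z)"
      by (rule set_integrable_continuous_mult[OF ac_derivD(2)[OF w(1)] vc])
    have "0 = (LINT z:{0..1}|lborel. w z * w z + v z * \<alpha> z)"
      using ac_derivD(3)[OF ac_deriv_mult[OF vac w(1)], of 0 1] v(2) w(2) by simp
    also have "\<dots> = W + (LINT z:{0..1}|lborel. v z * \<alpha> z)"
      using set_integral_add(2)[OF w2 va] by (simp add: W_def power2_eq_square)
    finally have "W = - (LINT z:{0..1}|lborel. v z * \<alpha> z)" by simp
    also have "\<dots> \<le> (LINT z:{0..1}|lborel. \<bar>v z * \<alpha> z\<bar>)" using set_integral_abs_le[OF va] by linarith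
    \<comment> \<open>The weight 2 t^2 is chosen so that, after division by t, the coefficient of
      \<Lambda> is t, as in the other summand.\<close>
    also have "\<dots> \<le> (LINT z:{0..1}|lborel. (v z)\<^sup>2 / (4 * t\<^sup>2) + t\<^sup>2 * (\<alpha> z)\<^sup>2)"
    proof (intro set_integral_mono set_integrable_abs va set_integral_add(1) set_integrable_divide set_integrable_mult_right v2 \<alpha>2)
      fix z
      show "\<bar>v z * \<alpha> z\<bar> \<le> (v z)\<^sup>2 / (4 * t\<^sup>2) + t\<^sup>2 * (\<alpha> z)\<^sup>2"
        using abs_mult_le_weighted_squares[of "2 * t\<^sup>2" "v z" "\<alpha> z"] t by (simp add: abs_mult)
    qed
    also have "\<dots> = V / (4 * t\<^sup>2) + t\<^sup>2 * \<Lambda>"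
      unfolding V_def \<Lambda>_def using set_integral_add(2)[OF set_integrable_divide[OF v2, of "4 * t\<^sup>2"] set_integrable_mult_right[OF \<alpha>2, of "t\<^sup>2"]] t
      by simp
    finally show ?thesis .
  qed
  then have "W / t + t * \<Lambda> \<le> (V / (4 * t\<^sup>2) + t\<^sup>2 * \<Lambda>) / t + t * \<Lambda>"
    using t by (simp add: divide_right_mono)
  also have "\<dots> = 2 * t * \<Lambda> + V / (4 * t ^ 3)"
    using t by (simp add: field_simps power2_eq_square power3_eq_cube)
  finally show ?thesis unfolding \<Lambda>_def V_def .
qed

section \<open>Assembling the estimates along a geodesic\<close>

lemma strict_mono_if_DERIV_pos:
  fixes f f' :: "real \<Rightarrow> real"
  assumes "\<And>x. (f has_real_derivative f' x) (at x)" "\<And>x. 0 < f' x"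
  shows "strict_mono f"
proof (rule strict_monoI)
  fix x y :: real assume "x < y"
  then show "f x < f y" by (rule DERIV_pos_imp_increasing) (use assms in blast)
qed

lemma quantile_square_integral_le:
  assumes q: "quantile_map X P A" and L: "\<And>z. P z \<le> L"
  shows "(LINT z:{0..1}|lborel. (A z)\<^sup>2) \<le> L ^ 5 * (LINT z:{0..1}|lborel. (A z)\<^sup>2 / P z ^ 5)"
proof -
  note D = quantile_mapD[OF q]
  have "(LINT z:{0..1}|lborel. (A z)\<^sup>2) \<le> (LINT z:{0..1}|lborel. L ^ 5 * ((A z)\<^sup>2 / P z ^ 5))"
  proof (intro set_integral_mono D(7) set_integrable_mult_right set_integrable_divide_power[OF q])
    fix z
    have "(A z)\<^sup>2 = P z ^ 5 * ((A z)\<^sup>2 / P z ^ 5)" using D(2)[of z] by simp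
    also have "\<dots> \<le> L ^ 5 * ((A z)\<^sup>2 / P z ^ 5)"
      using L[of z] D(2)[of z] by (intro mult_right_mono power_mono) auto
    finally show "(A z)\<^sup>2 \<le> L ^ 5 * ((A z)\<^sup>2 / P z ^ 5)" .
  qed
  then show ?thesis unfolding set_integral_mult_right .
qed

text \<open>The densities lie between l and M = 1 + sqrt B, so P and Q lie between 1 / M and 1 / l.
  With N = 2 t \<Lambda> + V / (4 t^3) bounding (Q - P)^2, the error term is at most 70 M^7 N * 2 B
  / l^5 = K N. The choice of t means 2 t K = l^5, so the \<Lambda> part of K N is exactly the good
  term. The rest K V / (4 t^3) turns into \<lambda> = - K / (8 t^3), the extra factor 1/2 being that
  of the energy.\<close>

lemma geodesic_semiconvex:
  assumes U0: "ac_deriv U0 (\<lambda>x. g0 (to_circle x))" "\<And>x. U0 (x + 1) = U0 x" "\<And>x. l \<le> U0 x"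
      "g0 \<in> L2_circle" "(\<integral>p. (g0 p)\<^sup>2 \<partial>lebesgue_circle) \<le> B" "has_density \<nu>0 (\<lambda>p. U0 (circle_rep p))"
    and U1: "ac_deriv U1 (\<lambda>x. g1 (to_circle x))" "\<And>x. U1 (x + 1) = U1 x" "\<And>x. l \<le> U1 x"
      "g1 \<in> L2_circle" "(\<integral>p. (g1 p)\<^sup>2 \<partial>lebesgue_circle) \<le> B" "has_density \<nu>1 (\<lambda>p. U1 (circle_rep p))"
    and P2: "\<nu>0 \<in> P2" "\<nu>1 \<in> P2"
    and l: "0 < l" and B: "0 < B" and close: "\<And>x. \<bar>U1 x - U0 x\<bar> \<le> l / 8"
    and K: "K = 140 * (1 + sqrt B) ^ 7 * (1 / l) ^ 5 * B" and t: "t = 1 / (2 * K * (1 / l) ^ 5)"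
    and \<gamma>: "wasserstein_geodesic \<nu>0 \<nu>1 \<gamma>"
  shows "convex_along dirichlet_energy (- K / (8 * t ^ 3)) \<gamma>"
proof -
  define M where "M = 1 + sqrt B"
  have Mpos: "0 < M" using B by (simp add: M_def add_pos_nonneg)
  have Kpos: "0 < K" unfolding K M_def[symmetric] using Mpos l B by simp
  have tpos: "0 < t" unfolding t using Kpos l by simp
  note U0c = ac_deriv_continuous[OF U0(1)] and U1c = ac_deriv_continuous[OF U1(1)]
  have pos: "0 < U0 x" "0 < U1 x" for x using U0(3)[of x] U1(3)[of x] l by linarith+
  have pr: "prob_space \<nu>0" "prob_space \<nu>1" using P2 by (auto simp: P2_def)
  have mass0: "(LINT t:{x..x+1}|lborel. U0 t) = 1" and mass1: "(LINT t:{x..x+1}|lborel. U1 t) = 1" for x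
    using density_mass[OF U0c U0(2) less_imp_le[OF pos(1)] U0(6) pr(1)]
      density_mass[OF U1c U1(2) less_imp_le[OF pos(2)] U1(6) pr(2)] by auto
  have UM: "U0 x \<le> M" "U1 x \<le> M" for x
  proof -
    have "U0 x \<le> 1 + sqrt (\<integral>p. (g0 p)\<^sup>2 \<partial>lebesgue_circle)"
      using density_upper_bound[OF U0(1,2,4)] mass0[of 0] by simp
    also have "\<dots> \<le> M" unfolding M_def using U0(5) by simp
    finally show "U0 x \<le> M" .
    have "U1 x \<le> 1 + sqrt (\<integral>p. (g1 p)\<^sup>2 \<partial>lebesgue_circle)"
      using density_upper_bound[OF U1(1,2,4)] mass1[of 0] by simp
    also have "\<dots> \<le> M" unfolding M_def using U1(5) by simp
    finally show "U1 x \<le> M" .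
  qed
  obtain X P A F0 where q0: "quantile_map X P A" and UP: "\<And>z. U0 (X z) * P z = 1"
    and law0: "density lebesgue_circle (\<lambda>p. ennreal (U0 (circle_rep p))) = circle_law X"
    and F0: "\<And>z. F0 (X z) = z" "\<And>x. X (F0 x) = x" "F0 0 = 0" "\<And>x. F0 (x + 1) = F0 x + 1" "\<And>x. (F0 has_real_derivative U0 x) (at x)"
    by (rule quantile_map_exists[OF U0(1,2) pos(1) U0(4) mass0]) (rule that, assumption+)
  obtain Y0 Q0 C0 F1 where q1: "quantile_map Y0 Q0 C0" and UQ0: "\<And>z. U1 (Y0 z) * Q0 z = 1"
    and F1: "\<And>z. F1 (Y0 z) = z" "\<And>x. Y0 (F1 x) = x" "F1 0 = 0" "\<And>x. F1 (x + 1) = F1 x + 1" "\<And>x. (F1 has_real_derivative U1 x) (at x)"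
    by (rule quantile_map_exists[OF U1(1,2) pos(2) U1(4) mass1]) (rule that, assumption+)
  note D = quantile_mapD[OF q0]
  have F0c: "continuous_on S F0" and F1c: "continuous_on S F1" for S
    using F0(5) F1(5) by (meson DERIV_isCont continuous_at_imp_continuous_on)+
  \<comment> \<open>This shift makes the pairing of X with the second quantile map optimal.\<close>
  obtain \<theta> where mean: "(LINT x:{0..1}|lborel. x - Y0 (F0 x + \<theta>)) = 0"
    using mean_zero_shift[OF quantile_mapD(8)[OF q1] quantile_mapD(4)[OF q1] F0c] by blast
  define Y Q C where "Y z = Y0 (z + \<theta>)" and "Q z = Q0 (z + \<theta>)" and "C z = C0 (z + \<theta>)" for z
  have qY: "quantile_map Y Q C"
    using quantile_map_shift[OF q1, of \<theta>] by (simp add: Y_def[abs_def] Q_def[abs_def] C_def[abs_def])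
  note E = quantile_mapD[OF qY]
  have UQ: "U1 (Y z) * Q z = 1" for z by (simp add: Y_def Q_def UQ0)
  have \<nu>0: "\<nu>0 = circle_law X" using U0(6) law0 by (simp add: has_density_def)
  \<comment> \<open>A shift of the parameter keeps U1 (Y z) * Q z = 1, hence the law.\<close>
  have \<nu>1: "\<nu>1 = circle_law Y"
    using U1(6) density_eq_circle_law[OF E(1,9,2,4) borel_measurable_continuous_onI[OF U1c] U1(2) UQ]
    by (simp add: has_density_def)
  have bounds: "1 / M \<le> P z" "1 / M \<le> Q z" "P z \<le> 1 / l" "Q z \<le> 1 / l" for z
  proof -
    have *: "1 / M \<le> p \<and> p \<le> 1 / l" if "u * p = 1" "l \<le> u" "u \<le> M" for u p :: real
    proof -
      have "u \<noteq> 0" using that(1) by auto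
      then have "p = 1 / u" using that(1) by (simp add: field_simps)
      then show ?thesis using that l by (auto intro!: divide_left_mono mult_pos_pos)
    qed
    show "1 / M \<le> P z" "P z \<le> 1 / l" using *[OF UP U0(3) UM(1)] by auto
    show "1 / M \<le> Q z" "Q z \<le> 1 / l" using *[OF UQ U1(3) UM(2)] by auto
  qed
  \<comment> \<open>The transport map on the line and its inverse.\<close>
  define S R where "S x = Y (F0 x)" and "R y = X (F1 y - \<theta>)" for x y
  have Sc: "continuous_on UNIV S"
    unfolding S_def by (rule continuous_on_compose2[OF E(8) F0c]) auto
  have Rc: "continuous_on UNIV R"
    unfolding R_def by (rule continuous_on_compose2[OF D(8)[of UNIV] continuous_on_diff[OF F1c continuous_on_const]]) auto
  have Smono: "strict_mono S"
    unfolding S_def using strict_mono_if_DERIV_pos[OF E(1,2)] strict_mono_if_DERIV_pos[OF F0(5) pos(1)]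
    by (simp add: strict_mono_def)
  have Sper: "S (x + 1) = S x + 1" for x by (simp add: S_def F0(4) E(4))
  have RS: "R (S x) = x" and SR: "S (R x) = x" for x by (simp_all add: S_def R_def Y_def F0 F1)
  have meanS: "(LINT x:{0..1}|lborel. x - S x) = 0" using mean by (simp add: S_def Y_def)
  have YS: "Y z = S (X z)" for z by (simp add: S_def F0(1))
  have F1Y: "F1 (Y z) = z + \<theta>" for z by (simp add: Y_def F1(1))
  \<comment> \<open>The closeness l / 8 of the densities is tailored to give the displacement bound
    1/4.\<close>
  have "l * \<bar>Y z - X z\<bar> \<le> 2 * (l / 8)" for z
    by (rule quantile_maps_close[OF F0 F1Y F1(3,4,5) E(8) l U1(3) close meanS[unfolded S_def]])
  then have small: "\<bar>Y z - X z\<bar> \<le> 1 / 4" for z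
    using l by (simp add: field_simps)
  define V \<Lambda> where "V = (LINT z:{0..1}|lborel. (Y z - X z)\<^sup>2)" and "\<Lambda> = (LINT z:{0..1}|lborel. (C z - A z)\<^sup>2)"
  note geo = wasserstein_geodesic_circle_law[OF D(8) YS Sc Smono Sper Rc RS SR meanS small \<gamma>[unfolded \<nu>0 \<nu>1]]
  have W: "(W2 (circle_law X) (circle_law Y))\<^sup>2 = V" unfolding V_def by (rule geo(1))
  have \<gamma>0: "\<gamma> 0 = circle_law X" and \<gamma>1: "\<gamma> 1 = circle_law Y" using geo(2)[of 0] geo(2)[of 1] by simp_all
  define I where "I s = (LINT z:{0..1}|lborel. ((1 - s) * A z + s * C z)\<^sup>2 / ((1 - s) * P z + s * Q z) ^ 5)" for s
  have energy: "dirichlet_energy (\<gamma> s) = ereal (1 / 2 * I s)" if "s \<in> {0..1}" for s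
    unfolding geo(2)[OF that] I_def by (rule dirichlet_energy_circle_law[OF quantile_map_convex_comb[OF q0 qY that]])
  have I0: "I 0 \<le> B" and I1: "I 1 \<le> B"
    using energy[of 0] energy[of 1] dirichlet_energy_eq[OF U0(1,2,4,6)] dirichlet_energy_eq[OF U1(1,2,4,6)] U0(5) U1(5)
    by (simp_all add: \<gamma>0 \<gamma>1 \<nu>0 \<nu>1)
  have sumsq: "(LINT z:{0..1}|lborel. (A z)\<^sup>2 + (C z)\<^sup>2) \<le> 2 * B * (1 / l) ^ 5"
  proof -
    have "(LINT z:{0..1}|lborel. (A z)\<^sup>2 + (C z)\<^sup>2) = (LINT z:{0..1}|lborel. (A z)\<^sup>2) + (LINT z:{0..1}|lborel. (C z)\<^sup>2)"
      by (rule set_integral_add(2)[OF D(7) E(7)])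
    also have "\<dots> \<le> (1 / l) ^ 5 * I 0 + (1 / l) ^ 5 * I 1"
      using quantile_square_integral_le[OF q0 bounds(3)] quantile_square_integral_le[OF qY bounds(4)]
      by (simp add: I_def)
    also have "\<dots> \<le> (1 / l) ^ 5 * B + (1 / l) ^ 5 * B"
      using I0 I1 l by (intro add_mono mult_left_mono) auto
    finally show ?thesis by (simp add: mult_ac)
  qed
  define N where "N = 2 * t * \<Lambda> + V / (4 * t ^ 3)"
  have sup: "(Q z - P z)\<^sup>2 \<le> N" if "z \<in> {0..1}" for z
    unfolding N_def \<Lambda>_def V_def
  proof (rule periodic_interpolation[OF _ _ _ _ _ tpos that])
    show "((\<lambda>z. Y z - X z) has_real_derivative Q z - P z) (at z)" for z by (rule DERIV_diff[OF E(1) D(1)])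
    show "Y 1 - X 1 = Y 0 - X 0" using D(4)[of 0] E(4)[of 0] by simp
    show "ac_deriv (\<lambda>z. Q z - P z) (\<lambda>z. C z - A z)"
      using ac_deriv_add[OF E(3) ac_deriv_cmult[OF D(3), of "-1"]] by simp
    show "Q 1 - P 1 = Q 0 - P 0" using D(5)[of 0] E(5)[of 0] by simp
    have "(C z - A z)\<^sup>2 = (C z)\<^sup>2 + (A z)\<^sup>2 - 2 * (C z * A z)" for z by (simp add: power2_eq_square algebra_simps)
    moreover have "set_integrable lborel {0..1} (\<lambda>z. (C z)\<^sup>2 + (A z)\<^sup>2 - 2 * (C z * A z))"
      by (intro set_integral_diff(1) set_integral_add(1) set_integrable_mult_right D(7) E(7)
          set_integrable_mult_if_square[OF E(10,7) D(10,7)])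
    ultimately show "set_integrable lborel {0..1} (\<lambda>z. (C z - A z)\<^sup>2)" by simp
  qed
  have N0: "0 \<le> N" using sup[of 0] by (simp add: order_trans[OF zero_le_power2])
  show ?thesis
    unfolding convex_along_def
  proof
    fix s :: real assume s: "s \<in> {0..1}"
    have "0 < 1 / M" using Mpos by simp
    note ineq = energy_semiconvex[OF q0 qY this bounds(1,2) bounds(3,4) sup s]
    have "70 / (1 / M) ^ 7 * N * (LINT z:{0..1}|lborel. (A z)\<^sup>2 + (C z)\<^sup>2) \<le> 70 * M ^ 7 * N * (2 * B * (1 / l) ^ 5)"
    proof -
      have "70 / (1 / M) ^ 7 * N = 70 * M ^ 7 * N" by (simp add: power_divide)
      moreover have "70 * M ^ 7 * N * (LINT z:{0..1}|lborel. (A z)\<^sup>2 + (C z)\<^sup>2) \<le> 70 * M ^ 7 * N * (2 * B * (1 / l) ^ 5)"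
        using N0 Mpos by (intro mult_left_mono sumsq) auto
      ultimately show ?thesis by simp
    qed
    also have "\<dots> = K * N" unfolding K M_def[symmetric] by (simp add: mult_ac)
    \<comment> \<open>Here the tuning of t enters: the \<Lambda> term matches the negative term of
      \<open>energy_semiconvex\<close> with L = 1 / l.\<close>
    also have "K * N = \<Lambda> / (1 / l) ^ 5 + K * V / (4 * t ^ 3)"
    proof -
      have "K * (2 * t) = 1 / (1 / l) ^ 5" unfolding t using Kpos l by (simp add: field_simps)
      then have "K * (2 * t * \<Lambda>) = \<Lambda> / (1 / l) ^ 5" by (metis mult.assoc mult.commute times_divide_eq_right mult.right_neutral)
      then show ?thesis by (simp add: N_def distrib_left)
    qed
    finally have "70 / (1 / M) ^ 7 * N * (LINT z:{0..1}|lborel. (A z)\<^sup>2 + (C z)\<^sup>2) - \<Lambda> / (1 / l) ^ 5 \<le> K * V / (4 * t ^ 3)"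
      by simp
    then have "s * (1 - s) / 2 * (70 / (1 / M) ^ 7 * N * (LINT z:{0..1}|lborel. (A z)\<^sup>2 + (C z)\<^sup>2) - \<Lambda> / (1 / l) ^ 5)
        \<le> s * (1 - s) / 2 * (K * V / (4 * t ^ 3))"
      using s by (intro mult_left_mono) auto
    moreover have "I s \<le> (1 - s) * I 0 + s * I 1
        + s * (1 - s) / 2 * (70 / (1 / M) ^ 7 * N * (LINT z:{0..1}|lborel. (A z)\<^sup>2 + (C z)\<^sup>2) - \<Lambda> / (1 / l) ^ 5)"
      using ineq by (simp add: I_def \<Lambda>_def)
    ultimately have "I s \<le> (1 - s) * I 0 + s * I 1 + s * (1 - s) / 2 * (K * V / (4 * t ^ 3))"
      by linarith
    then have "1 / 2 * I s \<le> (1 - s) * (1 / 2 * I 0) + s * (1 / 2 * I 1) - (- K / (8 * t ^ 3)) / 2 * s * (1 - s) * V"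
      using tpos by (simp add: field_simps)
    then show "dirichlet_energy (\<gamma> s) \<le> ereal (1 - s) * dirichlet_energy (\<gamma> 0) + ereal s * dirichlet_energy (\<gamma> 1)
       - ereal (- K / (8 * t ^ 3) / 2 * s * (1 - s) * (W2 (\<gamma> 0) (\<gamma> 1))\<^sup>2)"
      using energy[OF s] energy[of 0] energy[of 1] by (simp add: \<gamma>0 \<gamma>1 W)
  qed
qed

theorem theorem3p6:
  fixes c m :: real
  assumes "m > 0"
  shows "\<exists>lam::real. \<forall>\<mu>\<in>P2. \<forall>u::circle \<Rightarrow> real.
    has_density \<mu> u \<longrightarrow> dirichlet_energy \<mu> < ereal c \<longrightarrow> (\<forall>x. u x > m) \<longrightarrow>
    restricted_convex dirichlet_energy lam c \<mu>"
proof -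
  \<comment> \<open>Energy below c bounds the integral of the squared derivative by 2 c; the
    absolute value and the 1 make B positive.\<close>
  define B where "B = 2 * (\<bar>c\<bar> + 1)"
  define K where "K = 140 * (1 + sqrt B) ^ 7 * (1 / (m / 2)) ^ 5 * B"
  define t where "t = 1 / (2 * K * (1 / (m / 2)) ^ 5)"
  \<comment> \<open>Two densities within e of U differ by at most m / 16 = (m / 2) / 8, as required
    with l = m / 2, and each stays above m - m / 32, hence above m / 2.\<close>
  define e where "e = m / 32"
  define \<delta> where "\<delta> = e / 4 * (min (1/2) (e\<^sup>2 / (16 * B)))\<^sup>2"
  have B: "0 < B" by (simp add: B_def)
  have e: "0 < e" using assms by (simp add: e_def)
  have "min (1/2) (e\<^sup>2 / (16 * B)) > 0" using e B by simp
  then have \<delta>: "0 < \<delta>" unfolding \<delta>_def using e by (intro mult_pos_pos zero_less_power) auto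
  have gB: "(\<integral>p. (g p)\<^sup>2 \<partial>lebesgue_circle) \<le> B"
    if "dirichlet_energy \<nu> < ereal c" "dirichlet_energy \<nu> = ereal (1 / 2 * (\<integral>p. (g p)\<^sup>2 \<partial>lebesgue_circle))" for \<nu> g
    using that by (simp add: B_def)
  show ?thesis
  proof (intro exI[of _ "- K / (8 * t ^ 3)"] ballI allI impI)
    fix \<mu> u
    assume \<mu>: "\<mu> \<in> P2" "has_density \<mu> u" "dirichlet_energy \<mu> < ereal c" and um: "\<forall>x. m < u x"
    have "dirichlet_energy \<mu> < \<infinity>" using \<mu>(3) by (rule less_le_trans) simp
    then obtain U g where U: "ac_deriv U (\<lambda>x. g (to_circle x))" "\<And>x. U (x + 1) = U x" "g \<in> L2_circle"
      "has_density \<mu> (\<lambda>p. U (circle_rep p))" "\<And>x. 0 \<le> U x"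
      "dirichlet_energy \<mu> = ereal (1 / 2 * (\<integral>p. (g p)\<^sup>2 \<partial>lebesgue_circle))"
      by (rule dirichlet_energy_finiteE) (rule that, assumption+)
    \<comment> \<open>The bound on the given density passes to the continuous representative U,
      first almost everywhere and then everywhere.\<close>
    have "AE p in lebesgue_circle. u p = U (circle_rep p)" by (rule has_density_unique[OF \<mu>(2) U(4)])
    then have "AE p in lebesgue_circle. m \<le> U (circle_rep p)"
      by (rule eventually_mono) (metis um less_imp_le)
    then have Um: "m \<le> U x" for x by (rule AE_lebesgue_circle_le_continuous[OF ac_deriv_continuous[OF U(1)] U(2)])
    note UB = gB[OF \<mu>(3) U(6)]
    show "restricted_convex dirichlet_energy (- K / (8 * t ^ 3)) c \<mu>"
      unfolding restricted_convex_def
    proof (intro exI[of _ \<delta>] conjI ballI allI impI)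
      fix \<nu>0 \<nu>1 \<gamma>
      assume \<nu>0: "\<nu>0 \<in> P2" "W2 \<mu> \<nu>0 < \<delta>" "dirichlet_energy \<nu>0 < ereal c"
        and \<nu>1: "\<nu>1 \<in> P2" "W2 \<mu> \<nu>1 < \<delta>" "dirichlet_energy \<nu>1 < ereal c"
        and \<gamma>: "wasserstein_geodesic \<nu>0 \<nu>1 \<gamma>"
      have "dirichlet_energy \<nu>0 < \<infinity>" using \<nu>0(3) by (rule less_le_trans) simp
      then obtain U0 g0 where U0: "ac_deriv U0 (\<lambda>x. g0 (to_circle x))" "\<And>x. U0 (x + 1) = U0 x" "g0 \<in> L2_circle"
        "has_density \<nu>0 (\<lambda>p. U0 (circle_rep p))" "\<And>x. 0 \<le> U0 x"
        "dirichlet_energy \<nu>0 = ereal (1 / 2 * (\<integral>p. (g0 p)\<^sup>2 \<partial>lebesgue_circle))"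
        by (rule dirichlet_energy_finiteE) (rule that, assumption+)
      have "dirichlet_energy \<nu>1 < \<infinity>" using \<nu>1(3) by (rule less_le_trans) simp
      then obtain U1 g1 where U1: "ac_deriv U1 (\<lambda>x. g1 (to_circle x))" "\<And>x. U1 (x + 1) = U1 x" "g1 \<in> L2_circle"
        "has_density \<nu>1 (\<lambda>p. U1 (circle_rep p))" "\<And>x. 0 \<le> U1 x"
        "dirichlet_energy \<nu>1 = ereal (1 / 2 * (\<integral>p. (g1 p)\<^sup>2 \<partial>lebesgue_circle))"
        by (rule dirichlet_energy_finiteE) (rule that, assumption+)
      note B0 = gB[OF \<nu>0(3) U0(6)] and B1 = gB[OF \<nu>1(3) U1(6)]
      have c0: "\<bar>U x - U0 x\<bar> < e" for x
        by (rule sup_close_if_W2_close[OF U(1,2,5,3) UB U(4) U0(1,2,5,3) B0 U0(4) \<mu>(1) \<nu>0(1) e B \<nu>0(2)[unfolded \<delta>_def]])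
      have c1: "\<bar>U x - U1 x\<bar> < e" for x
        by (rule sup_close_if_W2_close[OF U(1,2,5,3) UB U(4) U1(1,2,5,3) B1 U1(4) \<mu>(1) \<nu>1(1) e B \<nu>1(2)[unfolded \<delta>_def]])
      have low: "m / 2 \<le> U0 x" "m / 2 \<le> U1 x" and close: "\<bar>U1 x - U0 x\<bar> \<le> m / 2 / 8" for x
        using c0[of x] c1[of x] Um[of x] assms unfolding e_def by linarith+
      show "convex_along dirichlet_energy (- K / (8 * t ^ 3)) \<gamma>"
        by (rule geodesic_semiconvex[OF U0(1,2) low(1) U0(3) B0 U0(4) U1(1,2) low(2) U1(3) B1 U1(4)
              \<nu>0(1) \<nu>1(1) _ B close K_def t_def \<gamma>]) (use assms in simp)
    qed (rule \<delta>)
  qed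
qed

end
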